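(* Let $\mathscr{H}$ and $\mathscr{U}$ be complex Hilbert spaces, $\mathbb{T}$ a strongly continuous semigroup on $\mathscr{H}$ with generator $\mathcal{A}$, $\mathcal{B}$ an admissible control operator for $\mathbb{T}$, $T>0$, $x_0,x_T\in\mathscr{H}$, $U\subseteq L^2((0,T);\mathscr{U})$ a closed convex set, $\theta\colon\mathscr{H}\times\mathscr{U}\times[0,T]\to\mathbb{R}$, and $g_j\colon\mathscr{H}\times[0,T]\to\mathbb{R}$, $j\in J=\{1,\dots,l\}$. Consider $$\min_{(x,u)}\ \mathcal{I}(x,u)=\int_0^T\theta(x(t),u(t),t)\,dt\quad\text{subject to}\quad\dot x(t)=\mathcal{A}x(t)+\mathcal{B}u(t),\ t\in[0,T],$$ $$x(0)=x_0,\ x(T)=x_T,\ u\in U,\quad g_j(x(t),t)\le0\ \ \forall t\in[0,T],\ j\in J.\qquad(\ast)$$ Let $X=C([0,T];\mathscr{H})\times L^2((0,T);\mathscr{U})$, let $A$ be the set of all $(x,u)\in X$ with $u\in U$, $x(T)=x_T$ and $x(t)=\mathbb{T}_tx_0+F_tu$ for all $t\in[0,T]$, and put $\varphi(x,u)=\sup_{t\in[0,T]}\max\{g_1(x(t),t),\dots,g_l(x(t),t),0\}$, $\Phi_\lambda=\mathcal{I}+\lambda\varphi$. Suppose that: 1. $\theta$ is continuous, and for any $R>0$ there exist $C_R>0$ and an a.e. nonnegative $\omega_R\in L^1(0,T)$ such that $|\theta(x,u,t)|\le C_R\|u\|_{\mathscr{U}}^2+\omega_R(t)$ for all $x\in\mathscr{H}$,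 $u\in\mathscr{U}$, $t\in(0,T)$ with $\|x\|_{\mathscr{H}}\le R$; 2. either $U$ is bounded in $L^2((0,T);\mathscr{U})$, or there exist $C_1>0$ and $\omega\in L^1(0,T)$ such that $\theta(x,u,t)\ge C_1\|u\|_{\mathscr{U}}^2+\omega(t)$ for all $x\in\mathscr{H}$, $u\in\mathscr{U}$ and a.e. $t\in[0,T]$; 3. $\theta$ is differentiable in $x$ and $u$, the functions $\nabla_x\theta$ and $\nabla_u\theta$ are continuous, and for any $R>0$ there exist $C_R>0$ and a.e. nonnegative functions $\omega_R\in L^1(0,T)$, $\eta_R\in L^2(0,T)$ such that $\|\nabla_x\theta(x,u,t)\|_{\mathscr{H}}\le C_R\|u\|_{\mathscr{U}}^2+\omega_R(t)$ and $\|\nabla_u\theta(x,u,t)\|_{\mathscr{U}}\le C_R\|u\|_{\mathscr{U}}+\eta_R(t)$ for all $x\in\mathscr{H}$, $u\in\mathscr{U}$, $t\in(0,T)$ with $\|x\|_{\mathscr{H}}\le R$; 4. there exists a globally optimal solution of $(\ast)$; 5. the functions $g_j(x,t)$, $j\in J$, are convex in $x$ and continuous jointly in $x$ and $t$, and Slater's condition holds: there exists $(\widehat{x},\widehat{u})\in A$ such that $g_j(\widehat{x}(t),t)<0$ for all $t\in[0,T]$ and $j\in J$. Then for all $c\in\mathbb{R}$ there exists $\lambda^*(c)\ge0$ such that for any $\lambda\ge\lambda^*(c)$ the penalty function $\Phi_\lambda$ for problem $(\ast)$ is completely exact on the set $S_\lambda(c)$.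
   Context: Control system: let $\mathscr{H}_{-1}$ be the extrapolation space of $\mathscr{H}$ (completion of $\mathscr{H}$ in the norm $\|(\beta I-\mathcal{A})^{-1}\cdot\|$, $\beta$ in the resolvent set of $\mathcal{A}$), to which $\mathbb{T}$ extends. A bounded linear $\mathcal{B}\colon\mathscr{U}\to\mathscr{H}_{-1}$ is an admissible control operator for $\mathbb{T}$ if for some $\tau>0$ the map $F_\tau u=\int_0^\tau\mathbb{T}_{\tau-\sigma}\mathcal{B}u(\sigma)\,d\sigma$ takes values in $\mathscr{H}$ for all $u\in L^2((0,\infty);\mathscr{U})$. Then for each $t\ge0$ the input map $F_tu=\int_0^t\mathbb{T}_{t-\sigma}\mathcal{B}u(\sigma)\,d\sigma$ is a bounded operator into $\mathscr{H}$, and for $u\in L^2((0,T);\mathscr{U})$ the unique solution in $C([0,T];\mathscr{H})$ of $\dot x=\mathcal{A}x+\mathcal{B}u$, $x(0)=x_0$ is $x(t)=\mathbb{T}_tx_0+F_tu$. $L^2((0,T);\mathscr{U})$ has its standard norm; $X$ carries the sum norm. Gradients of the real-valued $\theta$ are taken with respect to the underlying real Hilbert space structure. $\Omega=\{(x,u)\in A\mid\varphi(x,u)=0\}$ is the feasible set of $(\ast)$, $S_\lambda(c)=\{(x,u)\in A\mid\Phi_\lambda(x,u)<c\}$. For $K\subseteq X$, $f\colon X\to\mathbb{R}$ and $z\in K$, $f^{\downarrow}_K(z)=\liminf_{y\to z,\,y\in K}\frac{f(y)-f(z)}{\|y-z\|_X}$ ($+\infty$ if $z$ is isolated in $K$);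 $z$ is an inf-stationary point of $f$ on $K$ if $f^{\downarrow}_K(z)\ge0$. $\Phi_\lambda$ is completely exact on $S_\lambda(c)$ if: (1) the optimal values of $\min_\Omega\mathcal{I}$ and $\min_A\Phi_\lambda$ coincide; (2) their globally optimal solutions coincide; (3) $z\in S_\lambda(c)$ is a locally optimal solution of $\min_A\Phi_\lambda$ iff $z\in\Omega$ and $z$ is a locally optimal solution of $\min_\Omega\mathcal{I}$; (4) $z\in S_\lambda(c)$ is an inf-stationary point of $\Phi_\lambda$ on $A$ iff $z\in\Omega$ and $z$ is an inf-stationary point of $\mathcal{I}$ on $\Omega$. Local optimality is with respect to the norm of $X$. *)

theory Defs
  imports "HOL-Analysis.Analysis"
begin

section \<open>Complex Banach and Hilbert spaces\<close>

text \<open>The norm, topology and completeness are those of the underlying real space; the real inner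
  product is the real part of the Hermitian one.\<close>

class complex_normed_vector = real_normed_vector +
  fixes scaleC :: "complex \<Rightarrow> 'a \<Rightarrow> 'a" (infixr "*\<^sub>C" 75)
  assumes scaleC_add_right: "c *\<^sub>C (x + y) = c *\<^sub>C x + c *\<^sub>C y"
    and scaleC_add_left: "(c + d) *\<^sub>C x = c *\<^sub>C x + d *\<^sub>C x"
    and scaleC_scaleC: "c *\<^sub>C (d *\<^sub>C x) = (c * d) *\<^sub>C x"
    and scaleC_of_real: "complex_of_real r *\<^sub>C x = r *\<^sub>R x"
    and norm_scaleC: "norm (c *\<^sub>C x) = cmod c * norm x"

class complex_banach = complex_normed_vector + complete_space

class complex_inner = complex_normed_vector + real_inner +
  fixes cinner :: "'a \<Rightarrow> 'a \<Rightarrow> complex"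
  assumes cinner_commute: "cinner x y = cnj (cinner y x)"
    and cinner_add_left: "cinner (x + y) z = cinner x z + cinner y z"
    and cinner_scaleC_left: "cinner (c *\<^sub>C x) y = c * cinner x y"
    and inner_eq_Re_cinner: "inner x y = Re (cinner x y)"

class complex_hilbert = complex_inner + complete_space

definition bounded_clinear :: "('a::complex_normed_vector \<Rightarrow> 'b::complex_normed_vector) \<Rightarrow> bool" where
  "bounded_clinear f \<longleftrightarrow> bounded_linear f \<and> (\<forall>c x. f (c *\<^sub>C x) = c *\<^sub>C f x)"


section \<open>Bochner integration and square-integrable functions\<close>

text \<open>The Bochner integral of the library is restricted to second-countable target spaces. The
  following is the same notion for arbitrary, possibly non-separable, normed spaces; Borel
  measurability is replaced by strong measurability.\<close>

definition strongly_measurable :: "'a measure \<Rightarrow> ('a \<Rightarrow> 'b::real_normed_vector) \<Rightarrow> bool" where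
  "strongly_measurable M f \<longleftrightarrow>
     (\<exists>s. (\<forall>n::nat. simple_function M (s n)) \<and> (AE t in M. (\<lambda>n. s n t) \<longlonglongrightarrow> f t))"

definition has_Bochner_integral :: "'a measure \<Rightarrow> ('a \<Rightarrow> 'b::real_normed_vector) \<Rightarrow> 'b \<Rightarrow> bool" where
  "has_Bochner_integral M f y \<longleftrightarrow> strongly_measurable M f \<and>
     (\<exists>s. (\<forall>n::nat. Bochner_Integration.simple_bochner_integrable M (s n)) \<and>
          (\<lambda>n. \<integral>\<^sup>+t. ennreal (norm (f t - s n t)) \<partial>M) \<longlonglongrightarrow> 0 \<and>
          (\<lambda>n. Bochner_Integration.simple_bochner_integral M (s n)) \<longlonglongrightarrow> y)"

definition Bochner_integral :: "'a measure \<Rightarrow> ('a \<Rightarrow> 'b::real_normed_vector) \<Rightarrow> 'b" where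
  "Bochner_integral M f = (THE y. has_Bochner_integral M f y)"

text \<open>Elements of \<open>L\<^sup>2\<close> are represented by functions; equality almost everywhere is
  expressed by the vanishing of the seminorm \<open>L2_norm\<close> of the difference.\<close>

definition L2 :: "'a measure \<Rightarrow> ('a \<Rightarrow> 'b::real_normed_vector) set" where
  "L2 M = {u. strongly_measurable M u \<and> integrable M (\<lambda>t. (norm (u t))\<^sup>2)}"

definition L2_norm :: "'a measure \<Rightarrow> ('a \<Rightarrow> 'b::real_normed_vector) \<Rightarrow> real" where
  "L2_norm M u = sqrt (\<integral>t. (norm (u t))\<^sup>2 \<partial>M)"

text \<open>A set of representatives that is closed in this sense is automatically saturated with
  respect to equality almost everywhere, hence it corresponds to a closed set of classes.\<close>

definition L2_closed :: "'a measure \<Rightarrow> ('a \<Rightarrow> 'b::real_normed_vector) set \<Rightarrow> bool" where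
  "L2_closed M U \<longleftrightarrow>
     (\<forall>v w. (\<forall>n::nat. v n \<in> U) \<and> w \<in> L2 M \<and> (\<lambda>n. L2_norm M (\<lambda>t. v n t - w t)) \<longlonglongrightarrow> 0 \<longrightarrow> w \<in> U)"

definition L2_convex :: "(real \<Rightarrow> 'b::real_normed_vector) set \<Rightarrow> bool" where
  "L2_convex U \<longleftrightarrow>
     (\<forall>u\<in>U. \<forall>v\<in>U. \<forall>a\<in>{0..1}. (\<lambda>t. (1 - a) *\<^sub>R u t + a *\<^sub>R v t) \<in> U)"


section \<open>Semigroups, the extrapolation space and admissible control operators\<close>

definition C0_semigroup :: "(real \<Rightarrow> 'h::complex_normed_vector \<Rightarrow> 'h) \<Rightarrow> bool" where
  "C0_semigroup S \<longleftrightarrow>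
     (\<forall>t\<ge>0. bounded_clinear (S t)) \<and> (\<forall>x. S 0 x = x) \<and>
     (\<forall>s\<ge>0. \<forall>t\<ge>0. \<forall>x. S (s + t) x = S s (S t x)) \<and>
     (\<forall>x. ((\<lambda>t. S t x) \<longlongrightarrow> x) (at_right 0))"

definition generator_domain :: "(real \<Rightarrow> 'h::complex_normed_vector \<Rightarrow> 'h) \<Rightarrow> 'h set" where
  "generator_domain S = {x. \<exists>y. ((\<lambda>h. (S h x - x) /\<^sub>R h) \<longlongrightarrow> y) (at_right 0)}"

definition generator :: "(real \<Rightarrow> 'h::complex_normed_vector \<Rightarrow> 'h) \<Rightarrow> 'h \<Rightarrow> 'h" where
  "generator S x = Lim (at_right 0) (\<lambda>h. (S h x - x) /\<^sub>R h)"

definition resolvent :: "(real \<Rightarrow> 'h::complex_normed_vector \<Rightarrow> 'h) \<Rightarrow> complex \<Rightarrow> 'h \<Rightarrow> 'h" where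
  "resolvent S \<beta> = inv_into (generator_domain S) (\<lambda>x. \<beta> *\<^sub>C x - generator S x)"

definition resolvent_set :: "(real \<Rightarrow> 'h::complex_normed_vector \<Rightarrow> 'h) \<Rightarrow> complex set" where
  "resolvent_set S =
     {\<beta>. bij_betw (\<lambda>x. \<beta> *\<^sub>C x - generator S x) (generator_domain S) UNIV \<and>
          bounded_clinear (resolvent S \<beta>)}"

text \<open>The complete space \<open>'e\<close> with the embedding \<open>j\<close> is a completion of \<open>'h\<close> with respect to the
  norm of the resolvent. For \<open>\<beta>\<close> in the resolvent set this determines the pair up to a unique
  isometric isomorphism.\<close>

definition extrapolation_space ::
  "(real \<Rightarrow> 'h::complex_hilbert \<Rightarrow> 'h) \<Rightarrow> complex \<Rightarrow> ('h \<Rightarrow> 'e::complex_banach) \<Rightarrow> bool" where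
  "extrapolation_space S \<beta> j \<longleftrightarrow>
     (\<forall>x y. j (x + y) = j x + j y) \<and> (\<forall>c x. j (c *\<^sub>C x) = c *\<^sub>C j x) \<and>
     (\<forall>x. norm (j x) = norm (resolvent S \<beta> x)) \<and> closure (range j) = UNIV"

definition extended_semigroup ::
  "('h::complex_hilbert \<Rightarrow> 'e::complex_banach) \<Rightarrow> (real \<Rightarrow> 'h \<Rightarrow> 'h) \<Rightarrow> real \<Rightarrow> 'e \<Rightarrow> 'e" where
  "extended_semigroup j S t = (THE E. bounded_clinear E \<and> (\<forall>x. E (j x) = j (S t x)))"

definition input_integral ::
  "('h::complex_hilbert \<Rightarrow> 'e::complex_banach) \<Rightarrow> (real \<Rightarrow> 'h \<Rightarrow> 'h) \<Rightarrow> ('u::complex_hilbert \<Rightarrow> 'e)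
     \<Rightarrow> real \<Rightarrow> (real \<Rightarrow> 'u) \<Rightarrow> 'e" where
  "input_integral j S B t u =
     Bochner_integral (lebesgue_on {0<..<t}) (\<lambda>\<sigma>. extended_semigroup j S (t - \<sigma>) (B (u \<sigma>)))"

definition admissible_control_operator ::
  "('h::complex_hilbert \<Rightarrow> 'e::complex_banach) \<Rightarrow> (real \<Rightarrow> 'h \<Rightarrow> 'h) \<Rightarrow> ('u::complex_hilbert \<Rightarrow> 'e)
     \<Rightarrow> bool" where
  "admissible_control_operator j S B \<longleftrightarrow> bounded_clinear B \<and>
     (\<exists>\<tau>>0. \<forall>u\<in>L2 (lebesgue_on {0<..}). input_integral j S B \<tau> u \<in> range j)"

text \<open>The input map as an operator into \<open>'h\<close>: the preimage under the embedding \<open>j\<close>.\<close>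

definition input_map ::
  "('h::complex_hilbert \<Rightarrow> 'e::complex_banach) \<Rightarrow> (real \<Rightarrow> 'h \<Rightarrow> 'h) \<Rightarrow> ('u::complex_hilbert \<Rightarrow> 'e)
     \<Rightarrow> real \<Rightarrow> (real \<Rightarrow> 'u) \<Rightarrow> 'h" where
  "input_map j S B t u = inv j (input_integral j S B t u)"


section \<open>The optimal control problem and its penalty function\<close>

text \<open>The space \<open>X = C([0,T]; H) \<times> L\<^sup>2((0,T); U)\<close> with the distance of its sum norm. Since elements
  are represented by functions on the real line, the distance is a pseudometric: distance zero
  means equality in \<open>X\<close>.\<close>

definition X_space ::
  "real \<Rightarrow> ((real \<Rightarrow> 'h::complex_hilbert) \<times> (real \<Rightarrow> 'u::complex_hilbert)) set" where
  "X_space T = {(x, u). continuous_on {0..T} x \<and> u \<in> L2 (lebesgue_on {0<..<T})}"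

definition X_dist ::
  "real \<Rightarrow> (real \<Rightarrow> 'h::complex_hilbert) \<times> (real \<Rightarrow> 'u::complex_hilbert)
     \<Rightarrow> (real \<Rightarrow> 'h) \<times> (real \<Rightarrow> 'u) \<Rightarrow> real" where
  "X_dist T = (\<lambda>(x, u) (y, v).
     (SUP t\<in>{0..T}. norm (x t - y t)) + L2_norm (lebesgue_on {0<..<T}) (\<lambda>t. u t - v t))"

definition admissible_pairs ::
  "('h::complex_hilbert \<Rightarrow> 'e::complex_banach) \<Rightarrow> (real \<Rightarrow> 'h \<Rightarrow> 'h) \<Rightarrow> ('u::complex_hilbert \<Rightarrow> 'e)
     \<Rightarrow> real \<Rightarrow> 'h \<Rightarrow> 'h \<Rightarrow> (real \<Rightarrow> 'u) set \<Rightarrow> ((real \<Rightarrow> 'h) \<times> (real \<Rightarrow> 'u)) set" where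
  "admissible_pairs j S B T x\<^sub>0 x\<^sub>T U =
     {(x, u) \<in> X_space T. u \<in> U \<and> x T = x\<^sub>T \<and> (\<forall>t\<in>{0..T}. x t = S t x\<^sub>0 + input_map j S B t u)}"

definition cost ::
  "real \<Rightarrow> ('h \<Rightarrow> 'u \<Rightarrow> real \<Rightarrow> real) \<Rightarrow> (real \<Rightarrow> 'h) \<times> (real \<Rightarrow> 'u) \<Rightarrow> real" where
  "cost T \<theta> = (\<lambda>(x, u). \<integral>t. \<theta> (x t) (u t) t \<partial>lebesgue_on {0<..<T})"

definition constraint_violation ::
  "real \<Rightarrow> nat \<Rightarrow> (nat \<Rightarrow> 'h \<Rightarrow> real \<Rightarrow> real) \<Rightarrow> (real \<Rightarrow> 'h) \<times> (real \<Rightarrow> 'u) \<Rightarrow> real" where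
  "constraint_violation T l g = (\<lambda>(x, u).
     SUP t\<in>{0..T}. Max (insert 0 ((\<lambda>j. g j (x t) t) ` {1..l})))"

definition feasible_set ::
  "((real \<Rightarrow> 'h) \<times> (real \<Rightarrow> 'u)) set \<Rightarrow> real \<Rightarrow> nat \<Rightarrow> (nat \<Rightarrow> 'h \<Rightarrow> real \<Rightarrow> real)
     \<Rightarrow> ((real \<Rightarrow> 'h) \<times> (real \<Rightarrow> 'u)) set" where
  "feasible_set A T l g = {z \<in> A. constraint_violation T l g z = 0}"

definition penalty ::
  "real \<Rightarrow> ('h \<Rightarrow> 'u \<Rightarrow> real \<Rightarrow> real) \<Rightarrow> nat \<Rightarrow> (nat \<Rightarrow> 'h \<Rightarrow> real \<Rightarrow> real) \<Rightarrow> real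
     \<Rightarrow> (real \<Rightarrow> 'h) \<times> (real \<Rightarrow> 'u) \<Rightarrow> real" where
  "penalty T \<theta> l g lam z = cost T \<theta> z + lam * constraint_violation T l g z"


section \<open>Optimality, inf-stationarity and complete exactness\<close>

definition globally_optimal :: "('z \<Rightarrow> real) \<Rightarrow> 'z set \<Rightarrow> 'z \<Rightarrow> bool" where
  "globally_optimal f K z \<longleftrightarrow> z \<in> K \<and> (\<forall>y\<in>K. f z \<le> f y)"

definition locally_optimal :: "('z \<Rightarrow> 'z \<Rightarrow> real) \<Rightarrow> ('z \<Rightarrow> real) \<Rightarrow> 'z set \<Rightarrow> 'z \<Rightarrow> bool" where
  "locally_optimal d f K z \<longleftrightarrow> z \<in> K \<and> (\<exists>r>0. \<forall>y\<in>K. d y z < r \<longrightarrow> f z \<le> f y)"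

text \<open>The filter of punctured neighbourhoods of \<open>z\<close> within \<open>K\<close> for a pseudometric \<open>d\<close>. It is
  \<open>bot\<close> if \<open>z\<close> is isolated in \<open>K\<close>, and then the limit inferior below is \<open>\<infinity>\<close>.\<close>

definition punctured_nhds :: "('z \<Rightarrow> 'z \<Rightarrow> real) \<Rightarrow> 'z set \<Rightarrow> 'z \<Rightarrow> 'z filter" where
  "punctured_nhds d K z = (INF r\<in>{0<..}. principal {y\<in>K. 0 < d y z \<and> d y z < r})"

definition lower_slope :: "('z \<Rightarrow> 'z \<Rightarrow> real) \<Rightarrow> ('z \<Rightarrow> real) \<Rightarrow> 'z set \<Rightarrow> 'z \<Rightarrow> ereal" where
  "lower_slope d f K z = Liminf (punctured_nhds d K z) (\<lambda>y. ereal ((f y - f z) / d y z))"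

definition inf_stationary :: "('z \<Rightarrow> 'z \<Rightarrow> real) \<Rightarrow> ('z \<Rightarrow> real) \<Rightarrow> 'z set \<Rightarrow> 'z \<Rightarrow> bool" where
  "inf_stationary d f K z \<longleftrightarrow> z \<in> K \<and> lower_slope d f K z \<ge> 0"

definition completely_exact ::
  "('z \<Rightarrow> 'z \<Rightarrow> real) \<Rightarrow> ('z \<Rightarrow> real) \<Rightarrow> 'z set \<Rightarrow> ('z \<Rightarrow> real) \<Rightarrow> 'z set \<Rightarrow> 'z set \<Rightarrow> bool" where
  "completely_exact d I \<Omega> \<Phi> A C \<longleftrightarrow>
     (INF z\<in>\<Omega>. ereal (I z)) = (INF z\<in>A. ereal (\<Phi> z)) \<and>
     {z. globally_optimal I \<Omega> z} = {z. globally_optimal \<Phi> A z} \<and>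
     (\<forall>z\<in>C. locally_optimal d \<Phi> A z \<longleftrightarrow> z \<in> \<Omega> \<and> locally_optimal d I \<Omega> z) \<and>
     (\<forall>z\<in>C. inf_stationary d \<Phi> A z \<longleftrightarrow> z \<in> \<Omega> \<and> inf_stationary d I \<Omega> z)"

end

(* The penalty function is exact because Slater's condition gives a linear error bound. If z in A is
   infeasible, move from z towards the Slater point zh along the segment (1 - s) z + s zh: by convexity
   of the constraints the violation drops at least by s (phi z + delta), where delta is the margin at
   zh, while the cost changes by at most L s d(z, zh), because it is Lipschitz on bounded sets. For
   lam > L D / delta every infeasible point of a bounded sublevel set therefore has a direction of
   uniform descent, and a feasible point with a smaller penalty value lies within s D of it. This
   yields all four parts of complete exactness.

   Coercivity bounds the controls in a sublevel set, but the states must be bounded as well, uniformly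
   in time. This is the boundedness of the input map F_T from L^2 to H. It is only known that
   F_T u lies in H; since F_T is bounded into the larger extrapolation space, its graph is closed, so
   Zabreiko's lemma applies. Delaying the control by T - t gives F_t from F_T, hence a bound that is
   uniform in t, and F_(s+t) u = T_t F_s u + F_t u(s + .) carries the hypothesis from the time tau to T. *)

theory Submission
  imports Defs "HOL-Library.Function_Algebras"
begin

section \<open>Penalty functions with a linear error bound\<close>

text \<open>The cost is not convex, so everything takes place in a set that is stable under moves
  towards the Slater point: the pairs in A whose control has norm at most K, where K dominates the
  controls of a sublevel set as well as the Slater control. There the states are uniformly bounded,
  the growth conditions for the gradients give one Lipschitz constant L, and D bounds the distance
  to the Slater point. Descent shows that infeasible points are neither locally optimal nor
  stationary. At a feasible z the converse implications need a comparison: a nearby infeasible y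
  with smaller penalty value has violation at most L d(y, z), so the feasible point restored from y
  lies within (1 + L D / delta) d(y, z) of z, and radii and tolerances shrink by this factor. Two
  features shape the technical part. The spaces need not be separable, so measurability means a.e.
  approximation by simple functions, and integral and completeness of L^2 are built on that.
  Controls are functions rather than classes, so the distance is a pseudometric, and distance zero
  needs separate treatment.\<close>

lemma lower_slope_nonneg_iff:
  "0 \<le> lower_slope d f K z \<longleftrightarrow>
     (\<forall>e>0. \<exists>r>0. \<forall>y\<in>K. 0 < d y z \<and> d y z < r \<longrightarrow> - e * d y z < f y - f z)"
proof -
  \<comment> \<open>The sets \<open>P r\<close> shrink with \<open>r\<close>, so they form a filter
    base and the Liminf becomes a condition on one radius per tolerance. At an isolated point it is
    vacuous, in agreement with the value \<infinity> of the Liminf over \<open>bot\<close>.\<close>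
  define P where "P r = {y\<in>K. 0 < d y z \<and> d y z < r}" for r :: real
  have ev: "eventually Q (punctured_nhds d K z) \<longleftrightarrow> (\<exists>r>0. \<forall>y\<in>P r. Q y)" for Q
    unfolding punctured_nhds_def P_def[symmetric]
  proof (subst eventually_INF_base)
    fix a b :: real assume "a \<in> {0<..}" "b \<in> {0<..}"
    then show "\<exists>x\<in>{0<..}. principal (P x) \<le> inf (principal (P a)) (principal (P b))"
      by (intro bexI[of _ "min a b"]) (auto simp: P_def)
  qed (auto simp: eventually_principal)
  have quot: "ereal (- e) < ereal ((f y - f z) / d y z) \<longleftrightarrow> - e * d y z < f y - f z"
    if "0 < d y z" for e y
    using that by (simp add: pos_less_divide_eq)
  show ?thesis
  proof
    assume L: "0 \<le> lower_slope d f K z"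
    show "\<forall>e>0. \<exists>r>0. \<forall>y\<in>K. 0 < d y z \<and> d y z < r \<longrightarrow> - e * d y z < f y - f z"
    proof (intro allI impI)
      fix e :: real assume "0 < e"
      then have "ereal (- e) < 0" by simp
      then have "eventually (\<lambda>y. ereal (- e) < ereal ((f y - f z) / d y z)) (punctured_nhds d K z)"
        using L unfolding lower_slope_def le_Liminf_iff by blast
      then show "\<exists>r>0. \<forall>y\<in>K. 0 < d y z \<and> d y z < r \<longrightarrow> - e * d y z < f y - f z"
        unfolding ev P_def using quot by auto
    qed
  next
    assume R: "\<forall>e>0. \<exists>r>0. \<forall>y\<in>K. 0 < d y z \<and> d y z < r \<longrightarrow> - e * d y z < f y - f z"
    show "0 \<le> lower_slope d f K z"
      unfolding lower_slope_def le_Liminf_iff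
    proof (intro allI impI)
      fix a :: ereal assume "a < 0"
      \<comment> \<open>\<open>a\<close> may be -\<infinity>, so a negative real \<open>b\<close>
        above it supplies the tolerance \<open>- b\<close>.\<close>
      then obtain b :: real where b: "a < ereal b" "ereal b < 0"
        using ereal_dense2 by blast
      then have "0 < - b" by simp
      then obtain r where "r > 0" and r: "\<forall>y\<in>K. 0 < d y z \<and> d y z < r \<longrightarrow> b * d y z < f y - f z"
        using R[rule_format, of "- b"] by auto
      have "a < ereal ((f y - f z) / d y z)" if "y \<in> P r" for y
      proof -
        have "ereal (- (- b)) < ereal ((f y - f z) / d y z)"
          using that r by (subst quot) (auto simp: P_def)
        then show ?thesis using b(1) by (simp add: order.strict_trans)
      qed
      then show "eventually (\<lambda>y. a < ereal ((f y - f z) / d y z)) (punctured_nhds d K z)"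
        unfolding ev using \<open>r > 0\<close> by blast
    qed
  qed
qed

text \<open>The abstract core. \<open>Q\<close> collects points on which \<open>I\<close> is
  Lipschitz and which restoring moves do not leave; a sublevel set of a nonconvex \<open>I\<close>
  need not be stable in this way. In \<open>restore\<close>, \<open>s\<close> is the fraction of the
  way towards a Slater point, \<open>D\<close> bounds the full way and \<open>\<delta>\<close> is
  the margin at its end. Strict positivity of the distance makes the move visible to difference
  quotients.\<close>

lemma completely_exact_on_sublevel:
  fixes d :: "'z \<Rightarrow> 'z \<Rightarrow> real" and I \<phi> :: "'z \<Rightarrow> real" and L D \<delta> lam c :: real
  assumes d_nonneg: "\<And>y z. y \<in> A \<Longrightarrow> z \<in> A \<Longrightarrow> 0 \<le> d y z"
    and d_triangle: "\<And>x y z. x \<in> A \<Longrightarrow> y \<in> A \<Longrightarrow> z \<in> A \<Longrightarrow> d x z \<le> d x y + d y z"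
    and \<phi>_nonneg: "\<And>z. z \<in> A \<Longrightarrow> 0 \<le> \<phi> z"
    and \<Omega>: "\<Omega> = {z\<in>A. \<phi> z = 0}"
    and opt: "globally_optimal I \<Omega> z0" "I z0 < c"
    and pos: "0 < \<delta>" "0 \<le> L" "0 < D"
    and Q: "Q \<subseteq> A" "\<And>z. z \<in> A \<Longrightarrow> I z < c \<Longrightarrow> z \<in> Q"
    and lip: "\<And>y z. y \<in> Q \<Longrightarrow> z \<in> Q \<Longrightarrow> \<bar>I y - I z\<bar> \<le> L * d y z"
    and restore: "\<And>z s. z \<in> Q \<Longrightarrow> 0 < \<phi> z \<Longrightarrow> 0 < s \<Longrightarrow> s \<le> 1 \<Longrightarrow>
        \<exists>w\<in>Q. d w z \<le> s * D \<and> 0 < d w z \<and> \<phi> w \<le> max 0 ((1 - s) * \<phi> z - s * \<delta>)"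
    and lam: "L * D / \<delta> + 1 \<le> lam"
  shows "completely_exact d I \<Omega> (\<lambda>z. I z + lam * \<phi> z) A {z\<in>A. I z + lam * \<phi> z < c}"
proof -
  let ?\<Phi> = "\<lambda>z. I z + lam * \<phi> z"
  have LD: "0 \<le> L * D" "0 \<le> L * D / \<delta>" using pos by auto
  \<comment> \<open>The summand 1 serves twice: it makes the gain \<open>lam * \<delta>\<close>
    strictly exceed the loss \<open>L * D\<close>, and it gives \<open>1 \<le> lam\<close>, by which
    the penalty term bounds the violation itself.\<close>
  have lam1: "1 \<le> lam" "L * D < lam * \<delta>"
  proof -
    show "1 \<le> lam" using lam LD by linarith
    have "L * D / \<delta> < lam" using lam by linarith
    then show "L * D < lam * \<delta>" using pos by (simp add: pos_divide_less_eq)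
  qed
  have in\<Omega>: "z \<in> \<Omega> \<longleftrightarrow> z \<in> A \<and> \<phi> z = 0" for z using \<Omega> by auto
  have pos\<phi>: "0 < \<phi> z" if "z \<in> A" "z \<notin> \<Omega>" for z using that \<phi>_nonneg[of z] in\<Omega> by force
  have inQ: "z \<in> Q" if "z \<in> A" "?\<Phi> z < c" for z
  proof -
    have "0 \<le> lam * \<phi> z" using lam1 \<phi>_nonneg[OF that(1)] by simp
    then show ?thesis using Q(2) that by simp
  qed
  \<comment> \<open>\<open>\<kappa>\<close> is the net decrease of the penalty function per unit of
    \<open>s\<close>; since a move has length at most \<open>s * D\<close>, the slope of descent is
    at least \<open>\<kappa> / D\<close>.\<close>
  define \<kappa> where "\<kappa> = lam * \<delta> - L * D"
  have \<kappa>: "0 < \<kappa>" using lam1 by (simp add: \<kappa>_def)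
  \<comment> \<open>Up to \<open>s = \<phi> z / (\<phi> z + \<delta>)\<close> the affine bound on
    the violation is nonnegative, so the maximum with 0 in \<open>restore\<close> is that bound and
    the decrease is linear in \<open>s\<close>.\<close>
  have descent: "\<exists>w\<in>Q. d w z \<le> s * D \<and> 0 < d w z \<and> ?\<Phi> w \<le> ?\<Phi> z - s * \<kappa> \<and>
      \<phi> w \<le> (1 - s) * \<phi> z - s * \<delta>"
    if z: "z \<in> Q" "0 < \<phi> z" and s: "0 < s" "s \<le> \<phi> z / (\<phi> z + \<delta>)" for z s
  proof -
    have pd: "0 < \<phi> z + \<delta>" using z pos by simp
    then have s\<phi>: "s * (\<phi> z + \<delta>) \<le> \<phi> z" using s(2) by (simp add: pos_le_divide_eq)
    have "\<phi> z / (\<phi> z + \<delta>) \<le> 1" using pd pos by simp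
    then have "s \<le> 1" using s by linarith
    then obtain w where w: "w \<in> Q" "d w z \<le> s * D" "0 < d w z"
      "\<phi> w \<le> max 0 ((1 - s) * \<phi> z - s * \<delta>)"
      using restore z s by blast
    have nn: "0 \<le> (1 - s) * \<phi> z - s * \<delta>" using s\<phi> by (simp add: algebra_simps)
    then have \<phi>w: "\<phi> w \<le> (1 - s) * \<phi> z - s * \<delta>" using w(4) by simp
    have "I w - I z \<le> L * d w z" using lip[OF w(1) z(1)] by simp
    also have "\<dots> \<le> L * (s * D)" using w(2) pos by (simp add: mult_left_mono)
    finally have Iw: "I w - I z \<le> s * (L * D)" by (simp add: mult_ac)
    have "lam * \<phi> w \<le> lam * ((1 - s) * \<phi> z - s * \<delta>)" using \<phi>w lam1 by simp
    also have "\<dots> = lam * \<phi> z - s * (lam * \<delta>) - lam * (s * \<phi> z)" by (simp add: algebra_simps)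
    also have "\<dots> \<le> lam * \<phi> z - s * (lam * \<delta>)" using lam1 s z by simp
    finally have "?\<Phi> w \<le> ?\<Phi> z - s * \<kappa>" using Iw by (simp add: \<kappa>_def algebra_simps)
    then show ?thesis using w \<phi>w by blast
  qed
  \<comment> \<open>At the largest such \<open>s\<close> the violation vanishes; the point reached
    is feasible and its cost equals its penalty value.\<close>
  have to\<Omega>: "\<exists>w\<in>Q. w \<in> \<Omega> \<and> I w < ?\<Phi> z \<and> d w z \<le> (\<phi> z / (\<phi> z + \<delta>)) * D"
    if z: "z \<in> Q" "z \<notin> \<Omega>" for z
  proof -
    have \<phi>: "0 < \<phi> z" using z Q pos\<phi> by auto
    define s where "s = \<phi> z / (\<phi> z + \<delta>)"
    have s: "0 < s" "s \<le> \<phi> z / (\<phi> z + \<delta>)" using \<phi> pos by (auto simp: s_def)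
    have "(1 - s) * \<phi> z - s * \<delta> = 0"
    proof -
      have "s * (\<phi> z + \<delta>) = \<phi> z" using \<phi> pos by (simp add: s_def)
      then show ?thesis by (simp add: algebra_simps)
    qed
    then obtain w where w: "w \<in> Q" "d w z \<le> s * D" "?\<Phi> w \<le> ?\<Phi> z - s * \<kappa>" "\<phi> w \<le> 0"
      using descent[OF z(1) \<phi> s] by fastforce
    then have "\<phi> w = 0" using \<phi>_nonneg[of w] Q by force
    moreover have "0 < s * \<kappa>" using s \<kappa> by simp
    ultimately show ?thesis using w Q in\<Omega> by (intro bexI[of _ w]) (auto simp: s_def)
  qed
  have z0: "z0 \<in> \<Omega>" "z0 \<in> A" "\<phi> z0 = 0" "\<And>y. y \<in> \<Omega> \<Longrightarrow> I z0 \<le> I y"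
    using opt(1) in\<Omega> by (auto simp: globally_optimal_def)
  \<comment> \<open>Inside the sublevel set restoration compares with a feasible point; outside it
    \<open>I z0 < c\<close> already suffices.\<close>
  have low: "I z0 \<le> ?\<Phi> z" if zA: "z \<in> A" for z
  proof (cases "z \<in> \<Omega>")
    case True then show ?thesis using z0 in\<Omega> by auto
  next
    case z\<Omega>: False
    show ?thesis
    proof (cases "?\<Phi> z < c")
      case True
      then obtain w where "w \<in> \<Omega>" "I w < ?\<Phi> z" using to\<Omega>[OF inQ[OF zA True] z\<Omega>] by blast
      then show ?thesis using z0(4)[of w] by simp
    next
      case False then show ?thesis using opt(2) by linarith
    qed
  qed
  \<comment> \<open>The descent is available at arbitrarily small positive distance, which excludes
    local optimality and stationarity alike.\<close>
  have not\<Omega>: "\<exists>w\<in>A. 0 < d w z \<and> d w z < r \<and> ?\<Phi> w \<le> ?\<Phi> z - \<kappa> / D * d w z"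
    if z: "z \<in> A" "?\<Phi> z < c" "z \<notin> \<Omega>" and r: "0 < r" for z r
  proof -
    have \<phi>: "0 < \<phi> z" using z pos\<phi> by auto
    \<comment> \<open>The second bound gives \<open>s * D \<le> r / 2\<close>, strictly inside the
      ball of radius \<open>r\<close>.\<close>
    define s where "s = min (\<phi> z / (\<phi> z + \<delta>)) (r / (2 * D))"
    have s: "0 < s" "s \<le> \<phi> z / (\<phi> z + \<delta>)" "s \<le> r / (2 * D)" using \<phi> pos r by (auto simp: s_def)
    obtain w where w: "w \<in> Q" "d w z \<le> s * D" "0 < d w z" "?\<Phi> w \<le> ?\<Phi> z - s * \<kappa>"
      using descent[OF inQ[OF z(1,2)] \<phi> s(1,2)] by blast
    have "s * D \<le> r / 2" using mult_right_mono[OF s(3), of D] pos by simp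
    then have "d w z < r" using w r by linarith
    moreover have "\<kappa> / D * d w z \<le> \<kappa> / D * (s * D)" using w \<kappa> pos by (intro mult_left_mono) auto
    then have "\<kappa> / D * d w z \<le> s * \<kappa>" using pos by (simp add: mult.commute)
    ultimately show ?thesis using w Q by (intro bexI[of _ w]) auto
  qed
  \<comment> \<open>A better infeasible \<open>y\<close> near a feasible \<open>z\<close> yields a
    better feasible \<open>w\<close> nearby. As
    \<open>\<phi> y \<le> lam * \<phi> y < I z - I y \<le> L * d y z\<close>, restoring
    \<open>y\<close> costs a distance of at most \<open>L * D / \<delta> * d y z\<close>; the 1
    accounts for the way between \<open>y\<close> and \<open>z\<close>.\<close>
  have near: "\<exists>w\<in>\<Omega>. I w < ?\<Phi> y \<and> d w z \<le> (1 + L * D / \<delta>) * d y z \<and> w \<in> Q"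
    if z: "z \<in> \<Omega>" "I z < c" and y: "y \<in> A" "y \<notin> \<Omega>" "?\<Phi> y < I z" for y z
  proof -
    have zA: "z \<in> A" "\<phi> z = 0" using z in\<Omega> by auto
    have zQ: "z \<in> Q" using inQ z zA by simp
    have yQ: "y \<in> Q" using inQ y z by simp
    have \<phi>: "0 < \<phi> y" using y pos\<phi> by simp
    have "\<phi> y \<le> lam * \<phi> y"
      using mult_right_mono[OF lam1(1) \<phi>_nonneg[OF y(1)]] by simp
    also have "\<dots> \<le> I z - I y" using y by simp
    also have "\<dots> \<le> L * d y z" using lip[OF yQ zQ] by simp
    finally have \<phi>y: "\<phi> y \<le> L * d y z" .
    obtain w where w: "w \<in> Q" "w \<in> \<Omega>" "I w < ?\<Phi> y" "d w y \<le> (\<phi> y / (\<phi> y + \<delta>)) * D"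
      using to\<Omega>[OF yQ y(2)] by blast
    have "\<phi> y / (\<phi> y + \<delta>) \<le> L * d y z / \<delta>"
      using \<phi> \<phi>y pos by (intro frac_le) auto
    then have "d w y \<le> L * d y z / \<delta> * D"
      using w(4) pos by (meson mult_right_mono order.trans less_imp_le)
    also have "\<dots> = L * D / \<delta> * d y z" by simp
    finally have "d w z \<le> L * D / \<delta> * d y z + d y z"
      using d_triangle[of w y z] w Q y zA by force
    then show ?thesis using w by (auto simp: algebra_simps)
  qed
  have ratio: "0 < 1 + L * D / \<delta>" using LD by linarith
  show ?thesis
    unfolding completely_exact_def
  proof (intro conjI ballI)
    have "(INF z\<in>\<Omega>. ereal (I z)) = ereal (I z0)"
      using z0 by (intro antisym INF_lower INF_greatest) auto
    moreover have "(INF z\<in>A. ereal (?\<Phi> z)) = ereal (I z0)"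
    proof (rule antisym)
      show "(INF z\<in>A. ereal (?\<Phi> z)) \<le> ereal (I z0)"
        using INF_lower[OF z0(2), of "\<lambda>z. ereal (?\<Phi> z)"] z0(3) by simp
    qed (use low in \<open>auto intro!: INF_greatest\<close>)
    ultimately show "(INF z\<in>\<Omega>. ereal (I z)) = (INF z\<in>A. ereal (?\<Phi> z))" by simp
  next
    have "globally_optimal I \<Omega> z \<longleftrightarrow> globally_optimal ?\<Phi> A z" for z
    proof
      assume "globally_optimal I \<Omega> z"
      then have z: "z \<in> \<Omega>" "I z \<le> I z0" using z0(1) by (auto simp: globally_optimal_def)
      then show "globally_optimal ?\<Phi> A z" using low in\<Omega> by (fastforce simp: globally_optimal_def)
    next
      assume g: "globally_optimal ?\<Phi> A z"
      then have z: "z \<in> A" "\<And>y. y \<in> A \<Longrightarrow> ?\<Phi> z \<le> ?\<Phi> y" by (auto simp: globally_optimal_def)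
      \<comment> \<open>A minimiser of the penalty function is not above \<open>z0\<close>, hence
        lies in the sublevel set where restoration applies.\<close>
      have "?\<Phi> z < c" using z(2)[OF z0(2)] z0(3) opt(2) by simp
      then have "z \<in> \<Omega>" using to\<Omega>[OF inQ[OF z(1)]] z in\<Omega> by fastforce
      then show "globally_optimal I \<Omega> z" using z(2) in\<Omega> by (force simp: globally_optimal_def)
    qed
    then show "{z. globally_optimal I \<Omega> z} = {z. globally_optimal ?\<Phi> A z}" by simp
  next
    fix z assume "z \<in> {z\<in>A. ?\<Phi> z < c}"
    then have z: "z \<in> A" "?\<Phi> z < c" by auto
    show "locally_optimal d ?\<Phi> A z \<longleftrightarrow> z \<in> \<Omega> \<and> locally_optimal d I \<Omega> z"
    proof
      assume "locally_optimal d ?\<Phi> A z"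
      then obtain r where r: "0 < r" "\<And>y. y \<in> A \<Longrightarrow> d y z < r \<Longrightarrow> ?\<Phi> z \<le> ?\<Phi> y"
        by (auto simp: locally_optimal_def)
      have "z \<in> \<Omega>"
      proof (rule ccontr)
        assume "z \<notin> \<Omega>"
        then obtain w where w: "w \<in> A" "0 < d w z" "d w z < r" "?\<Phi> w \<le> ?\<Phi> z - \<kappa> / D * d w z"
          using not\<Omega>[OF z _ r(1)] by blast
        moreover have "0 < \<kappa> / D * d w z" using w \<kappa> pos by simp
        ultimately show False using r(2)[OF w(1,3)] by linarith
      qed
      then show "z \<in> \<Omega> \<and> locally_optimal d I \<Omega> z"
        using r in\<Omega> by (force simp: locally_optimal_def)
    next
      assume "z \<in> \<Omega> \<and> locally_optimal d I \<Omega> z"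
      then obtain r where z\<Omega>: "z \<in> \<Omega>"
        and r: "0 < r" "\<And>y. y \<in> \<Omega> \<Longrightarrow> d y z < r \<Longrightarrow> I z \<le> I y"
        by (auto simp: locally_optimal_def)
      have \<phi>z: "\<phi> z = 0" using z\<Omega> in\<Omega> by simp
      have Iz: "I z < c" using z \<phi>z by simp
      \<comment> \<open>The feasible competitor from \<open>near\<close> may be farther away by the
        factor \<open>1 + L * D / \<delta>\<close>; the smaller radius keeps it within
        \<open>r\<close>.\<close>
      define r' where "r' = min r (r / (1 + L * D / \<delta>))"
      have "?\<Phi> z \<le> ?\<Phi> y" if y: "y \<in> A" "d y z < r'" for y
      proof (rule ccontr)
        assume n: "\<not> ?\<Phi> z \<le> ?\<Phi> y"
        then have less: "?\<Phi> y < I z" using \<phi>z by simp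
        have "y \<notin> \<Omega>" using r(2)[of y] y less in\<Omega> by (force simp: r'_def)
        then obtain w where w: "w \<in> \<Omega>" "I w < ?\<Phi> y" "d w z \<le> (1 + L * D / \<delta>) * d y z"
          using near[OF z\<Omega> Iz y(1) _ less] by blast
        have "d y z < r / (1 + L * D / \<delta>)" using y by (simp add: r'_def)
        then have "(1 + L * D / \<delta>) * d y z < r"
          using ratio by (metis mult.commute pos_less_divide_eq)
        then have "I z \<le> I w" using r(2) w by simp
        then show False using w less by linarith
      qed
      moreover have "0 < r'" using r ratio by (simp add: r'_def)
      ultimately show "locally_optimal d ?\<Phi> A z" using z by (auto simp: locally_optimal_def)
    qed
    show "inf_stationary d ?\<Phi> A z \<longleftrightarrow> z \<in> \<Omega> \<and> inf_stationary d I \<Omega> z"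
      unfolding inf_stationary_def lower_slope_nonneg_iff conj_left_absorb
    proof safe
      assume st: "\<forall>e>0. \<exists>r>0. \<forall>y\<in>A. 0 < d y z \<and> d y z < r \<longrightarrow> - e * d y z < ?\<Phi> y - ?\<Phi> z"
      show z\<Omega>: "z \<in> \<Omega>"
      proof (rule ccontr)
        assume n: "z \<notin> \<Omega>"
        have "0 < \<kappa> / D" using \<kappa> pos by simp
        then obtain r where r: "0 < r"
          "\<And>y. y \<in> A \<Longrightarrow> 0 < d y z \<Longrightarrow> d y z < r \<Longrightarrow> - (\<kappa> / D) * d y z < ?\<Phi> y - ?\<Phi> z"
          using st by blast
        obtain w where "w \<in> A" "0 < d w z" "d w z < r" "?\<Phi> w \<le> ?\<Phi> z - \<kappa> / D * d w z"
          using not\<Omega>[OF z n r(1)] by blast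
        then show False using r(2)[of w] by simp
      qed
      fix e :: real assume "0 < e"
      then obtain r where r: "0 < r" "\<forall>y\<in>A. 0 < d y z \<and> d y z < r \<longrightarrow> - e * d y z < ?\<Phi> y - ?\<Phi> z"
        using st by blast
      then show "\<exists>r>0. \<forall>y\<in>\<Omega>. 0 < d y z \<and> d y z < r \<longrightarrow> - e * d y z < I y - I z"
        using z\<Omega> in\<Omega> by (intro exI[of _ r]) auto
    next
      assume z\<Omega>: "z \<in> \<Omega>"
        and st: "\<forall>e>0. \<exists>r>0. \<forall>y\<in>\<Omega>. 0 < d y z \<and> d y z < r \<longrightarrow> - e * d y z < I y - I z"
      fix e :: real assume e: "0 < e"
      have \<phi>z: "\<phi> z = 0" using z\<Omega> in\<Omega> by simp
      have Iz: "I z < c" using z \<phi>z by simp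
      let ?m = "1 + L * D / \<delta>"
      \<comment> \<open>The competitor may be \<open>?m\<close> times farther from \<open>z\<close>
        than \<open>y\<close> is, so stationarity is used with the tolerance divided by
        \<open>?m\<close>.\<close>
      have "0 < e / ?m" using e ratio by simp
      then obtain r where r: "0 < r"
        "\<And>y. y \<in> \<Omega> \<Longrightarrow> 0 < d y z \<Longrightarrow> d y z < r \<Longrightarrow> - (e / ?m) * d y z < I y - I z"
        using st by blast
      have em: "e / ?m \<le> e"
        using mult_left_mono[of 1 ?m e] e LD by (simp add: pos_divide_le_eq[OF ratio])
      define r' where "r' = min r (r / ?m)"
      have "- e * d y z < ?\<Phi> y - ?\<Phi> z" if y: "y \<in> A" "0 < d y z" "d y z < r'" for y
      proof (rule ccontr)
        assume n: "\<not> - e * d y z < ?\<Phi> y - ?\<Phi> z"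
        have ed: "0 < e * d y z" using e y by simp
        have less: "?\<Phi> y < I z" using n ed \<phi>z by simp
        have "y \<notin> \<Omega>"
        proof
          assume "y \<in> \<Omega>"
          then have "- (e / ?m) * d y z < ?\<Phi> y - ?\<Phi> z"
            using r(2)[of y] y \<phi>z in\<Omega> by (simp add: r'_def)
          moreover have "e / ?m * d y z \<le> e * d y z" using em y by (intro mult_right_mono) auto
          ultimately show False using n by linarith
        qed
        then obtain w where w: "w \<in> \<Omega>" "I w < ?\<Phi> y" "d w z \<le> ?m * d y z" "w \<in> Q"
          using near[OF z\<Omega> Iz y(1) _ less] by blast
        have "d y z < r / ?m" using y by (simp add: r'_def)
        then have dr: "?m * d y z < r"
          using ratio by (metis mult.commute pos_less_divide_eq)
        have "- (e * d y z) \<le> I w - I z"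
        proof (cases "0 < d w z")
          case True
          have "e / ?m * d w z \<le> e / ?m * (?m * d y z)"
            using w e ratio by (intro mult_left_mono) auto
          also have "\<dots> = e * d y z" using ratio by simp
          finally show ?thesis using r(2)[OF w(1) True] w dr by simp
        next
          \<comment> \<open>At distance zero stationarity says nothing, but the Lipschitz bound
            gives equal costs.\<close>
          case False
          then have "d w z = 0" using d_nonneg[of w z] w z in\<Omega> by force
          then have "I w = I z" using lip[OF w(4) inQ[OF z]] by simp
          then show ?thesis using ed by simp
        qed
        then show False using n w \<phi>z by simp
      qed
      moreover have "0 < r'" using r ratio by (simp add: r'_def)
      ultimately show "\<exists>r>0. \<forall>y\<in>A. 0 < d y z \<and> d y z < r \<longrightarrow> - e * d y z < ?\<Phi> y - ?\<Phi> z"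
        by blast
    qed (use z in\<Omega> in auto)
  qed
qed

section \<open>Bochner integrals with values in a non-separable space\<close>

text \<open>Completeness makes a.e. limits of real simple functions Borel measurable. Finiteness
  makes all simple functions integrable and functions in \<open>L2\<close> integrable in
  norm.\<close>

locale complete_finite_measure = complete_measure M + finite_measure M for M :: "'a measure"

lemma complete_finite_measure_lebesgue_on:
  "complete_finite_measure (lebesgue_on {a<..<b::real})"
proof -
  have "{a<..<b} \<in> lmeasurable" by (metis lmeasurable_box box_real(1))
  then interpret finite_measure "lebesgue_on {a<..<b}" by (rule finite_measure_lebesgue_on)
  show ?thesis
  proof
    fix A B :: "real set"
    assume "B \<subseteq> A" "A \<in> null_sets (lebesgue_on {a<..<b})"
    then have "A \<in> null_sets lebesgue" "A \<subseteq> {a<..<b}"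
      by (auto simp: null_sets_restrict_space)
    then show "B \<in> sets (lebesgue_on {a<..<b})"
      using \<open>B \<subseteq> A\<close> completion.complete[of B A lborel]
      by (auto simp: sets_restrict_space_iff)
  qed
qed

abbreviation simple_integral :: "'a measure \<Rightarrow> ('a \<Rightarrow> 'b::real_normed_vector) \<Rightarrow> 'b" where
  "simple_integral \<equiv> Bochner_Integration.simple_bochner_integral"

abbreviation L1_dist :: "'a measure \<Rightarrow> ('a \<Rightarrow> 'b::real_normed_vector) \<Rightarrow> ('a \<Rightarrow> 'b) \<Rightarrow> ennreal" where
  "L1_dist M f g \<equiv> \<integral>\<^sup>+t. ennreal (norm (f t - g t)) \<partial>M"

abbreviation Leb :: "real \<Rightarrow> real measure" where "Leb t \<equiv> lebesgue_on {0<..<t}"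

section \<open>Closure properties of strong measurability\<close>

lemma strongly_measurable_simple: "simple_function M f \<Longrightarrow> strongly_measurable M f"
  unfolding strongly_measurable_def by (intro exI[of _ "\<lambda>_. f"]) simp

lemma strongly_measurable_cong_AE:
  assumes "strongly_measurable M f" "AE t in M. f t = g t"
  shows "strongly_measurable M g"
proof -
  obtain s where s: "\<And>n::nat. simple_function M (s n)" "AE t in M. (\<lambda>n. s n t) \<longlonglongrightarrow> f t"
    using assms(1) by (auto simp: strongly_measurable_def)
  have "AE t in M. (\<lambda>n. s n t) \<longlonglongrightarrow> g t" using s(2) assms(2) by eventually_elim simp
  then show ?thesis using s(1) by (auto simp: strongly_measurable_def)
qed

text \<open>Any \<open>p\<close> of two simple functions is simple, as only finitely many pairs of
  values occur; continuity carries the a.e. limit over.\<close>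

lemma strongly_measurable_compose2:
  assumes "strongly_measurable M f" "strongly_measurable M g"
    and p: "continuous_on UNIV (case_prod p)"
  shows "strongly_measurable M (\<lambda>t. p (f t) (g t))"
proof -
  obtain s where s: "\<And>n::nat. simple_function M (s n)" "AE t in M. (\<lambda>n. s n t) \<longlonglongrightarrow> f t"
    using assms(1) by (auto simp: strongly_measurable_def)
  obtain r where r: "\<And>n::nat. simple_function M (r n)" "AE t in M. (\<lambda>n. r n t) \<longlonglongrightarrow> g t"
    using assms(2) by (auto simp: strongly_measurable_def)
  have "AE t in M. (\<lambda>n. p (s n t) (r n t)) \<longlonglongrightarrow> p (f t) (g t)"
    using s(2) r(2)
  proof eventually_elim
    case (elim t)
    then have "(\<lambda>n. (s n t, r n t)) \<longlonglongrightarrow> (f t, g t)" by (rule tendsto_Pair)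
    from continuous_on_tendsto_compose[OF p this] show ?case by simp
  qed
  moreover have "simple_function M (\<lambda>t. p (s n t) (r n t))" for n
    using s(1) r(1) by (rule simple_function_compose2)
  ultimately show ?thesis
    unfolding strongly_measurable_def by (intro exI[of _ "\<lambda>n t. p (s n t) (r n t)"]) simp
qed

lemma strongly_measurable_compose:
  assumes "strongly_measurable M f" "continuous_on UNIV p"
  shows "strongly_measurable M (\<lambda>t. p (f t))"
proof -
  have "continuous_on UNIV (\<lambda>z. p (fst z))"
    by (rule continuous_on_compose2[OF assms(2) continuous_on_fst]) auto
  then show ?thesis
    using strongly_measurable_compose2[OF assms(1) assms(1), of "\<lambda>a b. p a"]
    by (simp add: case_prod_beta')
qed

lemma strongly_measurable_add:
  "strongly_measurable M f \<Longrightarrow> strongly_measurable M g \<Longrightarrow> strongly_measurable M (\<lambda>t. f t + g t)"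
  by (rule strongly_measurable_compose2)
     (auto simp: case_prod_beta' intro!: continuous_intros)

lemma strongly_measurable_diff:
  "strongly_measurable M f \<Longrightarrow> strongly_measurable M g \<Longrightarrow> strongly_measurable M (\<lambda>t. f t - g t)"
  by (rule strongly_measurable_compose2)
     (auto simp: case_prod_beta' intro!: continuous_intros)

lemma strongly_measurable_bounded_linear:
  "bounded_linear p \<Longrightarrow> strongly_measurable M f \<Longrightarrow> strongly_measurable M (\<lambda>t. p (f t))"
  by (rule strongly_measurable_compose) (auto intro: linear_continuous_on)

lemma strongly_measurable_norm:
  "strongly_measurable M f \<Longrightarrow> strongly_measurable M (\<lambda>t. norm (f t))"
  by (rule strongly_measurable_compose) (auto intro!: continuous_intros)

text \<open>Time is discretised together with the argument, which keeps the approximants simple although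
  \<open>'b\<close> need not be separable.\<close>

lemma strongly_measurable_Caratheodory:
  fixes G :: "real \<Rightarrow> 'b::real_normed_vector \<Rightarrow> 'c::real_normed_vector"
  assumes u: "strongly_measurable (lebesgue_on {a<..<b}) u"
    and G: "continuous_on ({a..b} \<times> UNIV) (case_prod G)"
  shows "strongly_measurable (lebesgue_on {a<..<b}) (\<lambda>t. G t (u t))"
proof -
  let ?M = "lebesgue_on {a<..<b}"
  obtain s where s: "\<And>n::nat. simple_function ?M (s n)" "AE t in ?M. (\<lambda>n. s n t) \<longlonglongrightarrow> u t"
    using u by (auto simp: strongly_measurable_def)
  have "(\<lambda>t::real. t) \<in> borel_measurable ?M"
    by (intro measurable_restrict_space1 measurable_completion) simp
  from borel_measurable_implies_sequence_metric[OF this, of 0]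
  obtain r where r: "\<And>n::nat. simple_function ?M (r n)"
    "\<And>t. t \<in> space ?M \<Longrightarrow> (\<lambda>n. r n t) \<longlonglongrightarrow> t" by blast
  \<comment> \<open>\<open>G\<close> is continuous over \<open>{a..b}\<close> only, while
    \<open>r n t\<close> may leave the interval. Clamping keeps the values inside and does not
    change the limit \<open>t\<close>.\<close>
  define \<rho> where "\<rho> n t = max a (min b (r n t))" for n t
  have "AE t in ?M. (\<lambda>n. G (\<rho> n t) (s n t)) \<longlonglongrightarrow> G t (u t)"
    using s(2) AE_space
  proof eventually_elim
    case (elim t)
    then have t: "t \<in> {a<..<b}" by simp
    have "(\<lambda>n. \<rho> n t) \<longlonglongrightarrow> max a (min b t)"
      unfolding \<rho>_def using r(2)[OF elim(2)] by (intro tendsto_intros)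
    then have "(\<lambda>n. (\<rho> n t, s n t)) \<longlonglongrightarrow> (t, u t)"
      using t elim by (intro tendsto_Pair) auto
    from continuous_on_tendsto_compose[OF G this] show ?case
      using t by (simp add: \<rho>_def)
  qed
  moreover have "simple_function ?M (\<lambda>t. G (\<rho> n t) (s n t))" for n
    using r(1) s(1) unfolding \<rho>_def
    by (rule simple_function_compose2[where h="\<lambda>x. G (max a (min b x))"])
  ultimately show ?thesis
    unfolding strongly_measurable_def by (intro exI[of _ "\<lambda>n t. G (\<rho> n t) (s n t)"]) simp
qed

context complete_finite_measure
begin

text \<open>Off a null set \<open>N\<close> the function agrees with a pointwise limit
  \<open>h\<close> of measurable functions. Its behaviour on \<open>N\<close> contributes a subset
  of a null set to each preimage, measurable by completeness.\<close>

lemma strongly_measurable_imp_borel_measurable: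
  fixes f :: "'a \<Rightarrow> real"
  assumes "strongly_measurable M f"
  shows "f \<in> borel_measurable M"
proof -
  obtain s where s: "\<And>n::nat. simple_function M (s n)" "AE t in M. (\<lambda>n. s n t) \<longlonglongrightarrow> f t"
    using assms by (auto simp: strongly_measurable_def)
  obtain N where N: "N \<in> null_sets M" "\<And>t. t \<in> space M - N \<Longrightarrow> (\<lambda>n. s n t) \<longlonglongrightarrow> f t"
    using s(2) by (auto elim: AE_E3)
  define h where "h t = indicator (space M - N) t * f t" for t
  have N': "space M - N \<in> sets M" using N(1) by auto
  have h: "h \<in> borel_measurable M"
  proof (rule borel_measurable_LIMSEQ_real)
    fix t assume "t \<in> space M"
    show "(\<lambda>n. indicator (space M - N) t * s n t) \<longlonglongrightarrow> h t"
      unfolding h_def using N(2)[of t] \<open>t \<in> space M\<close>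
      by (cases "t \<in> N") (auto simp: indicator_def)
  next
    fix n show "(\<lambda>t. indicator (space M - N) t * s n t) \<in> borel_measurable M"
      using N' s(1)[of n] borel_measurable_simple_function by measurable
  qed
  show ?thesis
  proof (rule measurableI)
    fix A :: "real set" assume A: "A \<in> sets borel"
    have "f -` A \<inter> space M = (h -` A \<inter> space M - N) \<union> (f -` A \<inter> space M \<inter> N)"
      by (auto simp: h_def)
    moreover have "f -` A \<inter> space M \<inter> N \<in> sets M" by (rule complete[OF _ N(1)]) auto
    moreover have "h -` A \<inter> space M - N \<in> sets M"
      using measurable_sets[OF h A] N(1) by auto
    ultimately show "f -` A \<inter> space M \<in> sets M" by (metis sets.Un)
  qed simp
qed

lemma borel_measurable_norm_strongly:
  "strongly_measurable M f \<Longrightarrow> (\<lambda>t. norm (f t)) \<in> borel_measurable M"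
  by (intro strongly_measurable_imp_borel_measurable strongly_measurable_norm)

lemma borel_measurable_norm_diff_simple:
  assumes "strongly_measurable M f" "simple_function M s"
  shows "(\<lambda>t. norm (f t - s t)) \<in> borel_measurable M"
  using strongly_measurable_diff[OF assms(1) strongly_measurable_simple[OF assms(2)]]
  by (rule borel_measurable_norm_strongly)

lemma simple_bochner_integrable_iff: "Bochner_Integration.simple_bochner_integrable M f \<longleftrightarrow> simple_function M f"
  by (auto simp: simple_bochner_integrable.simps)

text \<open>Dominated convergence after truncation: where \<open>s n\<close> exceeds twice the norm
  of \<open>f\<close> it is replaced by 0, so the error stays below \<open>3 * norm (f t)\<close>.
  At points with \<open>f t \<noteq> 0\<close> the truncation is eventually inactive, and where
  \<open>f t = 0\<close> it yields exactly 0.\<close>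

lemma simple_L1_approximation:
  fixes f :: "'a \<Rightarrow> 'b::real_normed_vector"
  assumes f: "strongly_measurable M f" and int: "integrable M (\<lambda>t. norm (f t))"
  obtains s where "\<And>n::nat. simple_function M (s n)"
    "(\<lambda>n. L1_dist M f (s n)) \<longlonglongrightarrow> 0"
proof -
  obtain s where s: "\<And>n::nat. simple_function M (s n)" "AE t in M. (\<lambda>n. s n t) \<longlonglongrightarrow> f t"
    using f by (auto simp: strongly_measurable_def)
  define r where "r n t = (if norm (s n t) \<le> 2 * norm (f t) then s n t else 0)" for n t
  have [measurable]: "(\<lambda>t. norm (f t)) \<in> borel_measurable M"
    using f by (rule borel_measurable_norm_strongly)
  have [measurable]: "(\<lambda>t. norm (s n t)) \<in> borel_measurable M" for n
    using s(1) by (intro borel_measurable_norm_strongly strongly_measurable_simple)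
  have r: "simple_function M (r n)" for n
    unfolding r_def using s(1) by (intro simple_function_If) auto
  have lim: "AE t in M. (\<lambda>n. r n t) \<longlonglongrightarrow> f t"
    using s(2)
  proof eventually_elim
    case (elim t)
    show ?case
    proof (cases "f t = 0")
      case True
      then have "r n t = 0" for n by (simp add: r_def)
      then show ?thesis using True by simp
    next
      case False
      then have "eventually (\<lambda>n. norm (s n t) < 2 * norm (f t)) sequentially"
        by (intro order_tendstoD(2)[OF tendsto_norm[OF elim]]) simp
      then have "eventually (\<lambda>n. s n t = r n t) sequentially"
        by eventually_elim (simp add: r_def)
      then show ?thesis using elim by (rule Lim_transform_eventually[rotated])
    qed
  qed
  have meas: "(\<lambda>t. norm (f t - r n t)) \<in> borel_measurable M" for n
    using f r by (rule borel_measurable_norm_diff_simple)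
  have "(\<lambda>n. L1_dist M f (r n)) \<longlonglongrightarrow> (\<integral>\<^sup>+t. 0 \<partial>M)"
  proof (rule nn_integral_dominated_convergence[where w="\<lambda>t. ennreal (3 * norm (f t))"])
    show "(\<lambda>t. ennreal (norm (f t - r n t))) \<in> borel_measurable M" for n
      using meas[of n] by simp
    have "(\<integral>\<^sup>+t. ennreal (norm (3 * norm (f t))) \<partial>M) < \<infinity>"
      using integrable_mult_right[OF int, of 3] unfolding integrable_iff_bounded by blast
    then show "(\<integral>\<^sup>+t. ennreal (3 * norm (f t)) \<partial>M) < \<infinity>" by simp
    have bd: "norm (f t - r n t) \<le> 3 * norm (f t)" for t n
      using norm_triangle_ineq4[of "f t" "r n t"] by (auto simp: r_def split: if_splits)
    show "AE t in M. ennreal (norm (f t - r n t)) \<le> ennreal (3 * norm (f t))" for n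
      using bd by (intro AE_I2 ennreal_leI)
    show "AE t in M. (\<lambda>n. ennreal (norm (f t - r n t))) \<longlonglongrightarrow> 0"
      using lim
    proof eventually_elim
      case (elim t)
      then have "(\<lambda>n. norm (f t - r n t)) \<longlonglongrightarrow> norm (f t - f t)"
        by (intro tendsto_intros)
      then show ?case using tendsto_ennrealI[of "\<lambda>n. norm (f t - r n t)" 0] by simp
    qed
  qed auto
  then show ?thesis using that[of r] r by simp
qed

section \<open>Integrals of simple functions and their limits\<close>

lemma simple_bochner_integral_norm_le:
  assumes "simple_function M s"
  shows "ennreal (norm (simple_integral M s)) \<le> (\<integral>\<^sup>+t. ennreal (norm (s t)) \<partial>M)"
proof -
  have "Bochner_Integration.simple_bochner_integrable M (\<lambda>t. norm (s t))"
    using simple_function_compose1[OF assms, of norm] by (simp add: simple_bochner_integrable_iff)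
  then have "ennreal (simple_integral M (\<lambda>t. norm (s t))) = (\<integral>\<^sup>+t. ennreal (norm (s t)) \<partial>M)"
    by (intro simple_bochner_integral_eq_nn_integral) auto
  then show ?thesis
    using simple_bochner_integral_norm_bound[of M s] assms
    by (metis ennreal_leI simple_bochner_integrable_iff)
qed

text \<open>This estimate drives the construction: it gives the Cauchy property of the integrals of
  approximants, independence of the chosen sequence and, with \<open>r = 0\<close>, the norm
  bound.\<close>

lemma simple_bochner_integral_dist_le:
  assumes f: "strongly_measurable M f" and s: "simple_function M s" and r: "simple_function M r"
  shows "ennreal (norm (simple_integral M s - simple_integral M r)) \<le>
    L1_dist M f s + L1_dist M f r"
proof -
  have meas: "(\<lambda>t. norm (f t - q t)) \<in> borel_measurable M" if "simple_function M q" for q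
    using f that by (rule borel_measurable_norm_diff_simple)
  have "ennreal (norm (simple_integral M s - simple_integral M r)) =
      ennreal (norm (simple_integral M (\<lambda>t. s t - r t)))"
    using s r by (subst simple_bochner_integral_diff) (auto simp: simple_bochner_integrable_iff)
  also have "\<dots> \<le> (L1_dist M s r)"
    using s r by (intro simple_bochner_integral_norm_le simple_function_diff)
  also have "\<dots> \<le> (\<integral>\<^sup>+t. ennreal (norm (f t - s t)) + ennreal (norm (f t - r t)) \<partial>M)"
  proof (rule nn_integral_mono)
    fix t
    have "norm (s t - r t) \<le> norm (f t - s t) + norm (f t - r t)"
      using norm_triangle_ineq4[of "f t - r t" "f t - s t"] by (simp add: algebra_simps)
    then show "ennreal (norm (s t - r t)) \<le> ennreal (norm (f t - s t)) + ennreal (norm (f t - r t))"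
      by (simp flip: ennreal_plus add: ennreal_leI)
  qed
  also have "\<dots> = L1_dist M f s + L1_dist M f r"
    using meas s r by (intro nn_integral_add) auto
  finally show ?thesis .
qed

lemma simple_bochner_integral_convergent:
  fixes f :: "'a \<Rightarrow> 'b::banach"
  assumes f: "strongly_measurable M f" and s: "\<And>n::nat. simple_function M (s n)"
    and lim: "(\<lambda>n. L1_dist M f (s n)) \<longlonglongrightarrow> 0"
  shows "convergent (\<lambda>n. simple_integral M (s n))"
proof (rule Cauchy_convergent, rule CauchyI)
  fix e :: real assume e: "0 < e"
  then have "eventually (\<lambda>n. (L1_dist M f (s n)) < ennreal (e / 2)) sequentially"
    by (intro order_tendstoD(2)[OF lim]) simp
  then obtain K where K: "\<And>n. n \<ge> K \<Longrightarrow> (L1_dist M f (s n)) < ennreal (e / 2)"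
    by (auto simp: eventually_sequentially)
  have "norm (simple_integral M (s m) - simple_integral M (s n)) < e"
    if "m \<ge> K" "n \<ge> K" for m n
  proof -
    have "ennreal (norm (simple_integral M (s m) - simple_integral M (s n))) <
        ennreal (e / 2) + ennreal (e / 2)"
      using simple_bochner_integral_dist_le[OF f s s, of m n] K[OF that(1)] K[OF that(2)]
      by (meson add_strict_mono le_less_trans)
    also have "\<dots> = ennreal e" using e by (simp flip: ennreal_plus)
    finally show ?thesis by (simp add: ennreal_less_iff)
  qed
  then show "\<exists>K. \<forall>m\<ge>K. \<forall>n\<ge>K. norm (simple_integral M (s m) - simple_integral M (s n)) < e"
    by blast
qed

text \<open>The definition provides one approximating sequence with integrals tending to
  \<open>y\<close>. Any other one has integrals at vanishing distance from these, so later proofs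
  may choose a convenient sequence.\<close>

lemma has_Bochner_integral_limit:
  assumes y: "has_Bochner_integral M f y" and s: "\<And>n::nat. simple_function M (s n)"
    and lim: "(\<lambda>n. L1_dist M f (s n)) \<longlonglongrightarrow> 0"
  shows "(\<lambda>n. simple_integral M (s n)) \<longlonglongrightarrow> y"
proof -
  obtain r where f: "strongly_measurable M f" and r: "\<And>n::nat. simple_function M (r n)"
    "(\<lambda>n. L1_dist M f (r n)) \<longlonglongrightarrow> 0"
    "(\<lambda>n. simple_integral M (r n)) \<longlonglongrightarrow> y"
    using y by (auto simp: has_Bochner_integral_def simple_bochner_integrable_iff)
  have "(\<lambda>n. ennreal (norm (simple_integral M (s n) - simple_integral M (r n)))) \<longlonglongrightarrow> 0"
  proof (rule tendsto_sandwich[OF _ _ tendsto_const])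
    show "(\<lambda>n. L1_dist M f (s n) + L1_dist M f (r n)) \<longlonglongrightarrow> 0"
      using tendsto_add[OF lim r(2)] by simp
  qed (use simple_bochner_integral_dist_le[OF f s r(1)] in auto)
  then have "(\<lambda>n. norm (simple_integral M (s n) - simple_integral M (r n))) \<longlonglongrightarrow> 0"
    by (simp add: ennreal_tendsto_0_iff)
  then have "(\<lambda>n. simple_integral M (s n) - simple_integral M (r n)) \<longlonglongrightarrow> 0"
    by (simp add: tendsto_norm_zero_iff)
  from tendsto_add[OF this r(3)] show ?thesis by simp
qed

lemma has_Bochner_integral_unique:
  assumes "has_Bochner_integral M f y" "has_Bochner_integral M f z"
  shows "y = z"
proof -
  obtain r where "\<And>n::nat. simple_function M (r n)"
    "(\<lambda>n. L1_dist M f (r n)) \<longlonglongrightarrow> 0"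
    "(\<lambda>n. simple_integral M (r n)) \<longlonglongrightarrow> y"
    using assms(1) by (auto simp: has_Bochner_integral_def simple_bochner_integrable_iff)
  then show ?thesis using has_Bochner_integral_limit[OF assms(2)] LIMSEQ_unique by blast
qed

lemma Bochner_integral_eq: "has_Bochner_integral M f y \<Longrightarrow> Bochner_integral M f = y"
  unfolding Bochner_integral_def using has_Bochner_integral_unique by blast

lemma has_Bochner_integral_Bochner_integral:
  fixes f :: "'a \<Rightarrow> 'b::banach"
  assumes "strongly_measurable M f" "integrable M (\<lambda>t. norm (f t))"
  shows "has_Bochner_integral M f (Bochner_integral M f)"
proof -
  obtain s where s: "\<And>n::nat. simple_function M (s n)"
    "(\<lambda>n. L1_dist M f (s n)) \<longlonglongrightarrow> 0"
    using simple_L1_approximation[OF assms] by metis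
  obtain y where "(\<lambda>n. simple_integral M (s n)) \<longlonglongrightarrow> y"
    using simple_bochner_integral_convergent[OF assms(1) s] by (auto simp: convergent_def)
  then have "has_Bochner_integral M f y"
    unfolding has_Bochner_integral_def simple_bochner_integrable_iff using assms s by blast
  then show ?thesis using Bochner_integral_eq by metis
qed

lemma simple_approximation:
  fixes f :: "'a \<Rightarrow> 'b::banach"
  assumes "strongly_measurable M f" "integrable M (\<lambda>t. norm (f t))"
  obtains s where "\<And>n::nat. simple_function M (s n)" "(\<lambda>n. L1_dist M f (s n)) \<longlonglongrightarrow> 0"
    "(\<lambda>n. simple_integral M (s n)) \<longlonglongrightarrow> Bochner_integral M f"
proof -
  obtain s where s: "\<And>n::nat. simple_function M (s n)" "(\<lambda>n. L1_dist M f (s n)) \<longlonglongrightarrow> 0"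
    using simple_L1_approximation[OF assms] by metis
  show ?thesis
    by (rule that[OF s has_Bochner_integral_limit[OF has_Bochner_integral_Bochner_integral[OF assms] s]])
qed

lemma norm_Bochner_integral_le:
  fixes f :: "'a \<Rightarrow> 'b::banach"
  assumes f: "strongly_measurable M f" and int: "integrable M (\<lambda>t. norm (f t))"
  shows "norm (Bochner_integral M f) \<le> (\<integral>t. norm (f t) \<partial>M)"
proof -
  obtain s where s: "\<And>n::nat. simple_function M (s n)"
    "(\<lambda>n. L1_dist M f (s n)) \<longlonglongrightarrow> 0" and lim: "(\<lambda>n. simple_integral M (s n)) \<longlonglongrightarrow> Bochner_integral M f"
    using simple_approximation[OF assms] by metis
  have zero: "simple_integral M (\<lambda>_. 0::'b) = 0"
    unfolding simple_bochner_integral_def by (rule sum.neutral) auto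
  have "ennreal (norm (Bochner_integral M f)) \<le> (\<integral>\<^sup>+t. ennreal (norm (f t)) \<partial>M) + 0"
  proof (rule LIMSEQ_le)
    show "(\<lambda>n. ennreal (norm (simple_integral M (s n)))) \<longlonglongrightarrow> ennreal (norm (Bochner_integral M f))"
      by (intro tendsto_ennrealI tendsto_norm lim)
    show "(\<lambda>n. (\<integral>\<^sup>+t. ennreal (norm (f t)) \<partial>M) + L1_dist M f (s n))
        \<longlonglongrightarrow> (\<integral>\<^sup>+t. ennreal (norm (f t)) \<partial>M) + 0"
      by (intro tendsto_add tendsto_const s)
    have "ennreal (norm (simple_integral M (s n))) \<le>
       (\<integral>\<^sup>+t. ennreal (norm (f t)) \<partial>M) + L1_dist M f (s n)" for n
      using simple_bochner_integral_dist_le[OF f s(1), of "\<lambda>_. 0" n]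
      by (simp add: zero add.commute)
    then show "\<exists>N. \<forall>n\<ge>N. ennreal (norm (simple_integral M (s n))) \<le>
       (\<integral>\<^sup>+t. ennreal (norm (f t)) \<partial>M) + L1_dist M f (s n)" by blast
  qed
  also have "\<dots> = ennreal (\<integral>t. norm (f t) \<partial>M)"
    using int by (simp add: nn_integral_eq_integral)
  finally show ?thesis by (simp add: ennreal_le_iff)
qed

text \<open>If simple \<open>s n\<close> approximate \<open>f\<close>, then the simple functions
  \<open>p (s n t)\<close> approximate the image, with errors larger by at most the bound
  \<open>K\<close> of \<open>p\<close>.\<close>

lemma Bochner_integral_bounded_linear:
  fixes f :: "'a \<Rightarrow> 'b::banach" and p :: "'b \<Rightarrow> 'c::banach"
  assumes f: "strongly_measurable M f" and int: "integrable M (\<lambda>t. norm (f t))"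
    and p: "bounded_linear p"
  shows "Bochner_integral M (\<lambda>t. p (f t)) = p (Bochner_integral M f)"
proof -
  obtain s where s: "\<And>n::nat. simple_function M (s n)"
    "(\<lambda>n. L1_dist M f (s n)) \<longlonglongrightarrow> 0" "(\<lambda>n. simple_integral M (s n)) \<longlonglongrightarrow> Bochner_integral M f"
    using simple_approximation[OF f int] by metis
  obtain K where K: "0 \<le> K" "\<And>x. norm (p x) \<le> norm x * K"
    using bounded_linear.nonneg_bounded[OF p] by blast
  have "(\<lambda>n. p (simple_integral M (s n))) \<longlonglongrightarrow> p (Bochner_integral M f)"
    by (rule bounded_linear.tendsto[OF p s(3)])
  moreover have "simple_integral M (\<lambda>t. p (s n t)) = p (simple_integral M (s n))" for n
    using s(1) p by (intro simple_bochner_integral_linear)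
      (auto simp: simple_bochner_integrable_iff bounded_linear.linear)
  moreover have "(\<lambda>n. \<integral>\<^sup>+t. ennreal (norm (p (f t) - p (s n t))) \<partial>M) \<longlonglongrightarrow> 0"
  proof (rule tendsto_sandwich[OF _ _ tendsto_const])
    have "(\<lambda>n. ennreal K * L1_dist M f (s n)) \<longlonglongrightarrow> ennreal K * 0"
      by (intro ennreal_tendsto_cmult s(2)) simp
    then show "(\<lambda>n. ennreal K * L1_dist M f (s n)) \<longlonglongrightarrow> 0" by simp
    have "(\<integral>\<^sup>+t. ennreal (norm (p (f t) - p (s n t))) \<partial>M) \<le>
        (\<integral>\<^sup>+t. ennreal K * ennreal (norm (f t - s n t)) \<partial>M)" for n
    proof (rule nn_integral_mono)
      fix t
      have "norm (p (f t) - p (s n t)) \<le> K * norm (f t - s n t)"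
        using K(2)[of "f t - s n t"] by (simp add: linear_diff[OF bounded_linear.linear[OF p]] mult.commute)
      then show "ennreal (norm (p (f t) - p (s n t))) \<le> ennreal K * ennreal (norm (f t - s n t))"
        using K(1) by (metis ennreal_leI ennreal_mult norm_ge_zero)
    qed
    also have "(\<integral>\<^sup>+t. ennreal K * ennreal (norm (f t - s n t)) \<partial>M) =
        ennreal K * L1_dist M f (s n)" for n
      using borel_measurable_norm_diff_simple[OF f s(1), of n]
      by (intro nn_integral_cmult) simp
    finally show "eventually (\<lambda>n. (\<integral>\<^sup>+t. ennreal (norm (p (f t) - p (s n t))) \<partial>M) \<le>
        ennreal K * L1_dist M f (s n)) sequentially" by simp
  qed simp
  ultimately have "has_Bochner_integral M (\<lambda>t. p (f t)) (p (Bochner_integral M f))"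
    unfolding has_Bochner_integral_def simple_bochner_integrable_iff
    using strongly_measurable_bounded_linear[OF p f] simple_function_compose1[OF s(1), of p]
    by (intro conjI exI[of _ "\<lambda>n t. p (s n t)"]) auto
  then show ?thesis by (rule Bochner_integral_eq)
qed

text \<open>Additivity is commutation with the bounded linear maps \<open>fst\<close>, \<open>snd\<close> and \<open>(+)\<close>, applied to the pair
  of the two functions.\<close>

lemma Bochner_integral_add:
  fixes f g :: "'a \<Rightarrow> 'b::banach"
  assumes f: "strongly_measurable M f" "integrable M (\<lambda>t. norm (f t))"
    and g: "strongly_measurable M g" "integrable M (\<lambda>t. norm (g t))"
  shows "Bochner_integral M (\<lambda>t. f t + g t) = Bochner_integral M f + Bochner_integral M g"
proof -
  have sm: "strongly_measurable M (\<lambda>t. (f t, g t))"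
    using f(1) g(1) by (rule strongly_measurable_compose2) (simp add: case_prod_beta')
  have int: "integrable M (\<lambda>t. norm (f t, g t))"
  proof (rule Bochner_Integration.integrable_bound)
    show "integrable M (\<lambda>t. norm (f t) + norm (g t))" using f g by simp
    show "(\<lambda>t. norm (f t, g t)) \<in> borel_measurable M" using sm by (rule borel_measurable_norm_strongly)
    show "AE t in M. norm (norm (f t, g t)) \<le> norm (norm (f t) + norm (g t))"
      by (simp add: norm_Pair sqrt_sum_squares_le_sum)
  qed
  note linear = Bochner_integral_bounded_linear[OF sm int]
  have "Bochner_integral M (\<lambda>t. fst (f t, g t) + snd (f t, g t)) =
      fst (Bochner_integral M (\<lambda>t. (f t, g t))) + snd (Bochner_integral M (\<lambda>t. (f t, g t)))"
    by (rule linear) (intro bounded_linear_add bounded_linear_fst bounded_linear_snd)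
  then show ?thesis using linear[OF bounded_linear_fst] linear[OF bounded_linear_snd] by simp
qed

end

section \<open>Zabreiko's lemma\<close>

text \<open>The pointwise structure turns \<open>L2 M\<close> into a subspace of the functions
  without a quotient by null functions; this is why the lemma below works with seminorms on a
  subspace \<open>V\<close>.\<close>

instantiation "fun" :: (type, real_vector) real_vector
begin

definition scaleR_fun :: "real \<Rightarrow> ('a \<Rightarrow> 'b) \<Rightarrow> 'a \<Rightarrow> 'b" where
  "scaleR_fun c f = (\<lambda>t. c *\<^sub>R f t)"

instance
  by standard (auto simp: scaleR_fun_def plus_fun_def fun_eq_iff algebra_simps)

end

lemma fun_sum_apply: "(\<Sum>i<n::nat. u i) t = (\<Sum>i<n. u i t)"
  for u :: "nat \<Rightarrow> 'a \<Rightarrow> 'b::comm_monoid_add"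
  by (induction n) (auto simp: zero_fun_def plus_fun_def)

text \<open>Zabreiko's lemma: by Baire's argument the \<open>q\<close>-closure of some set \<open>{p \<le> n}\<close> contains a ball,
  and successive approximation together with countable subadditivity removes the closure.\<close>

lemma countably_subadditive_seminorm_bounded:
  fixes V :: "'v::real_vector set" and q p :: "'v \<Rightarrow> real"
  assumes V: "subspace V"
    and q_nonneg: "\<And>u. u \<in> V \<Longrightarrow> 0 \<le> q u"
    and q_add: "\<And>u v. u \<in> V \<Longrightarrow> v \<in> V \<Longrightarrow> q (u + v) \<le> q u + q v"
    and q_scale: "\<And>c u. u \<in> V \<Longrightarrow> q (c *\<^sub>R u) = \<bar>c\<bar> * q u"
    and q_complete: "\<And>u. (\<And>n::nat. u n \<in> V) \<Longrightarrow> summable (\<lambda>n. q (u n)) \<Longrightarrow>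
        \<exists>w\<in>V. (\<lambda>n. q ((\<Sum>i<n. u i) - w)) \<longlonglongrightarrow> 0"
    and p_nonneg: "\<And>u. u \<in> V \<Longrightarrow> 0 \<le> p u"
    and p_add: "\<And>u v. u \<in> V \<Longrightarrow> v \<in> V \<Longrightarrow> p (u + v) \<le> p u + p v"
    and p_scale: "\<And>c u. u \<in> V \<Longrightarrow> p (c *\<^sub>R u) = \<bar>c\<bar> * p u"
    and p_suminf: "\<And>u w. (\<And>n::nat. u n \<in> V) \<Longrightarrow> w \<in> V \<Longrightarrow>
        (\<lambda>n. q ((\<Sum>i<n. u i) - w)) \<longlonglongrightarrow> 0 \<Longrightarrow> summable (\<lambda>n. p (u n)) \<Longrightarrow> p w \<le> (\<Sum>n. p (u n))"
  obtains C where "0 \<le> C" "\<And>u. u \<in> V \<Longrightarrow> p u \<le> C * q u"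
proof -
  note Vs = subspace_add[OF V] subspace_diff[OF V] subspace_scale[OF V] subspace_0[OF V]
  have q_minus: "q (- u) = q u" if "u \<in> V" for u using q_scale[OF that, of "-1"] by simp
  have p_minus: "p (- u) = p u" if "u \<in> V" for u using p_scale[OF that, of "-1"] by simp
  have q_commute: "q (u - v) = q (v - u)" if "u \<in> V" "v \<in> V" for u v
    using q_minus[of "u - v"] Vs that by simp
  have q_tri: "q (x - z) \<le> q (x - y) + q (y - z)" if "x \<in> V" "y \<in> V" "z \<in> V" for x y z
    using q_add[of "x - y" "y - z"] Vs that by simp
  have q0: "q 0 = 0" using q_scale[of 0 0] Vs by simp
  \<comment> \<open>The category argument: some \<open>{p \<le> n}\<close> is \<open>q\<close>-dense
    in a ball. Otherwise every ball contains a smaller one away from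
    \<open>{p \<le> n}\<close>.\<close>
  have "\<exists>n::nat. \<exists>v\<in>V. \<exists>r>0. \<forall>w\<in>V. q (w - v) < r \<longrightarrow> (\<forall>e>0. \<exists>a\<in>V. p a \<le> real n \<and> q (w - a) < e)"
  proof (rule ccontr)
    assume none: "\<not> ?thesis"
    have neg: "\<exists>w\<in>V. q (w - v) < r \<and> (\<exists>e>0. \<forall>a\<in>V. p a \<le> real n \<longrightarrow> e \<le> q (w - a))"
      if "v \<in> V" "0 < r" for n v r
    proof (rule ccontr)
      assume "\<not> (\<exists>w\<in>V. q (w - v) < r \<and> (\<exists>e>0. \<forall>a\<in>V. p a \<le> real n \<longrightarrow> e \<le> q (w - a)))"
      then have "\<forall>w\<in>V. q (w - v) < r \<longrightarrow> (\<forall>e>0. \<exists>a\<in>V. p a \<le> real n \<and> q (w - a) < e)"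
        by (auto simp: not_le)
      then show False using none that by blast
    qed
    \<comment> \<open>A pair is a ball, given by centre and radius. The successor lies inside the
      ball, has at most half its radius, and its centre is at least two of its own radii away from
      \<open>{p \<le> n}\<close>, so that even its closure misses that set.\<close>
    define Q where "Q n x y \<longleftrightarrow> q (fst y - fst x) + snd y \<le> snd x \<and> snd y \<le> snd x / 2 \<and>
       (\<forall>a\<in>V. p a \<le> real n \<longrightarrow> 2 * snd y \<le> q (fst y - a))" for n :: nat and x y :: "'v \<times> real"
    have "\<exists>f. \<forall>n. (fst (f n) \<in> V \<and> 0 < snd (f n)) \<and> Q n (f n) (f (Suc n))"
    proof (rule dependent_nat_choice)
      show "\<exists>x::'v \<times> real. fst x \<in> V \<and> 0 < snd x" using Vs(4) by (intro exI[of _ "(0::'v, 1::real)"]) simp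
    next
      fix x :: "'v \<times> real" and n
      assume x: "fst x \<in> V \<and> 0 < snd x"
      then obtain w e where w: "w \<in> V" "q (w - fst x) < snd x" "0 < e"
        "\<forall>a\<in>V. p a \<le> real n \<longrightarrow> e \<le> q (w - a)"
        using neg by blast
      define r where "r = min (e / 2) (min (snd x / 2) (snd x - q (w - fst x)))"
      have "0 < r" "2 * r \<le> e" "r \<le> snd x / 2" "q (w - fst x) + r \<le> snd x"
        using w x by (auto simp: r_def min_def)
      then show "\<exists>y. (fst y \<in> V \<and> 0 < snd y) \<and> Q n x y"
        using w unfolding Q_def by (intro exI[of _ "(w, r)"]) force
    qed
    then obtain f where f: "\<And>n. fst (f n) \<in> V" "\<And>n. 0 < snd (f n)" "\<And>n. Q n (f n) (f (Suc n))"
      by blast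
    define v r where "v n = fst (f n)" and "r n = snd (f n)" for n
    have vr: "v n \<in> V" "0 < r n" "q (v (Suc n) - v n) + r (Suc n) \<le> r n" "r (Suc n) \<le> r n / 2"
      "\<And>a. a \<in> V \<Longrightarrow> p a \<le> real n \<Longrightarrow> 2 * r (Suc n) \<le> q (v (Suc n) - a)" for n
      using f[of n] by (auto simp: v_def r_def Q_def)
    have rle: "r n \<le> r 0 * (1 / 2) ^ n" for n
    proof (induction n)
      case (Suc n)
      then have "r (Suc n) \<le> r 0 * (1 / 2) ^ n / 2" using vr(4)[of n] by linarith
      then show ?case by simp
    qed simp
    \<comment> \<open>Completeness is available for absolutely convergent series, so the limit of
      the centres is found by summing their increments, which the geometric decay of the radii makes
      summable.\<close>
    have "summable (\<lambda>n. q (v (Suc n) - v n))"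
    proof (rule summable_comparison_test')
      show "summable (\<lambda>n. r 0 * (1 / 2 :: real) ^ n)" by (intro summable_mult summable_geometric) simp
      fix n
      have "0 \<le> q (v (Suc n) - v n)" "q (v (Suc n) - v n) \<le> r n"
        using vr(1,2,3)[of n] vr(1,2)[of "Suc n"] q_nonneg Vs by auto
      then show "norm (q (v (Suc n) - v n)) \<le> r 0 * (1 / 2) ^ n" using rle[of n] by simp
    qed
    moreover have "v (Suc n) - v n \<in> V" for n using vr(1) by (intro Vs(2))
    ultimately obtain w where w: "w \<in> V" "(\<lambda>n. q ((\<Sum>i<n. v (Suc i) - v i) - w)) \<longlonglongrightarrow> 0"
      using q_complete[of "\<lambda>n. v (Suc n) - v n"] by auto
    define x where "x = v 0 + w"
    have x: "x \<in> V" using w vr(1)[of 0] Vs by (simp add: x_def)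
    have "(\<Sum>i<n. v (Suc i) - v i) - w = v n - x" for n
      by (simp add: sum_lessThan_telescope x_def)
    then have lim: "(\<lambda>n. q (v n - x)) \<longlonglongrightarrow> 0" using w(2) by simp
    have step: "q (v (n + k) - v n) \<le> r n - r (n + k)" for n k
    proof (induction k)
      case 0 then show ?case using q0 by simp
    next
      case (Suc k)
      then show ?case using vr(3)[of "n + k"] q_tri[of "v (Suc (n + k))" "v (n + k)" "v n"] vr(1)
        by (auto simp: algebra_simps)
    qed
    \<comment> \<open>The limit \<open>x\<close> lies in every closed ball. Since
      \<open>p x \<le> N\<close> for some \<open>N\<close>, this contradicts the distance of the
      ball with index \<open>Suc N\<close> from \<open>{p \<le> N}\<close>.\<close>
    have close: "q (v n - x) \<le> r n" for n
    proof (rule field_le_epsilon)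
      fix e :: real assume "0 < e"
      then have "eventually (\<lambda>m. q (v m - x) < e) sequentially" using lim by (intro order_tendstoD(2))
      then obtain K where "\<And>m. m \<ge> K \<Longrightarrow> q (v m - x) < e" by (auto simp: eventually_sequentially)
      then obtain m where "m \<ge> n" "q (v m - x) < e" using max.cobounded1 max.cobounded2 by blast
      moreover have "q (v n - x) \<le> q (v n - v m) + q (v m - x)" using vr(1) x by (intro q_tri)
      moreover have "q (v n - v m) \<le> r n" using step[of n "m - n"] vr(2)[of m] \<open>m \<ge> n\<close>
          q_commute[OF vr(1) vr(1), of n m] by simp
      ultimately show "q (v n - x) \<le> r n + e" by simp
    qed
    obtain N where "p x \<le> real N" using real_arch_simple by blast
    then have "2 * r (Suc N) \<le> q (v (Suc N) - x)" using vr(5) x by blast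
    then show False using close[of "Suc N"] vr(2)[of "Suc N"] by simp
  qed
  then obtain n v r where nvr: "v \<in> V" "0 < r"
    and nvr': "\<forall>w\<in>V. q (w - v) < r \<longrightarrow> (\<forall>e>0. \<exists>a\<in>V. p a \<le> real n \<and> q (w - a) < e)"
    by blast
  \<comment> \<open>Moving the centre to 0: \<open>w\<close> is half the difference of
    \<open>v + w\<close> and \<open>v - w\<close>, both in the ball around \<open>v\<close>. As
    \<open>{p \<le> n}\<close> is symmetric and convex, half the difference of their approximants
    serves.\<close>
  have ball: "\<exists>a\<in>V. p a \<le> real n \<and> q (w - a) < e" if w: "w \<in> V" "q w < r" and e: "0 < e" for w e
  proof -
    have 1: "v + w \<in> V" "q ((v + w) - v) < r" using w nvr Vs by auto
    have 2: "v - w \<in> V" "q ((v - w) - v) < r" using w nvr Vs q_minus by auto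
    obtain a b where a: "a \<in> V" "p a \<le> real n" "q (v + w - a) < e"
      and b: "b \<in> V" "p b \<le> real n" "q (v - w - b) < e"
      using nvr'[rule_format, OF 1 e] nvr'[rule_format, OF 2 e] by blast
    define c where "c = (1 / 2) *\<^sub>R (a - b)"
    have cV: "c \<in> V" using a b Vs by (simp add: c_def)
    have "p (a - b) \<le> p a + p b" using p_add[of a "- b"] p_minus[of b] a b subspace_neg[OF V] by simp
    then have "p c \<le> real n" using p_scale[of "a - b" "1 / 2"] a b Vs by (simp add: c_def)
    moreover have "q (w - c) < e"
    proof -
      define X Y where "X = v + w - a" and "Y = v - w - b"
      have XY: "X \<in> V" "Y \<in> V" using a b w nvr(1) Vs by (auto simp: X_def Y_def)
      have "2 *\<^sub>R (w - c) = X - Y"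
        by (simp add: c_def X_def Y_def scaleR_diff_right scaleR_2)
      then have "q (X - Y) = 2 * q (w - c)" using q_scale[of "w - c" 2] w cV Vs by simp
      moreover have "q (X - Y) \<le> q X + q Y"
        using q_add[OF XY(1) subspace_neg[OF V XY(2)]] q_minus[OF XY(2)] by simp
      moreover have "q X < e" "q Y < e" using a b by (auto simp: X_def Y_def)
      ultimately show ?thesis by linarith
    qed
    ultimately show ?thesis using a b cV by (intro bexI[of _ c]) auto
  qed
  \<comment> \<open>Scaling by \<open>r / (2 * \<rho>)\<close> sends \<open>{q \<le> \<rho>}\<close>
    into the open ball of radius \<open>r\<close>; scaling back turns the bound \<open>n\<close>
    into \<open>2 * n / r * \<rho>\<close>.\<close>
  define K where "K = 2 * real n / r"
  have K: "0 \<le> K" using nvr by (simp add: K_def)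
  have approx: "\<exists>a\<in>V. p a \<le> K * \<rho> \<and> q (w - a) \<le> \<rho> / 2"
    if w: "w \<in> V" "q w \<le> \<rho>" and \<rho>: "0 < \<rho>" for w \<rho>
  proof -
    define c where "c = r / (2 * \<rho>)"
    have c: "0 < c" using nvr \<rho> by (simp add: c_def)
    have "q (c *\<^sub>R w) \<le> c * \<rho>" using q_scale[OF w(1), of c] w c by simp
    also have "c * \<rho> < r" using nvr \<rho> by (simp add: c_def)
    finally have "q (c *\<^sub>R w) < r" .
    then obtain a where a: "a \<in> V" "p a \<le> real n" "q (c *\<^sub>R w - a) < c * (\<rho> / 2)"
      using ball[of "c *\<^sub>R w" "c * (\<rho> / 2)"] w Vs c \<rho> by auto
    define b where "b = (1 / c) *\<^sub>R a"
    have b: "b \<in> V" using a Vs by (simp add: b_def)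
    have "p b = (1 / c) * p a" using p_scale[OF a(1), of "1 / c"] c by (simp add: b_def)
    also have "\<dots> \<le> (1 / c) * real n" using a c by (intro mult_left_mono) auto
    also have "\<dots> = K * \<rho>" using nvr \<rho> by (simp add: c_def K_def field_simps)
    finally have pb: "p b \<le> K * \<rho>" .
    have "w - b = (1 / c) *\<^sub>R (c *\<^sub>R w - a)" using c by (simp add: b_def scaleR_diff_right)
    then have "q (w - b) = (1 / c) * q (c *\<^sub>R w - a)"
      using q_scale[of "c *\<^sub>R w - a" "1 / c"] c a w Vs by simp
    also have "\<dots> \<le> (1 / c) * (c * (\<rho> / 2))" using a(3) c by (intro mult_left_mono) auto
    also have "\<dots> = \<rho> / 2" using c by simp
    finally show ?thesis using b pb by blast
  qed
  \<comment> \<open>Each remainder \<open>f k\<close> is approximated up to half its size bound by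
    an element with \<open>p\<close> at most \<open>K * \<sigma> k\<close>. These elements sum to
    \<open>u\<close>, and the geometric series contributes the factor 2.\<close>
  have bound: "p u \<le> 2 * K * \<rho>" if u: "u \<in> V" "q u \<le> \<rho>" and \<rho>: "0 < \<rho>" for u \<rho>
  proof -
    define \<sigma> where "\<sigma> k = \<rho> * (1 / 2) ^ k" for k :: nat
    have \<sigma>: "0 < \<sigma> k" "\<sigma> (Suc k) = \<sigma> k / 2" for k using \<rho> by (auto simp: \<sigma>_def)
    have "\<exists>f. \<forall>k. (f k \<in> V \<and> q (f k) \<le> \<sigma> k) \<and>
        (f k - f (Suc k) \<in> V \<and> p (f k - f (Suc k)) \<le> K * \<sigma> k \<and> (k = 0 \<longrightarrow> f k = u))"
    proof -
      \<comment> \<open>The clause for \<open>k = 0\<close> pins the start to \<open>u\<close>,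
        since dependent choice only guarantees that the start satisfies the invariant.\<close>
      have "\<exists>f. \<forall>k. (f k \<in> V \<and> q (f k) \<le> \<sigma> k \<and> (k = 0 \<longrightarrow> f k = u)) \<and> p (f k - f (Suc k)) \<le> K * \<sigma> k"
      proof (rule dependent_nat_choice)
        show "\<exists>x. x \<in> V \<and> q x \<le> \<sigma> 0 \<and> ((0::nat) = 0 \<longrightarrow> x = u)" using u by (simp add: \<sigma>_def)
      next
        fix x k assume x: "x \<in> V \<and> q x \<le> \<sigma> k \<and> (k = 0 \<longrightarrow> x = u)"
        then obtain a where "a \<in> V" "p a \<le> K * \<sigma> k" "q (x - a) \<le> \<sigma> k / 2"
          using approx \<sigma>(1) by blast
        then show "\<exists>y. (y \<in> V \<and> q y \<le> \<sigma> (Suc k) \<and> (Suc k = 0 \<longrightarrow> y = u)) \<and> p (x - y) \<le> K * \<sigma> k"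
          using x Vs(2)[of x a] Vs(2)[of u a] \<sigma>(2)[of k] by (intro exI[of _ "x - a"]) auto
      qed
      then show ?thesis using Vs(2) by blast
    qed
    then obtain f where f: "\<And>k. f k \<in> V" "\<And>k. q (f k) \<le> \<sigma> k"
      "\<And>k. p (f k - f (Suc k)) \<le> K * \<sigma> k" "f 0 = u" by auto
    have s\<sigma>: "(\<lambda>k. K * \<sigma> k) sums (K * (\<rho> * 2))"
      unfolding \<sigma>_def using geometric_sums[of "1 / 2 :: real"] by (intro sums_mult) simp
    have sp: "summable (\<lambda>k. p (f k - f (Suc k)))"
      using f(3) p_nonneg f(1) Vs(2)
      by (intro summable_comparison_test'[OF sums_summable[OF s\<sigma>]]) auto
    have \<sigma>0: "\<sigma> \<longlonglongrightarrow> 0" unfolding \<sigma>_def using LIMSEQ_power_zero[of "1 / 2 :: real"] tendsto_mult_right_zero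
      by fastforce
    have "q ((\<Sum>i<k. f i - f (Suc i)) - u) = q (f k)" for k
    proof -
      have "(\<Sum>i<k. f i - f (Suc i)) - u = - f k" using f(4) by (simp add: sum_lessThan_telescope')
      then show ?thesis using q_minus f(1) by simp
    qed
    moreover have "(\<lambda>k. q (f k)) \<longlonglongrightarrow> 0"
      by (rule tendsto_sandwich[OF _ _ tendsto_const \<sigma>0]) (use f q_nonneg in auto)
    ultimately have "p u \<le> (\<Sum>k. p (f k - f (Suc k)))"
      using p_suminf[of "\<lambda>k. f k - f (Suc k)" u] sp f(1) u Vs by simp
    also have "\<dots> \<le> K * (\<rho> * 2)"
      using suminf_le[OF f(3) sp sums_summable[OF s\<sigma>]] sums_unique[OF s\<sigma>] by simp
    finally show ?thesis by (simp add: mult_ac)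
  qed
  show ?thesis
  proof (rule that[of "2 * K"])
    show "0 \<le> 2 * K" using K by simp
    fix u assume u: "u \<in> V"
    show "p u \<le> 2 * K * q u"
    proof (rule field_le_epsilon)
      fix e :: real assume e: "0 < e"
      \<comment> \<open>\<open>q u\<close> may be 0 although \<open>bound\<close> wants a positive
        radius; the surplus costs at most \<open>e\<close> after multiplication by
        \<open>2 * K\<close>.\<close>
      define \<rho> where "\<rho> = q u + e / (2 * K + 1)"
      have "0 < e / (2 * K + 1)" using e K by simp
      then have "p u \<le> 2 * K * \<rho>" using u q_nonneg[OF u] by (intro bound) (auto simp: \<rho>_def)
      also have "\<dots> = 2 * K * q u + 2 * K / (2 * K + 1) * e" by (simp add: \<rho>_def algebra_simps)
      also have "2 * K / (2 * K + 1) * e \<le> e" using K e by (simp add: field_simps)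
      finally show "p u \<le> 2 * K * q u + e" by simp
    qed
  qed
qed

section \<open>Square-integrable functions\<close>

lemma Cauchy_Schwarz_integral:
  fixes f g :: "'a \<Rightarrow> real"
  assumes [measurable]: "f \<in> borel_measurable M" "g \<in> borel_measurable M"
    and f2: "integrable M (\<lambda>t. (f t)\<^sup>2)" and g2: "integrable M (\<lambda>t. (g t)\<^sup>2)"
  shows "integrable M (\<lambda>t. f t * g t)"
    and "(\<integral>t. \<bar>f t * g t\<bar> \<partial>M) \<le> sqrt (\<integral>t. (f t)\<^sup>2 \<partial>M) * sqrt (\<integral>t. (g t)\<^sup>2 \<partial>M)"
proof -
  show int: "integrable M (\<lambda>t. f t * g t)"
  proof (rule Bochner_Integration.integrable_bound)
    show "integrable M (\<lambda>t. (f t)\<^sup>2 + (g t)\<^sup>2)" using f2 g2 by simp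
    have "\<bar>x * y\<bar> \<le> x\<^sup>2 + y\<^sup>2" for x y :: real
    proof -
      have "0 \<le> (\<bar>x\<bar> - \<bar>y\<bar>)\<^sup>2" "0 \<le> \<bar>x\<bar> * \<bar>y\<bar>" by auto
      then show ?thesis unfolding power2_diff power2_abs abs_mult by linarith
    qed
    then show "AE t in M. norm (f t * g t) \<le> norm ((f t)\<^sup>2 + (g t)\<^sup>2)" by simp
  qed simp
  have "(\<integral>\<^sup>+t. ennreal \<bar>f t\<bar> * ennreal \<bar>g t\<bar> \<partial>M)\<^sup>2 \<le>
      (\<integral>\<^sup>+t. (ennreal \<bar>f t\<bar>)\<^sup>2 \<partial>M) * (\<integral>\<^sup>+t. (ennreal \<bar>g t\<bar>)\<^sup>2 \<partial>M)"
    by (rule Cauchy_Schwarz_nn_integral) simp_all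
  moreover have "(\<integral>\<^sup>+t. ennreal \<bar>f t\<bar> * ennreal \<bar>g t\<bar> \<partial>M) = ennreal (\<integral>t. \<bar>f t * g t\<bar> \<partial>M)"
    using integrable_abs[OF int] by (subst nn_integral_eq_integral[symmetric]) (simp_all add: abs_mult ennreal_mult)
  moreover have "(\<integral>\<^sup>+t. (ennreal \<bar>f t\<bar>)\<^sup>2 \<partial>M) = ennreal (\<integral>t. (f t)\<^sup>2 \<partial>M)"
    using f2 by (subst nn_integral_eq_integral[symmetric]) (simp_all add: ennreal_power)
  moreover have "(\<integral>\<^sup>+t. (ennreal \<bar>g t\<bar>)\<^sup>2 \<partial>M) = ennreal (\<integral>t. (g t)\<^sup>2 \<partial>M)"
    using g2 by (subst nn_integral_eq_integral[symmetric]) (simp_all add: ennreal_power)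
  ultimately have "ennreal ((\<integral>t. \<bar>f t * g t\<bar> \<partial>M)\<^sup>2) \<le> ennreal ((\<integral>t. (f t)\<^sup>2 \<partial>M) * (\<integral>t. (g t)\<^sup>2 \<partial>M))"
    by (simp add: ennreal_power ennreal_mult)
  then have "(\<integral>t. \<bar>f t * g t\<bar> \<partial>M)\<^sup>2 \<le> (\<integral>t. (f t)\<^sup>2 \<partial>M) * (\<integral>t. (g t)\<^sup>2 \<partial>M)"
    by (simp add: ennreal_le_iff)
  then show "(\<integral>t. \<bar>f t * g t\<bar> \<partial>M) \<le> sqrt (\<integral>t. (f t)\<^sup>2 \<partial>M) * sqrt (\<integral>t. (g t)\<^sup>2 \<partial>M)"
    by (metis real_le_rsqrt real_sqrt_mult)
qed

lemma L2_norm_nonneg [simp]: "0 \<le> L2_norm M u"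
  by (simp add: L2_norm_def)

lemma L2_norm_power2: "(L2_norm M u)\<^sup>2 = (\<integral>t. (norm (u t))\<^sup>2 \<partial>M)"
  by (simp add: L2_norm_def)

lemma L2_norm_scaleR: "L2_norm M (\<lambda>t. c *\<^sub>R u t) = \<bar>c\<bar> * L2_norm M u"
  by (simp add: L2_norm_def power_mult_distrib real_sqrt_mult)

lemma L2_scaleR: "u \<in> L2 M \<Longrightarrow> (\<lambda>t. c *\<^sub>R u t) \<in> L2 M"
  by (simp add: L2_def power_mult_distrib strongly_measurable_bounded_linear[OF bounded_linear_scaleR_right])

context complete_finite_measure
begin

text \<open>Choose simple \<open>s n\<close> within \<open>(1 / 2) ^ n\<close> of \<open>f n\<close>
  in mean. The sum of the errors has finite integral, so the errors tend to 0 almost everywhere and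
  \<open>s n\<close> has the same limit as \<open>f n\<close>.\<close>

lemma strongly_measurable_AE_limit:
  fixes f :: "nat \<Rightarrow> 'a \<Rightarrow> 'b::real_normed_vector"
  assumes f: "\<And>n. strongly_measurable M (f n)" "\<And>n. integrable M (\<lambda>t. norm (f n t))"
    and lim: "AE t in M. (\<lambda>n. f n t) \<longlonglongrightarrow> g t"
  shows "strongly_measurable M g"
proof -
  have "\<exists>s. simple_function M s \<and> (\<integral>\<^sup>+t. ennreal (norm (f n t - s t)) \<partial>M) < ennreal ((1 / 2) ^ n)" for n
  proof -
    obtain s where s: "\<And>k::nat. simple_function M (s k)"
      "(\<lambda>k. \<integral>\<^sup>+t. ennreal (norm (f n t - s k t)) \<partial>M) \<longlonglongrightarrow> 0"
      using simple_L1_approximation[OF f(1)[of n] f(2)[of n]] by metis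
    have "eventually (\<lambda>k. (\<integral>\<^sup>+t. ennreal (norm (f n t - s k t)) \<partial>M) < ennreal ((1 / 2) ^ n)) sequentially"
      by (rule order_tendstoD(2)[OF s(2)]) simp
    then show ?thesis using s(1) by (auto simp: eventually_sequentially)
  qed
  then obtain s where s: "\<And>n. simple_function M (s n)"
    "\<And>n. (\<integral>\<^sup>+t. ennreal (norm (f n t - s n t)) \<partial>M) < ennreal ((1 / 2) ^ n)"
    by metis
  have meas: "(\<lambda>t. ennreal (norm (f n t - s n t))) \<in> borel_measurable M" for n
    using borel_measurable_norm_diff_simple[OF f(1) s(1), of n] by simp
  have "(\<integral>\<^sup>+t. (\<Sum>n. ennreal (norm (f n t - s n t))) \<partial>M) =
      (\<Sum>n. \<integral>\<^sup>+t. ennreal (norm (f n t - s n t)) \<partial>M)"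
    using meas by (rule nn_integral_suminf)
  also have "\<dots> \<le> (\<Sum>n. ennreal ((1 / 2) ^ n))"
    using s(2) by (intro suminf_le less_imp_le) auto
  also have "\<dots> = ennreal 2"
    using geometric_sums[of "1 / 2 :: real"] by (intro suminf_ennreal_eq) auto
  finally have "(\<integral>\<^sup>+t. (\<Sum>n. ennreal (norm (f n t - s n t))) \<partial>M) \<noteq> \<infinity>"
    by (auto simp: top_unique)
  then have "AE t in M. (\<Sum>n. ennreal (norm (f n t - s n t))) \<noteq> \<infinity>"
    using meas by (intro nn_integral_PInf_AE borel_measurable_suminf_order)
  with lim have "AE t in M. (\<lambda>n. s n t) \<longlonglongrightarrow> g t"
  proof eventually_elim
    case (elim t)
    then have "summable (\<lambda>n. norm (f n t - s n t))"
      by (intro summable_suminf_not_top) auto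
    then have "(\<lambda>n. f n t - s n t) \<longlonglongrightarrow> 0"
      using summable_LIMSEQ_zero tendsto_norm_zero_iff by blast
    from tendsto_diff[OF elim(1) this] show ?case by simp
  qed
  then show ?thesis using s(1) by (auto simp: strongly_measurable_def)
qed

lemma L2_D:
  assumes "u \<in> L2 M"
  shows "strongly_measurable M u" "integrable M (\<lambda>t. (norm (u t))\<^sup>2)" "integrable M (\<lambda>t. norm (u t))"
    "(\<lambda>t. norm (u t)) \<in> borel_measurable M"
proof -
  show 1: "strongly_measurable M u" "integrable M (\<lambda>t. (norm (u t))\<^sup>2)" using assms by (auto simp: L2_def)
  show 2: "(\<lambda>t. norm (u t)) \<in> borel_measurable M" using 1(1) by (rule borel_measurable_norm_strongly)
  show "integrable M (\<lambda>t. norm (u t))" using 2 1(2) by (rule square_integrable_imp_integrable)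
qed

lemma L2_Cauchy_Schwarz:
  assumes u: "u \<in> L2 M" and v: "v \<in> L2 M"
  shows "integrable M (\<lambda>t. norm (u t) * norm (v t))"
    "(\<integral>t. norm (u t) * norm (v t) \<partial>M) \<le> L2_norm M u * L2_norm M v"
  using Cauchy_Schwarz_integral[OF L2_D(4)[OF u] L2_D(4)[OF v] L2_D(2)[OF u] L2_D(2)[OF v]]
  by (simp_all add: L2_norm_def)

lemma L2_add:
  assumes u: "u \<in> L2 M" and v: "v \<in> L2 M"
  shows "(\<lambda>t. u t + v t) \<in> L2 M"
proof -
  have sm: "strongly_measurable M (\<lambda>t. u t + v t)"
    using L2_D(1)[OF u] L2_D(1)[OF v] by (rule strongly_measurable_add)
  note borel_measurable_norm_strongly[OF sm, measurable]
  have "integrable M (\<lambda>t. (norm (u t + v t))\<^sup>2)"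
  proof (rule Bochner_Integration.integrable_bound)
    show "integrable M (\<lambda>t. (norm (u t))\<^sup>2 + (norm (v t))\<^sup>2 + 2 * (norm (u t) * norm (v t)))"
      using L2_D(2)[OF u] L2_D(2)[OF v] L2_Cauchy_Schwarz(1)[OF u v] by simp
    have "(norm (x + y))\<^sup>2 \<le> (norm x)\<^sup>2 + (norm y)\<^sup>2 + 2 * (norm x * norm y)" for x y :: 'b
      using power_mono[OF norm_triangle_ineq[of x y], of 2] by (simp add: power2_sum)
    then show "AE t in M. norm ((norm (u t + v t))\<^sup>2) \<le>
        norm ((norm (u t))\<^sup>2 + (norm (v t))\<^sup>2 + 2 * (norm (u t) * norm (v t)))" by simp
  qed simp
  then show ?thesis using sm by (simp add: L2_def)
qed

lemma L2_norm_triangle: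
  assumes u: "u \<in> L2 M" and v: "v \<in> L2 M"
  shows "L2_norm M (\<lambda>t. u t + v t) \<le> L2_norm M u + L2_norm M v"
proof -
  have "(L2_norm M (\<lambda>t. u t + v t))\<^sup>2 \<le>
      (\<integral>t. (norm (u t))\<^sup>2 + (norm (v t))\<^sup>2 + 2 * (norm (u t) * norm (v t)) \<partial>M)"
    unfolding L2_norm_power2
  proof (rule integral_mono)
    show "integrable M (\<lambda>t. (norm (u t + v t))\<^sup>2)" using L2_D(2)[OF L2_add[OF u v]] .
    show "integrable M (\<lambda>t. (norm (u t))\<^sup>2 + (norm (v t))\<^sup>2 + 2 * (norm (u t) * norm (v t)))"
      using L2_D(2)[OF u] L2_D(2)[OF v] L2_Cauchy_Schwarz(1)[OF u v] by simp
    show "(norm (u t + v t))\<^sup>2 \<le> (norm (u t))\<^sup>2 + (norm (v t))\<^sup>2 + 2 * (norm (u t) * norm (v t))" for t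
      using power_mono[OF norm_triangle_ineq[of "u t" "v t"], of 2] by (simp add: power2_sum)
  qed
  also have "\<dots> = (L2_norm M u)\<^sup>2 + (L2_norm M v)\<^sup>2 + 2 * (\<integral>t. norm (u t) * norm (v t) \<partial>M)"
    using L2_D(2)[OF u] L2_D(2)[OF v] L2_Cauchy_Schwarz(1)[OF u v] by (simp add: L2_norm_power2)
  also have "\<dots> \<le> (L2_norm M u + L2_norm M v)\<^sup>2"
    using L2_Cauchy_Schwarz(2)[OF u v] by (simp add: power2_sum)
  finally show ?thesis by (rule power2_le_imp_le) simp
qed

lemma L2_zero: "(\<lambda>_. 0) \<in> L2 M"
  by (simp add: L2_def strongly_measurable_simple)

lemma L2_diff: "u \<in> L2 M \<Longrightarrow> v \<in> L2 M \<Longrightarrow> (\<lambda>t. u t - v t) \<in> L2 M"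
  using L2_add[of u "\<lambda>t. (-1) *\<^sub>R v t"] L2_scaleR[of v M "-1"] by simp

lemma L2_sum: "(\<And>i. i < n \<Longrightarrow> u i \<in> L2 M) \<Longrightarrow> (\<lambda>t. \<Sum>i<n::nat. u i t) \<in> L2 M"
  by (induction n) (simp_all add: L2_zero L2_add)

lemma L2_norm_sum_le:
  "(\<And>i. i < n \<Longrightarrow> u i \<in> L2 M) \<Longrightarrow> L2_norm M (\<lambda>t. \<Sum>i<n::nat. u i t) \<le> (\<Sum>i<n. L2_norm M (u i))"
proof (induction n)
  case 0 then show ?case by (simp add: L2_norm_def)
next
  case (Suc n)
  have "L2_norm M (\<lambda>t. (\<Sum>i<n. u i t) + u n t) \<le> L2_norm M (\<lambda>t. \<Sum>i<n. u i t) + L2_norm M (u n)"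
    using Suc.prems by (intro L2_norm_triangle L2_sum) auto
  then show ?case using Suc by fastforce
qed

lemma L1_le_L2:
  assumes "u \<in> L2 M"
  shows "(\<integral>t. norm (u t) \<partial>M) \<le> sqrt (measure M (space M)) * L2_norm M u"
proof -
  have "(\<lambda>_. 1::real) \<in> L2 M" by (simp add: L2_def strongly_measurable_simple)
  from L2_Cauchy_Schwarz(2)[OF this assms] show ?thesis by (simp add: L2_norm_def)
qed

text \<open>Riesz-Fischer in series form. On a finite measure the L^1 norms are summable too, which
  gives a.e. absolute convergence; Fatou then bounds the L^2 distance of a partial sum from the
  limit by the tail of the norms.\<close>

lemma L2_complete:
  fixes u :: "nat \<Rightarrow> 'a \<Rightarrow> 'b::banach"
  assumes u: "\<And>n. u n \<in> L2 M" and sum: "summable (\<lambda>n. L2_norm M (u n))"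
  shows "\<exists>w\<in>L2 M. (\<lambda>n. L2_norm M (\<lambda>t. (\<Sum>i<n. u i t) - w t)) \<longlonglongrightarrow> 0"
proof -
  let ?s = "\<lambda>n t. \<Sum>i<n. u i t"
  have [measurable]: "(\<lambda>t. norm (u n t)) \<in> borel_measurable M" for n using L2_D(4)[OF u] .
  let ?c = "sqrt (measure M (space M))"
  have "(\<integral>\<^sup>+t. (\<Sum>n. ennreal (norm (u n t))) \<partial>M) = (\<Sum>n. \<integral>\<^sup>+t. ennreal (norm (u n t)) \<partial>M)"
    by (rule nn_integral_suminf) simp
  also have "\<dots> = (\<Sum>n. ennreal (\<integral>t. norm (u n t) \<partial>M))"
    using L2_D(3)[OF u] by (simp add: nn_integral_eq_integral)
  also have "\<dots> \<le> (\<Sum>n. ennreal (?c * L2_norm M (u n)))"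
    using L1_le_L2[OF u] by (intro suminf_le ennreal_leI) auto
  also have "\<dots> = ennreal (\<Sum>n. ?c * L2_norm M (u n))"
    by (rule suminf_ennreal2) (auto intro: summable_mult sum)
  finally have "(\<integral>\<^sup>+t. (\<Sum>n. ennreal (norm (u n t))) \<partial>M) \<noteq> \<infinity>"
    by (auto simp: top_unique)
  then have fin: "AE t in M. (\<Sum>n. ennreal (norm (u n t))) \<noteq> \<infinity>"
    by (intro nn_integral_PInf_AE borel_measurable_suminf) simp_all
  \<comment> \<open>Where the series diverges, the value of \<open>w\<close> is unspecified; this
    happens only on a null set.\<close>
  define w where "w t = (\<Sum>n. u n t)" for t
  have lim: "AE t in M. (\<lambda>n. ?s n t) \<longlonglongrightarrow> w t"
    using fin
  proof eventually_elim
    case (elim t)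
    then have "summable (\<lambda>n. norm (u n t))" by (intro summable_suminf_not_top) auto
    then have "summable (\<lambda>n. u n t)" by (rule summable_norm_cancel)
    then show ?case unfolding w_def by (rule summable_LIMSEQ)
  qed
  have partial: "?s n \<in> L2 M" for n using u by (intro L2_sum)
  have sm: "strongly_measurable M w"
    using L2_D(1)[OF partial] L2_D(3)[OF partial] lim by (rule strongly_measurable_AE_limit)
  define r where "r n = (\<Sum>i. L2_norm M (u (i + n)))" for n
  have r: "r \<longlonglongrightarrow> 0" unfolding r_def using suminf_exist_split2[OF sum] by simp
  have tail: "L2_norm M (\<lambda>t. ?s (n + k) t - ?s n t) \<le> r n" for n k
  proof -
    have "?s (n + k) t - ?s n t = (\<Sum>i<k. u (i + n) t)" for t
      by (induction k) (auto simp: add.commute algebra_simps)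
    then have "L2_norm M (\<lambda>t. ?s (n + k) t - ?s n t) \<le> (\<Sum>i<k. L2_norm M (u (i + n)))"
      using L2_norm_sum_le[of k "\<lambda>i. u (i + n)"] u by simp
    also have "\<dots> \<le> r n"
      unfolding r_def by (intro sum_le_suminf summable_ignore_initial_segment sum) auto
    finally show ?thesis .
  qed
  have Fatou: "(\<integral>\<^sup>+t. ennreal ((norm (?s n t - w t))\<^sup>2) \<partial>M) \<le> ennreal ((r n)\<^sup>2)" for n
  proof -
    let ?D = "\<lambda>k t. ?s (n + k) t - ?s n t"
    have D: "?D k \<in> L2 M" for k using partial by (intro L2_diff)
    have "(\<integral>\<^sup>+t. ennreal ((norm (?s n t - w t))\<^sup>2) \<partial>M) =
        (\<integral>\<^sup>+t. liminf (\<lambda>k. ennreal ((norm (?D k t))\<^sup>2)) \<partial>M)"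
    proof (rule nn_integral_cong_AE, use lim in eventually_elim)
      fix t assume "(\<lambda>n. ?s n t) \<longlonglongrightarrow> w t"
      then have "(\<lambda>k. ?s (n + k) t) \<longlonglongrightarrow> w t"
        by (subst add.commute) (rule LIMSEQ_ignore_initial_segment)
      then have "(\<lambda>k. ennreal ((norm (?D k t))\<^sup>2)) \<longlonglongrightarrow> ennreal ((norm (w t - ?s n t))\<^sup>2)"
        by (intro tendsto_intros)
      then show "ennreal ((norm (?s n t - w t))\<^sup>2) = liminf (\<lambda>k. ennreal ((norm (?D k t))\<^sup>2))"
        by (metis lim_imp_Liminf norm_minus_commute sequentially_bot)
    qed
    also have "\<dots> \<le> liminf (\<lambda>k. \<integral>\<^sup>+t. ennreal ((norm (?D k t))\<^sup>2) \<partial>M)"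
    proof (rule nn_integral_liminf)
      show "(\<lambda>t. ennreal ((norm (?D k t))\<^sup>2)) \<in> borel_measurable M" for k
        using L2_D(4)[OF D[of k]] by simp
    qed
    also have "\<dots> \<le> liminf (\<lambda>k::nat. ennreal ((r n)\<^sup>2))"
    proof (rule Liminf_mono, intro always_eventually allI)
      fix k
      have "(\<integral>\<^sup>+t. ennreal ((norm (?D k t))\<^sup>2) \<partial>M) = ennreal ((L2_norm M (?D k))\<^sup>2)"
        using L2_D(2)[OF D[of k]] by (simp add: nn_integral_eq_integral L2_norm_power2)
      also have "\<dots> \<le> ennreal ((r n)\<^sup>2)" by (intro ennreal_leI power_mono tail) simp
      finally show "(\<integral>\<^sup>+t. ennreal ((norm (?D k t))\<^sup>2) \<partial>M) \<le> ennreal ((r n)\<^sup>2)" .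
    qed
    finally show ?thesis by (simp add: Liminf_const)
  qed
  have sm_diff: "strongly_measurable M (\<lambda>t. ?s n t - w t)" for n
    using L2_D(1)[OF partial] sm by (rule strongly_measurable_diff)
  have in_L2: "(\<lambda>t. ?s n t - w t) \<in> L2 M" for n
  proof -
    have "(\<integral>\<^sup>+t. ennreal (norm ((norm (?s n t - w t))\<^sup>2)) \<partial>M) < \<infinity>"
      using Fatou[of n] by (simp add: le_less_trans)
    then have "integrable M (\<lambda>t. (norm (?s n t - w t))\<^sup>2)"
      using borel_measurable_norm_strongly[OF sm_diff[of n]] by (intro integrableI_bounded) simp_all
    then show ?thesis using sm_diff by (simp add: L2_def)
  qed
  have r_nonneg: "0 \<le> r n" for n
    unfolding r_def by (intro suminf_nonneg summable_ignore_initial_segment sum) auto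
  have "L2_norm M (\<lambda>t. ?s n t - w t) \<le> r n" for n
  proof (rule power2_le_imp_le)
    have "ennreal ((L2_norm M (\<lambda>t. ?s n t - w t))\<^sup>2) \<le> ennreal ((r n)\<^sup>2)"
      using Fatou[of n] L2_D(2)[OF in_L2[of n]] by (simp add: nn_integral_eq_integral L2_norm_power2)
    then show "(L2_norm M (\<lambda>t. ?s n t - w t))\<^sup>2 \<le> (r n)\<^sup>2" by (simp add: ennreal_le_iff)
  qed (rule r_nonneg)
  then have "(\<lambda>n. L2_norm M (\<lambda>t. ?s n t - w t)) \<longlonglongrightarrow> 0"
    by (intro tendsto_sandwich[OF _ _ tendsto_const r]) auto
  \<comment> \<open>The partial sum at index 0 is empty, so \<open>in_L2\<close> says that
    \<open>- w\<close> is in \<open>L2 M\<close>.\<close>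
  moreover have "w \<in> L2 M"
    using L2_scaleR[OF in_L2[of 0], of "-1"] by simp
  ultimately show ?thesis by blast
qed

lemma subspace_L2: "subspace (L2 M :: ('a \<Rightarrow> 'b::real_normed_vector) set)"
  using L2_zero L2_add L2_scaleR
  by (auto simp: subspace_def zero_fun_def plus_fun_def scaleR_fun_def)

end

section \<open>Restriction and translation of the time interval\<close>

text \<open>The hypothesis says that the image of \<open>N\<close> under \<open>h\<close> is
  dominated by \<open>M\<close>. Inclusion of a shorter interval and translation of an interval are
  both of this kind, so measurability, integrals and \<open>L2\<close> are pulled back once for
  both.\<close>

lemma measure_le_pullback:
  assumes h: "h \<in> N \<rightarrow>\<^sub>M M"
    and le: "\<And>A. A \<in> sets M \<Longrightarrow> emeasure N (h -` A \<inter> space N) \<le> emeasure M A"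
  shows AE_pullback: "AE t in M. P t \<Longrightarrow> AE t in N. P (h t)"
    and nn_integral_pullback_le: "f \<in> borel_measurable M \<Longrightarrow> (\<integral>\<^sup>+t. f (h t) \<partial>N) \<le> (\<integral>\<^sup>+t. f t \<partial>M)"
proof -
  show "AE t in N. P (h t)" if ae: "AE t in M. P t"
  proof -
    obtain A where A: "{t \<in> space M. \<not> P t} \<subseteq> A" "emeasure M A = 0" "A \<in> sets M"
      using ae by (rule AE_E)
    show ?thesis
    proof (rule AE_I)
      show "{t \<in> space N. \<not> P (h t)} \<subseteq> h -` A \<inter> space N"
        using A(1) measurable_space[OF h] by auto
      show "emeasure N (h -` A \<inter> space N) = 0" using le[OF A(3)] A(2) by simp
      show "h -` A \<inter> space N \<in> sets N" using h A(3) by (rule measurable_sets)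
    qed
  qed
  show "(\<integral>\<^sup>+t. f (h t) \<partial>N) \<le> (\<integral>\<^sup>+t. f t \<partial>M)" if f: "f \<in> borel_measurable M"
  proof -
    have "emeasure (distr N M h) A \<le> emeasure M A" for A
      by (cases "A \<in> sets M") (auto simp: emeasure_distr[OF h] emeasure_notin_sets le)
    then have "distr N M h \<le> M"
      unfolding le_measure_iff by (simp add: le_fun_def)
    then have "(\<integral>\<^sup>+t. f t \<partial>distr N M h) \<le> (\<integral>\<^sup>+t. f t \<partial>M)"
      by (intro nn_integral_mono_measure) auto
    then show ?thesis using nn_integral_distr[OF h, of f] f by simp
  qed
qed

lemma simple_function_pullback:
  assumes "h \<in> N \<rightarrow>\<^sub>M M" "simple_function M s"
  shows "simple_function N (\<lambda>t. s (h t))"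
  unfolding simple_function_def
proof
  have "(\<lambda>t. s (h t)) ` space N \<subseteq> s ` space M" using measurable_space[OF assms(1)] by auto
  then show "finite ((\<lambda>t. s (h t)) ` space N)"
    using assms(2) finite_subset by (auto simp: simple_function_def)
  show "\<forall>x\<in>(\<lambda>t. s (h t)) ` space N. (\<lambda>t. s (h t)) -` {x} \<inter> space N \<in> sets N"
  proof
    fix x assume "x \<in> (\<lambda>t. s (h t)) ` space N"
    then have "s -` {x} \<inter> space M \<in> sets M"
      using simple_functionD(2)[OF assms(2)] by simp
    from measurable_sets[OF assms(1) this]
    have "h -` (s -` {x} \<inter> space M) \<inter> space N \<in> sets N" .
    also have "h -` (s -` {x} \<inter> space M) \<inter> space N = (\<lambda>t. s (h t)) -` {x} \<inter> space N"
      using measurable_space[OF assms(1)] by auto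
    finally show "(\<lambda>t. s (h t)) -` {x} \<inter> space N \<in> sets N" .
  qed
qed

lemma strongly_measurable_pullback:
  assumes h: "h \<in> N \<rightarrow>\<^sub>M M"
    and le: "\<And>A. A \<in> sets M \<Longrightarrow> emeasure N (h -` A \<inter> space N) \<le> emeasure M A"
    and f: "strongly_measurable M f"
  shows "strongly_measurable N (\<lambda>t. f (h t))"
proof -
  obtain s where s: "\<And>n::nat. simple_function M (s n)" "AE t in M. (\<lambda>n. s n t) \<longlonglongrightarrow> f t"
    using f by (auto simp: strongly_measurable_def)
  show ?thesis
    unfolding strongly_measurable_def
    using simple_function_pullback[OF h s(1)] AE_pullback[OF h le s(2)]
    by (intro exI[of _ "\<lambda>n t. s n (h t)"]) simp
qed

lemma integrable_pullback:
  fixes f :: "'a \<Rightarrow> real"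
  assumes h: "h \<in> N \<rightarrow>\<^sub>M M"
    and le: "\<And>A. A \<in> sets M \<Longrightarrow> emeasure N (h -` A \<inter> space N) \<le> emeasure M A"
    and f: "integrable M f"
  shows "integrable N (\<lambda>t. f (h t))"
proof (rule integrableI_bounded)
  have [measurable]: "f \<in> borel_measurable M" using f by simp
  show "(\<lambda>t. f (h t)) \<in> borel_measurable N" using h by measurable
  have "(\<integral>\<^sup>+t. ennreal (norm (f (h t))) \<partial>N) \<le> (\<integral>\<^sup>+t. ennreal (norm (f t)) \<partial>M)"
    using borel_measurable_integrable[OF f]
    by (intro nn_integral_pullback_le[OF h le, of "\<lambda>t. ennreal (norm (f t))"]) simp_all
  also have "\<dots> < \<infinity>" using f by (simp add: integrable_iff_bounded)
  finally show "(\<integral>\<^sup>+t. ennreal (norm (f (h t))) \<partial>N) < \<infinity>" .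
qed

lemma L2_pullback:
  assumes h: "h \<in> N \<rightarrow>\<^sub>M M"
    and le: "\<And>A. A \<in> sets M \<Longrightarrow> emeasure N (h -` A \<inter> space N) \<le> emeasure M A"
    and u: "u \<in> L2 M"
  shows "(\<lambda>t. u (h t)) \<in> L2 N" "L2_norm N (\<lambda>t. u (h t)) \<le> L2_norm M u"
proof -
  have int: "integrable M (\<lambda>t. (norm (u t))\<^sup>2)" using u by (simp add: L2_def)
  show 1: "(\<lambda>t. u (h t)) \<in> L2 N"
    using u strongly_measurable_pullback[OF h le, of u]
      integrable_pullback[OF h le, of "\<lambda>t. (norm (u t))\<^sup>2"] by (simp add: L2_def)
  have "ennreal (\<integral>t. (norm (u (h t)))\<^sup>2 \<partial>N) = (\<integral>\<^sup>+t. ennreal ((norm (u (h t)))\<^sup>2) \<partial>N)"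
    using 1 by (subst nn_integral_eq_integral) (auto simp: L2_def)
  also have "\<dots> \<le> (\<integral>\<^sup>+t. ennreal ((norm (u t))\<^sup>2) \<partial>M)"
    by (rule nn_integral_pullback_le[OF h le, of "\<lambda>t. ennreal ((norm (u t))\<^sup>2)"])
       (use borel_measurable_integrable[OF int] in simp_all)
  also have "\<dots> = ennreal (\<integral>t. (norm (u t))\<^sup>2 \<partial>M)"
    using int by (subst nn_integral_eq_integral) auto
  finally show "L2_norm N (\<lambda>t. u (h t)) \<le> L2_norm M u"
    by (simp add: L2_norm_def ennreal_le_iff)
qed

lemma L2_zero_extension:
  fixes w :: "real \<Rightarrow> 'b::real_normed_vector"
  assumes PQ: "P \<subseteq> Q" "P \<in> sets lebesgue" "Q \<in> sets lebesgue"
    and w: "w \<in> L2 (lebesgue_on P)"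
  shows "(\<lambda>t. if t \<in> P then w t else 0) \<in> L2 (lebesgue_on Q)"
    "L2_norm (lebesgue_on Q) (\<lambda>t. if t \<in> P then w t else 0) = L2_norm (lebesgue_on P) w"
proof -
  let ?w = "\<lambda>t. if t \<in> P then w t else 0"
  obtain s where s: "\<And>n::nat. simple_function (lebesgue_on P) (s n)"
    "AE t in lebesgue_on P. (\<lambda>n. s n t) \<longlonglongrightarrow> w t"
    using w by (auto simp: L2_def strongly_measurable_def)
  let ?s = "\<lambda>n t. if t \<in> P then s n t else 0"
  have simple: "simple_function (lebesgue_on Q) (?s n)" for n
    unfolding simple_function_def
  proof
    have "?s n ` space (lebesgue_on Q) \<subseteq> insert 0 (s n ` space (lebesgue_on P))"
      by auto
    moreover have "finite (s n ` space (lebesgue_on P))"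
      using s(1)[of n] unfolding simple_function_def by blast
    ultimately show "finite (?s n ` space (lebesgue_on Q))"
      by (meson finite_insert finite_subset)
    show "\<forall>x\<in>?s n ` space (lebesgue_on Q).
        ?s n -` {x} \<inter> space (lebesgue_on Q) \<in> sets (lebesgue_on Q)"
    proof
      fix x
      have "s n -` {x} \<inter> space (lebesgue_on P) \<in> sets (lebesgue_on P)"
        using simple_functionD(2)[OF s(1)[of n]] by blast
      then have 1: "s n -` {x} \<inter> P \<in> sets lebesgue" using PQ by (simp add: sets_restrict_space_iff)
      \<comment> \<open>On \<open>Q - P\<close> the extension is 0, so only the level set of 0
        grows.\<close>
      have "?s n -` {x} \<inter> space (lebesgue_on Q) =
          (s n -` {x} \<inter> P) \<union> (if x = 0 then Q - P else {})"
        using PQ(1) by (auto split: if_splits)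
      also have "\<dots> \<in> sets (lebesgue_on Q)"
        using 1 PQ by (auto simp: sets_restrict_space_iff)
      finally show "?s n -` {x} \<inter> space (lebesgue_on Q) \<in> sets (lebesgue_on Q)" .
    qed
  qed
  have "AE t in lebesgue. t \<in> P \<longrightarrow> (\<lambda>n. s n t) \<longlonglongrightarrow> w t"
    using s(2) PQ by (simp add: AE_restrict_space_iff)
  then have "AE t in lebesgue. t \<in> Q \<longrightarrow> (\<lambda>n. if t \<in> P then s n t else 0) \<longlonglongrightarrow> ?w t"
    by eventually_elim auto
  then have "AE t in lebesgue_on Q. (\<lambda>n. if t \<in> P then s n t else 0) \<longlonglongrightarrow> ?w t"
    using PQ by (simp add: AE_restrict_space_iff)
  then have sm: "strongly_measurable (lebesgue_on Q) ?w"
    unfolding strongly_measurable_def using simple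
    by (intro exI[of _ ?s]) simp
  have eq: "indicator Q t *\<^sub>R (norm (?w t))\<^sup>2 = indicator P t *\<^sub>R (norm (w t))\<^sup>2" for t
    using PQ(1) by (auto simp: indicator_def)
  have "integrable (lebesgue_on Q) (\<lambda>t. (norm (?w t))\<^sup>2) \<longleftrightarrow> integrable (lebesgue_on P) (\<lambda>t. (norm (w t))\<^sup>2)"
    using PQ by (simp only: integrable_restrict_space eq sets.Int sets.top Int_UNIV_right space_completion space_lborel space_borel)
  then show "?w \<in> L2 (lebesgue_on Q)" using sm w by (simp add: L2_def)
  have "(\<integral>t. (norm (?w t))\<^sup>2 \<partial>lebesgue_on Q) = (\<integral>t. (norm (w t))\<^sup>2 \<partial>lebesgue_on P)"
    using PQ by (simp only: integral_restrict_space eq sets.Int sets.top Int_UNIV_right space_completion space_lborel space_borel)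
  then show "L2_norm (lebesgue_on Q) ?w = L2_norm (lebesgue_on P) w" by (simp add: L2_norm_def)
qed

section \<open>Splitting an integral at an intermediate time\<close>

lemma (in complete_finite_measure) Bochner_integral_cong_AE:
  fixes f g :: "'a \<Rightarrow> 'b::banach"
  assumes f: "strongly_measurable M f" "integrable M (\<lambda>t. norm (f t))" and eq: "AE t in M. f t = g t"
  shows "Bochner_integral M f = Bochner_integral M g"
proof -
  have "has_Bochner_integral M g (Bochner_integral M f)"
  proof -
    have "(L1_dist M f s) = (L1_dist M g s)" for s
      using eq by (intro nn_integral_cong_AE) auto
    then show ?thesis
      using has_Bochner_integral_Bochner_integral[OF f] strongly_measurable_cong_AE[OF f(1) eq]
      by (simp add: has_Bochner_integral_def)
  qed
  then show ?thesis by (simp add: Bochner_integral_eq)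
qed

text \<open>Here \<open>M\<close> is the sum of the images of \<open>M1\<close> and
  \<open>M2\<close>. For simple functions the formula is additivity of measures of level sets; each
  image is dominated by \<open>M\<close>, so one approximating sequence works for all three
  integrals and the formula passes to the limit.\<close>

lemma Bochner_integral_split:
  fixes f :: "'a \<Rightarrow> 'b::banach"
  assumes M: "complete_finite_measure M" "complete_finite_measure M1" "complete_finite_measure M2"
    and h1: "h1 \<in> M1 \<rightarrow>\<^sub>M M" and h2: "h2 \<in> M2 \<rightarrow>\<^sub>M M"
    and split: "\<And>A. A \<in> sets M \<Longrightarrow> emeasure M A =
        emeasure M1 (h1 -` A \<inter> space M1) + emeasure M2 (h2 -` A \<inter> space M2)"
    and f: "strongly_measurable M f" "integrable M (\<lambda>t. norm (f t))"
  shows "Bochner_integral M f = Bochner_integral M1 (\<lambda>t. f (h1 t)) + Bochner_integral M2 (\<lambda>t. f (h2 t))"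
proof -
  interpret M: complete_finite_measure M by fact
  interpret M1: complete_finite_measure M1 by fact
  interpret M2: complete_finite_measure M2 by fact
  have le1: "emeasure M1 (h1 -` A \<inter> space M1) \<le> emeasure M A" if "A \<in> sets M" for A
    using split[OF that] by simp
  have le2: "emeasure M2 (h2 -` A \<inter> space M2) \<le> emeasure M A" if "A \<in> sets M" for A
    using split[OF that] by simp
  obtain s where s: "\<And>n::nat. simple_function M (s n)"
    "(\<lambda>n. L1_dist M f (s n)) \<longlonglongrightarrow> 0" "(\<lambda>n. simple_integral M (s n)) \<longlonglongrightarrow> Bochner_integral M f"
    using M.simple_approximation[OF f] by metis
  have meas: "(\<lambda>t. ennreal (norm (f t - s n t))) \<in> borel_measurable M" for n
    using M.borel_measurable_norm_diff_simple[OF f(1) s(1), of n] by simp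
  have lim1: "(\<lambda>n. \<integral>\<^sup>+t. ennreal (norm (f (h1 t) - s n (h1 t))) \<partial>M1) \<longlonglongrightarrow> 0"
    by (rule tendsto_sandwich[OF _ _ tendsto_const s(2)])
       (use nn_integral_pullback_le[OF h1 le1 meas] in auto)
  have lim2: "(\<lambda>n. \<integral>\<^sup>+t. ennreal (norm (f (h2 t) - s n (h2 t))) \<partial>M2) \<longlonglongrightarrow> 0"
    by (rule tendsto_sandwich[OF _ _ tendsto_const s(2)])
       (use nn_integral_pullback_le[OF h2 le2 meas] in auto)
  \<comment> \<open>All sums are made to run over the values taken on \<open>M\<close>; a value not
    attained along \<open>h\<close> has an empty level set and contributes 0.\<close>
  have part: "(\<Sum>y\<in>r ` space M. measure N {t \<in> space N. r (h t) = y} *\<^sub>R y) =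
      simple_integral N (\<lambda>t. r (h t))"
    if h: "h \<in> N \<rightarrow>\<^sub>M M" and r: "simple_function M r" for N h and r :: "'a \<Rightarrow> 'b"
    unfolding simple_bochner_integral_def
  proof (rule sum.mono_neutral_right)
    show "finite (r ` space M)" using r by (simp add: simple_function_def)
    show "(\<lambda>t. r (h t)) ` space N \<subseteq> r ` space M" using measurable_space[OF h] by auto
    show "\<forall>y\<in>r ` space M - (\<lambda>t. r (h t)) ` space N. measure N {t \<in> space N. r (h t) = y} *\<^sub>R y = 0"
    proof
      fix y assume "y \<in> r ` space M - (\<lambda>t. r (h t)) ` space N"
      then have "{t \<in> space N. r (h t) = y} = {}" by (auto simp: image_iff)
      then show "measure N {t \<in> space N. r (h t) = y} *\<^sub>R y = 0" by (simp only: measure_empty scaleR_zero_left)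
    qed
  qed
  have simple: "simple_integral M (s n) =
      simple_integral M1 (\<lambda>t. s n (h1 t)) +
      simple_integral M2 (\<lambda>t. s n (h2 t))" for n
  proof -
    have "measure M {t \<in> space M. s n t = y} =
        measure M1 {t \<in> space M1. s n (h1 t) = y} + measure M2 {t \<in> space M2. s n (h2 t) = y}" for y
    proof -
      have "s n -` {y} \<inter> space M \<in> sets M" using simple_functionD(2)[OF s(1)] by blast
      moreover have "s n -` {y} \<inter> space M = {t \<in> space M. s n t = y}" by auto
      moreover have "h1 -` {t \<in> space M. s n t = y} \<inter> space M1 = {t \<in> space M1. s n (h1 t) = y}"
        using measurable_space[OF h1] by auto
      moreover have "h2 -` {t \<in> space M. s n t = y} \<inter> space M2 = {t \<in> space M2. s n (h2 t) = y}"
        using measurable_space[OF h2] by auto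
      ultimately have "emeasure M {t \<in> space M. s n t = y} =
          emeasure M1 {t \<in> space M1. s n (h1 t) = y} + emeasure M2 {t \<in> space M2. s n (h2 t) = y}"
        using split[of "{t \<in> space M. s n t = y}"] by simp
      then show ?thesis
        by (simp add: M.emeasure_eq_measure M1.emeasure_eq_measure M2.emeasure_eq_measure flip: ennreal_plus)
    qed
    then show ?thesis
      unfolding part[OF h1 s(1), symmetric] part[OF h2 s(1), symmetric]
      by (simp add: simple_bochner_integral_def scaleR_add_left sum.distrib)
  qed
  note s(3)
  moreover have "(\<lambda>n. simple_integral M1 (\<lambda>t. s n (h1 t)))
      \<longlonglongrightarrow> Bochner_integral M1 (\<lambda>t. f (h1 t))"
    by (rule M1.has_Bochner_integral_limit[OF M1.has_Bochner_integral_Bochner_integral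
          simple_function_pullback[OF h1 s(1)] lim1])
       (use strongly_measurable_pullback[OF h1 le1 f(1)] integrable_pullback[OF h1 le1 f(2)] in auto)
  moreover have "(\<lambda>n. simple_integral M2 (\<lambda>t. s n (h2 t)))
      \<longlonglongrightarrow> Bochner_integral M2 (\<lambda>t. f (h2 t))"
    by (rule M2.has_Bochner_integral_limit[OF M2.has_Bochner_integral_Bochner_integral
          simple_function_pullback[OF h2 s(1)] lim2])
       (use strongly_measurable_pullback[OF h2 le2 f(1)] integrable_pullback[OF h2 le2 f(2)] in auto)
  ultimately show ?thesis
    unfolding simple using LIMSEQ_unique tendsto_add by blast
qed

lemma translation_measurable_lebesgue: "(\<lambda>t::real. s + t) \<in> lebesgue \<rightarrow>\<^sub>M lebesgue"
  using lebesgue_affine_measurable[of "\<lambda>_. 1" s] by simp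

lemma emeasure_lebesgue_translation:
  "emeasure lebesgue ((\<lambda>t::real. s + t) -` A) = emeasure lebesgue A"
proof -
  have "(\<lambda>t. s + t) -` A = (\<lambda>x. 1 *\<^sub>R x + (- s)) ` A" by (force simp: image_iff)
  then show ?thesis using emeasure_lebesgue_affine[of 1 "- s" A] by simp
qed

lemma interval_translation:
  assumes "0 \<le> s"
  shows "(\<lambda>t::real. s + t) \<in> Leb t \<rightarrow>\<^sub>M Leb (s + t)"
    and "A \<in> sets (Leb (s + t)) \<Longrightarrow>
      emeasure (Leb t) ((\<lambda>t. s + t) -` A \<inter> space (Leb t)) =
      emeasure lebesgue (A \<inter> {s<..<s + t})"
proof -
  show "(\<lambda>t::real. s + t) \<in> Leb t \<rightarrow>\<^sub>M Leb (s + t)"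
    using assms by (intro measurable_restrict_space3 translation_measurable_lebesgue) auto
  assume A: "A \<in> sets (Leb (s + t))"
  have "(\<lambda>t. s + t) -` A \<inter> space (Leb t) = (\<lambda>t. s + t) -` (A \<inter> {s<..<s + t})"
    by auto
  then show "emeasure (Leb t) ((\<lambda>t. s + t) -` A \<inter> space (Leb t)) =
      emeasure lebesgue (A \<inter> {s<..<s + t})"
    using emeasure_lebesgue_translation[of s "A \<inter> {s<..<s + t}"]
    by (subst emeasure_restrict_space) auto
qed

lemma interval_inclusion:
  assumes "s \<le> r"
  shows "(\<lambda>t::real. t) \<in> Leb s \<rightarrow>\<^sub>M Leb r"
    and "A \<in> sets (Leb r) \<Longrightarrow>
      emeasure (Leb s) ((\<lambda>t. t) -` A \<inter> space (Leb s)) =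
      emeasure lebesgue (A \<inter> {0<..<s})"
proof -
  show "(\<lambda>t::real. t) \<in> Leb s \<rightarrow>\<^sub>M Leb r"
    using assms by (intro measurable_restrict_space3 measurable_ident_sets) auto
  show "emeasure (Leb s) ((\<lambda>t. t) -` A \<inter> space (Leb s)) =
      emeasure lebesgue (A \<inter> {0<..<s})"
    by (subst emeasure_restrict_space) (auto simp: Int_commute)
qed

lemma emeasure_interval_split:
  assumes "0 \<le> s" "0 \<le> t" "A \<in> sets (Leb (s + t::real))"
  shows "emeasure (Leb (s + t)) A =
    emeasure (Leb s) ((\<lambda>t. t) -` A \<inter> space (Leb s)) +
    emeasure (Leb t) ((\<lambda>t. s + t) -` A \<inter> space (Leb t))"
proof -
  have A: "A \<in> sets lebesgue" "A \<subseteq> {0<..<s + t}" using assms(3) by (auto simp: sets_restrict_space_iff)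
  have "emeasure (Leb (s + t)) A = emeasure lebesgue A"
    using A by (intro emeasure_restrict_space) auto
  \<comment> \<open>The dividing point \<open>s\<close> belongs to neither open piece and has
    measure 0.\<close>
  also have "\<dots> = emeasure lebesgue ((A \<inter> {0<..<s}) \<union> (A \<inter> {s<..<s + t}) \<union> (A \<inter> {s}))"
    using A(2) by (intro arg_cong[where f="emeasure lebesgue"]) force
  also have "\<dots> = emeasure lebesgue ((A \<inter> {0<..<s}) \<union> (A \<inter> {s<..<s + t}))"
  proof (rule emeasure_Un_null_set)
    show "(A \<inter> {0<..<s}) \<union> (A \<inter> {s<..<s + t}) \<in> sets lebesgue"
      using A by (intro sets.Un sets.Int) auto
    show "A \<inter> {s} \<in> null_sets lebesgue"
      using negligible_subset[OF negligible_sing[of s], of "A \<inter> {s}"]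
      by (simp add: negligible_iff_null_sets)
  qed
  also have "\<dots> = emeasure lebesgue (A \<inter> {0<..<s}) + emeasure lebesgue (A \<inter> {s<..<s + t})"
    using A by (intro plus_emeasure[symmetric]) auto
  finally show ?thesis
    using interval_inclusion(2)[of s "s + t" A] interval_translation(2)[of s A t] assms by simp
qed

section \<open>Semigroups and the extrapolation space\<close>

instance complex_banach \<subseteq> banach ..
instance complex_hilbert \<subseteq> banach ..

text \<open>Banach-Steinhaus from Zabreiko's lemma: a pointwise finite supremum of continuous
  seminorms is countably subadditive.\<close>

lemma pointwise_bounded_imp_uniformly_bounded:
  fixes F :: "nat \<Rightarrow> 'a::banach \<Rightarrow> 'b::real_normed_vector"
  assumes lin: "\<And>n. bounded_linear (F n)" and bdd: "\<And>x. bdd_above (range (\<lambda>n. norm (F n x)))"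
  obtains K where "0 \<le> K" "\<And>n x. norm (F n x) \<le> K * norm x"
proof -
  define p where "p x = (SUP n. norm (F n x))" for x
  have upper: "norm (F n x) \<le> p x" for n x unfolding p_def by (intro cSUP_upper bdd) simp
  have least: "p x \<le> c" if "\<And>n. norm (F n x) \<le> c" for x c
    unfolding p_def by (rule cSUP_least) (use that in auto)
  have p_nonneg: "0 \<le> p x" for x using upper[of 0 x] norm_ge_zero order_trans by blast
  have p_scale_le: "p (c *\<^sub>R x) \<le> \<bar>c\<bar> * p x" for c x
    by (rule least) (simp add: linear_scale[OF bounded_linear.linear[OF lin]] mult_left_mono upper)
  have p_scale: "p (c *\<^sub>R x) = \<bar>c\<bar> * p x" for c x
  proof (cases "c = 0")
    case True then show ?thesis using p_scale_le[of 0 x] p_nonneg[of 0] by simp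
  next
    case False
    have "p x \<le> \<bar>1 / c\<bar> * p (c *\<^sub>R x)" using p_scale_le[of "1 / c" "c *\<^sub>R x"] False by simp
    then have "\<bar>c\<bar> * p x \<le> p (c *\<^sub>R x)" using False by (simp add: abs_divide field_simps)
    then show ?thesis using p_scale_le[of c x] by simp
  qed
  obtain K where "0 \<le> K" "\<And>x. x \<in> UNIV \<Longrightarrow> p x \<le> K * norm x"
  proof (rule countably_subadditive_seminorm_bounded[of UNIV norm p])
    show "\<exists>w\<in>UNIV. (\<lambda>n. norm ((\<Sum>i<n. u i) - w)) \<longlonglongrightarrow> 0" if "summable (\<lambda>n. norm (u n))"
      for u :: "nat \<Rightarrow> 'a"
    proof -
      have "(\<lambda>n. \<Sum>i<n. u i) \<longlonglongrightarrow> suminf u" using summable_LIMSEQ[OF summable_norm_cancel[OF that]] .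
      then have "(\<lambda>n. (\<Sum>i<n. u i) - suminf u) \<longlonglongrightarrow> 0" by (simp add: LIM_zero)
      then show ?thesis by (auto intro: tendsto_norm_zero)
    qed
    show "p (x + y) \<le> p x + p y" for x y
    proof (rule least)
      fix n
      have "norm (F n (x + y)) \<le> norm (F n x) + norm (F n y)"
        by (simp add: linear_add[OF bounded_linear.linear[OF lin]] norm_triangle_ineq)
      then show "norm (F n (x + y)) \<le> p x + p y" using upper[of n x] upper[of n y] by linarith
    qed
    show "p w \<le> (\<Sum>n. p (u n))"
      if lim: "(\<lambda>n. norm ((\<Sum>i<n. u i) - w)) \<longlonglongrightarrow> 0" and sum: "summable (\<lambda>n. p (u n))"
      for u :: "nat \<Rightarrow> 'a" and w
    proof (rule least)
      fix n
      have "(\<lambda>k. \<Sum>i<k. u i) \<longlonglongrightarrow> w" using LIM_zero_cancel[OF tendsto_norm_zero_cancel[OF lim]] .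
      then have "(\<lambda>k. norm (F n (\<Sum>i<k. u i))) \<longlonglongrightarrow> norm (F n w)"
        by (intro tendsto_norm bounded_linear.tendsto[OF lin])
      moreover have "norm (F n (\<Sum>i<k. u i)) \<le> (\<Sum>n. p (u n))" for k
      proof -
        have "norm (F n (\<Sum>i<k. u i)) \<le> (\<Sum>i<k. norm (F n (u i)))"
          by (simp add: linear_sum[OF bounded_linear.linear[OF lin]] norm_sum)
        also have "\<dots> \<le> (\<Sum>i<k. p (u i))" by (intro sum_mono upper)
        also have "\<dots> \<le> (\<Sum>n. p (u n))" using sum p_nonneg by (intro sum_le_suminf) auto
        finally show ?thesis .
      qed
      ultimately show "norm (F n w) \<le> (\<Sum>n. p (u n))" by (intro LIMSEQ_le_const2) auto
    qed
  qed (use p_nonneg p_scale norm_triangle_ineq in auto)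
  then show ?thesis using that[of K] order_trans[OF upper] by simp
qed

text \<open>If no bound held near 0, there would be times tending to 0 along which the operators are
  unbounded although all orbits converge; uniform boundedness forbids this. The semigroup law
  carries the bound to \<open>{0..T}\<close> in finitely many steps.\<close>

lemma C0_semigroup_locally_bounded:
  fixes S :: "real \<Rightarrow> 'h::complex_hilbert \<Rightarrow> 'h"
  assumes S: "C0_semigroup S"
  obtains K where "0 \<le> K" "\<And>t x. t \<in> {0..T} \<Longrightarrow> norm (S t x) \<le> K * norm x"
proof -
  have lin: "bounded_linear (S t)" if "0 \<le> t" for t
    using S that by (simp add: C0_semigroup_def bounded_clinear_def)
  have S0: "S 0 x = x" and Sadd: "0 \<le> s \<Longrightarrow> 0 \<le> t \<Longrightarrow> S (s + t) x = S s (S t x)"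
    and lim: "((\<lambda>t. S t x) \<longlongrightarrow> x) (at_right 0)" for s t x
    using S by (auto simp: C0_semigroup_def)
  \<comment> \<open>A single \<open>n\<close> determines both the bound and the length of the
    interval, so that the negation directly yields a sequence of times tending to 0.\<close>
  have "\<exists>n::nat. \<forall>t\<in>{0..1 / Suc n}. \<forall>x. norm (S t x) \<le> n * norm x"
  proof (rule ccontr)
    assume none: "\<not> ?thesis"
    have "\<exists>t x. t \<in> {0..1 / Suc n} \<and> n * norm x < norm (S t x)" for n :: nat
    proof -
      have "\<not> (\<forall>t\<in>{0..1 / Suc n}. \<forall>x. norm (S t x) \<le> n * norm x)" using none by blast
      then show ?thesis by (auto simp: not_le)
    qed
    then obtain \<tau> y where \<tau>: "\<And>n::nat. \<tau> n \<in> {0..1 / Suc n}" and y: "\<And>n::nat. n * norm (y n) < norm (S (\<tau> n) (y n))"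
      by metis
    have \<tau>0: "\<tau> \<longlonglongrightarrow> 0"
      by (rule tendsto_sandwich[OF _ _ tendsto_const LIMSEQ_inverse_real_of_nat])
         (use \<tau> in \<open>auto simp: inverse_eq_divide\<close>)
    have "bdd_above (range (\<lambda>n. norm (S (\<tau> n) x)))" for x
    proof -
      have "((\<lambda>t. S t x) \<longlongrightarrow> S 0 x) (at 0 within {0..})"
        using lim[of x] by (simp add: S0 at_within_Ici_at_right)
      then have "continuous (at 0 within {0..}) (\<lambda>t. S t x)" by (simp add: continuous_within)
      then have "(\<lambda>n. S (\<tau> n) x) \<longlonglongrightarrow> S 0 x"
        using \<tau>0 \<tau> by (auto simp: continuous_within_sequentially comp_def)
      then have "bounded (range (\<lambda>n. S (\<tau> n) x))" by (rule convergent_imp_bounded)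
      then show ?thesis by (auto simp: bounded_iff bdd_above_def)
    qed
    moreover have "bounded_linear (S (\<tau> n))" for n using lin \<tau> by simp
    ultimately obtain K where K: "0 \<le> K" "\<And>n x. norm (S (\<tau> n) x) \<le> K * norm x"
      using pointwise_bounded_imp_uniformly_bounded[of "\<lambda>n. S (\<tau> n)"] by metis
    obtain n :: nat where "K \<le> n" using real_arch_simple by blast
    then have "K * norm (y n) \<le> n * norm (y n)" by (intro mult_right_mono) auto
    then show False using K(2)[of n "y n"] y[of n] by linarith
  qed
  then obtain n :: nat where n: "\<And>t x. t \<in> {0..1 / Suc n} \<Longrightarrow> norm (S t x) \<le> n * norm x" by blast
  define \<delta> where "\<delta> = 1 / real (Suc n)"
  have \<delta>: "0 < \<delta>" by (simp add: \<delta>_def)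
  have "\<exists>K\<ge>0. \<forall>t\<in>{0..k * \<delta>}. \<forall>x. norm (S t x) \<le> K * norm x" for k :: nat
  proof (induction k)
    case 0 then show ?case by (intro exI[of _ 1]) (auto simp: S0)
  next
    case (Suc k)
    then obtain K where K: "0 \<le> K" "\<And>t x. t \<in> {0..k * \<delta>} \<Longrightarrow> norm (S t x) \<le> K * norm x" by blast
    \<comment> \<open>The sum \<open>n * K + n\<close> dominates both the bound for a first step and
      the product for a further one.\<close>
    have "norm (S t x) \<le> (n * K + n) * norm x" if t: "t \<in> {0..Suc k * \<delta>}" for t x
    proof (cases "t \<le> \<delta>")
      case True
      then have "norm (S t x) \<le> n * norm x" using n t by (simp add: \<delta>_def)
      moreover have "0 \<le> n * K * norm x" using K by simp
      ultimately show ?thesis by (simp add: distrib_right)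
    next
      case False
      have "norm (S t x) = norm (S \<delta> (S (t - \<delta>) x))" using Sadd[of \<delta> "t - \<delta>" x] False \<delta> by simp
      moreover have "norm (S (t - \<delta>) x) \<le> K * norm x"
        using K(2)[of "t - \<delta>"] t False by (simp add: algebra_simps)
      then have "n * norm (S (t - \<delta>) x) \<le> n * (K * norm x)" by (intro mult_left_mono) auto
      moreover have "norm (S \<delta> (S (t - \<delta>) x)) \<le> n * norm (S (t - \<delta>) x)"
        using \<delta> by (intro n) (simp add: \<delta>_def)
      moreover have "0 \<le> n * norm x" by simp
      ultimately have "norm (S t x) \<le> n * (K * norm x) + n * norm x" by linarith
      then show ?thesis by (simp add: distrib_right mult.assoc)
    qed
    then show ?case using K by (intro exI[of _ "n * K + n"]) auto
  qed
  moreover obtain k :: nat where "T / \<delta> \<le> k" using real_arch_simple by blast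
  then have "T \<le> k * \<delta>" using \<delta> by (simp add: pos_divide_le_eq)
  ultimately show ?thesis using that by (metis atLeastAtMost_iff order_trans)
qed

section \<open>Extension of bounded maps from a dense range\<close>

lemma bounded_linear_scaleC: "bounded_linear (\<lambda>x. c *\<^sub>C (x::'a::complex_normed_vector))"
proof (rule bounded_linear_intro[where K="cmod c"])
  show "c *\<^sub>C (r *\<^sub>R x) = r *\<^sub>R (c *\<^sub>C x)" for r and x :: 'a
    by (metis mult.commute scaleC_of_real scaleC_scaleC)
qed (simp_all add: scaleC_add_right norm_scaleC mult.commute)

lemma bounded_clinear_bounded_linear: "bounded_clinear f \<Longrightarrow> bounded_linear f"
  by (simp add: bounded_clinear_def)

lemma bounded_linear_eq_on_dense:
  assumes "bounded_linear f" "bounded_linear g" "closure (range j) = UNIV" "\<And>x. f (j x) = g (j x)"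
  shows "f = g"
proof
  fix y
  have "closed {y. f y = g y}"
    using assms(1,2) by (intro closed_Collect_eq linear_continuous_on) auto
  then have "closure (range j) \<subseteq> {y. f y = g y}" using assms(4) by (intro closure_minimal) auto
  then show "f y = g y" using assms(3) by auto
qed

text \<open>The estimate against \<open>norm (j x)\<close> makes \<open>f\<close> well defined and
  uniformly continuous as a function of \<open>j x\<close>, so it extends to the closure of the
  range. The constant \<open>K\<close> survives, which keeps bounds on the extended semigroup as
  uniform in time as those on the original one.\<close>

lemma bounded_clinear_extension:
  fixes j :: "'a::complex_normed_vector \<Rightarrow> 'e::complex_normed_vector" and f :: "'a \<Rightarrow> 'd::complex_banach"
  assumes j: "\<And>x y. j (x + y) = j x + j y" "\<And>c x. j (c *\<^sub>C x) = c *\<^sub>C j x"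
      "closure (range j) = UNIV"
    and f: "\<And>x y. f (x + y) = f x + f y" "\<And>c x. f (c *\<^sub>C x) = c *\<^sub>C f x"
    and K: "\<And>x. norm (f x) \<le> K * norm (j x)"
  shows "\<exists>g. bounded_clinear g \<and> (\<forall>x. g (j x) = f x) \<and> (\<forall>y. norm (g y) \<le> K * norm y)"
proof -
  have neg: "j (x - y) = j x - j y" "f (x - y) = f x - f y" for x y
    using j(1)[of "x - y" y] f(1)[of "x - y" y] by (auto simp: algebra_simps)
  have le: "norm (f x - f y) \<le> K * norm (j x - j y)" for x y
    using K[of "x - y"] by (simp add: neg)
  have wd: "f x = f y" if "j x = j y" for x y using le[of x y] that by simp
  define f' where "f' y = f (SOME x. j x = y)" for y
  have f'j: "f' (j x) = f x" for x
    unfolding f'_def by (rule wd) (rule someI[of "\<lambda>z. j z = j x"], simp)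
  have "uniformly_continuous_on (range j) f'"
    unfolding uniformly_continuous_on_def
  proof (intro allI impI)
    fix e :: real assume e: "0 < e"
    \<comment> \<open>The sign of \<open>K\<close> is not known and it may be 0;
      \<open>\<bar>K\<bar> + 1\<close> is a safe divisor.\<close>
    have pos: "0 < \<bar>K\<bar> + 1" by simp
    have "dist (f' b) (f' a) < e" if ab: "a \<in> range j" "b \<in> range j" "dist b a < e / (\<bar>K\<bar> + 1)" for a b
    proof -
      obtain x y where xy: "a = j x" "b = j y" using ab by auto
      have "norm (f y - f x) \<le> K * norm (j y - j x)" by (rule le)
      also have "\<dots> \<le> (\<bar>K\<bar> + 1) * norm (j y - j x)" by (intro mult_right_mono) auto
      also have "\<dots> < e" using ab(3) pos by (simp add: xy dist_norm pos_less_divide_eq mult.commute)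
      finally show ?thesis by (simp add: xy f'j dist_norm)
    qed
    then show "\<exists>d>0. \<forall>a\<in>range j. \<forall>b\<in>range j. dist b a < d \<longrightarrow> dist (f' b) (f' a) < e"
      using e pos by (intro exI[of _ "e / (\<bar>K\<bar> + 1)"]) auto
  qed
  then obtain g where g: "uniformly_continuous_on (closure (range j)) g" "\<And>y. y \<in> range j \<Longrightarrow> f' y = g y"
    by (metis uniformly_continuous_on_extension_on_closure)
  have cont: "continuous_on UNIV g" using uniformly_continuous_imp_continuous[OF g(1)] j(3) by simp
  have gj: "g (j x) = f x" for x using g(2)[of "j x"] f'j by simp
  have tend: "(\<lambda>n. g (a n)) \<longlonglongrightarrow> g y" if "a \<longlonglongrightarrow> y" for a :: "nat \<Rightarrow> 'e" and y
    using continuous_on_tendsto_compose[OF cont that] by simp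
  have seq: "\<exists>a. (\<lambda>n. j (a n)) \<longlonglongrightarrow> y" for y
  proof -
    obtain b where b: "\<And>n. b n \<in> range j" "b \<longlonglongrightarrow> y"
      using j(3) closure_sequential[of y "range j"] by auto
    have "\<forall>n. \<exists>x. b n = j x" using b(1) by blast
    then obtain a where a: "\<And>n. b n = j (a n)" by (metis choice)
    have "(\<lambda>n. j (a n)) = b" by (simp add: fun_eq_iff a)
    then have "(\<lambda>n. j (a n)) \<longlonglongrightarrow> y" using b(2) by simp
    then show ?thesis by blast
  qed
  have add: "g (x + y) = g x + g y" for x y
  proof -
    obtain a b where a: "(\<lambda>n. j (a n)) \<longlonglongrightarrow> x" and b: "(\<lambda>n. j (b n)) \<longlonglongrightarrow> y" using seq by blast
    have "(\<lambda>n. g (j (a n) + j (b n))) \<longlonglongrightarrow> g (x + y)" using a b by (intro tend tendsto_add)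
    moreover have "g (j (a n) + j (b n)) = g (j (a n)) + g (j (b n))" for n
      using gj[of "a n + b n"] by (simp add: j f gj)
    ultimately show ?thesis using tendsto_add[OF tend[OF a] tend[OF b]] LIMSEQ_unique by auto
  qed
  have scale: "g (c *\<^sub>C x) = c *\<^sub>C g x" for c x
  proof -
    obtain a where a: "(\<lambda>n. j (a n)) \<longlonglongrightarrow> x" using seq by blast
    have "(\<lambda>n. g (c *\<^sub>C j (a n))) \<longlonglongrightarrow> g (c *\<^sub>C x)"
      by (rule tend) (rule bounded_linear.tendsto[OF bounded_linear_scaleC a])
    moreover have "g (c *\<^sub>C j (a n)) = c *\<^sub>C g (j (a n))" for n
      using gj[of "c *\<^sub>C a n"] by (simp add: j f gj)
    ultimately show ?thesis
      using bounded_linear.tendsto[OF bounded_linear_scaleC tend[OF a], of c] LIMSEQ_unique by auto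
  qed
  have bound: "norm (g y) \<le> K * norm y" for y
  proof -
    obtain a where a: "(\<lambda>n. j (a n)) \<longlonglongrightarrow> y" using seq by blast
    show ?thesis
    proof (rule LIMSEQ_le)
      show "(\<lambda>n. norm (g (j (a n)))) \<longlonglongrightarrow> norm (g y)" by (intro tendsto_norm tend a)
      show "(\<lambda>n. K * norm (j (a n))) \<longlonglongrightarrow> K * norm y" by (intro tendsto_intros a)
      show "\<exists>N. \<forall>n\<ge>N. norm (g (j (a n))) \<le> K * norm (j (a n))" using K by (simp add: gj)
    qed
  qed
  have "bounded_linear g"
  proof (rule bounded_linear_intro[where K=K])
    show "g (r *\<^sub>R x) = r *\<^sub>R g x" for r x using scale[of "complex_of_real r" x] by (simp add: scaleC_of_real)
    show "norm (g x) \<le> norm x * K" for x using bound[of x] by (simp add: mult.commute)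
  qed (rule add)
  then show ?thesis using scale gj bound by (auto simp: bounded_clinear_def)
qed

section \<open>The semigroup on the extrapolation space\<close>

locale extrapolated_semigroup =
  fixes S :: "real \<Rightarrow> 'h::complex_hilbert \<Rightarrow> 'h" and \<beta> :: complex and \<iota> :: "'h \<Rightarrow> 'e::complex_banach"
  assumes semigroup: "C0_semigroup S" and \<beta>: "\<beta> \<in> resolvent_set S"
    and extrapolation: "extrapolation_space S \<beta> \<iota>"
begin

lemma S_0: "S 0 x = x"
  and S_add: "0 \<le> s \<Longrightarrow> 0 \<le> t \<Longrightarrow> S (s + t) x = S s (S t x)"
  and S_tendsto: "((\<lambda>t. S t x) \<longlongrightarrow> x) (at_right 0)"
  using semigroup by (auto simp: C0_semigroup_def)

lemma S_clinear: "0 \<le> t \<Longrightarrow> bounded_clinear (S t)"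
  using semigroup by (auto simp: C0_semigroup_def)

lemma bounded_linear_S: "0 \<le> t \<Longrightarrow> bounded_linear (S t)"
  using S_clinear bounded_clinear_bounded_linear by blast

lemma generator_tendsto:
  assumes "x \<in> generator_domain S"
  shows "((\<lambda>h. (S h x - x) /\<^sub>R h) \<longlongrightarrow> generator S x) (at_right 0)"
proof -
  obtain y where y: "((\<lambda>h. (S h x - x) /\<^sub>R h) \<longlongrightarrow> y) (at_right 0)"
    using assms by (auto simp: generator_domain_def)
  then have "generator S x = y" unfolding generator_def by (intro tendsto_Lim) auto
  then show ?thesis using y by simp
qed

lemma generator_semigroup:
  assumes x: "x \<in> generator_domain S" and t: "0 \<le> t"
  shows "S t x \<in> generator_domain S" "generator S (S t x) = S t (generator S x)"
proof -
  note lin = bounded_linear.linear[OF bounded_linear_S[OF t]]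
  have "((\<lambda>h. S t ((S h x - x) /\<^sub>R h)) \<longlongrightarrow> S t (generator S x)) (at_right 0)"
    by (rule bounded_linear.tendsto[OF bounded_linear_S[OF t] generator_tendsto[OF x]])
  moreover have "eventually (\<lambda>h. S t ((S h x - x) /\<^sub>R h) = (S h (S t x) - S t x) /\<^sub>R h) (at_right 0)"
    using eventually_at_right_less
  proof eventually_elim
    case (elim h)
    then have "S h (S t x) = S t (S h x)"
      using S_add[of h t x] S_add[of t h x] t by (simp add: add.commute)
    then show ?case by (simp add: linear_scale[OF lin] linear_diff[OF lin])
  qed
  ultimately have lim: "((\<lambda>h. (S h (S t x) - S t x) /\<^sub>R h) \<longlongrightarrow> S t (generator S x)) (at_right 0)"
    by (rule Lim_transform_eventually)
  then show "S t x \<in> generator_domain S" by (auto simp: generator_domain_def)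
  show "generator S (S t x) = S t (generator S x)"
    unfolding generator_def[of S "S t x"] using lim by (intro tendsto_Lim) auto
qed

lemma resolvent_properties:
  shows "resolvent S \<beta> y \<in> generator_domain S"
    "\<beta> *\<^sub>C resolvent S \<beta> y - generator S (resolvent S \<beta> y) = y"
    "x \<in> generator_domain S \<Longrightarrow> resolvent S \<beta> (\<beta> *\<^sub>C x - generator S x) = x"
    "bounded_clinear (resolvent S \<beta>)"
proof -
  have bij: "bij_betw (\<lambda>x. \<beta> *\<^sub>C x - generator S x) (generator_domain S) UNIV"
    using \<beta> by (simp add: resolvent_set_def)
  then have y: "y \<in> (\<lambda>x. \<beta> *\<^sub>C x - generator S x) ` generator_domain S" by (simp add: bij_betw_def)
  show "resolvent S \<beta> y \<in> generator_domain S"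
    unfolding resolvent_def using y by (rule inv_into_into)
  show "\<beta> *\<^sub>C resolvent S \<beta> y - generator S (resolvent S \<beta> y) = y"
    unfolding resolvent_def using f_inv_into_f[OF y] .
  show "x \<in> generator_domain S \<Longrightarrow> resolvent S \<beta> (\<beta> *\<^sub>C x - generator S x) = x"
    unfolding resolvent_def using inv_into_f_f[OF bij_betw_imp_inj_on[OF bij]] by simp
  show "bounded_clinear (resolvent S \<beta>)" using \<beta> by (simp add: resolvent_set_def)
qed

text \<open>The norm of \<open>\<iota> x\<close> is the norm of the resolvent at \<open>x\<close>.
  Commutation therefore turns a bound for \<open>S t\<close> into the same bound in the
  extrapolation norm, which is what lets \<open>S t\<close> extend.\<close>

lemma resolvent_commute:
  assumes t: "0 \<le> t"
  shows "resolvent S \<beta> (S t y) = S t (resolvent S \<beta> y)"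
proof -
  let ?x = "resolvent S \<beta> y"
  note lin = bounded_linear.linear[OF bounded_linear_S[OF t]]
  have "S t y = S t (\<beta> *\<^sub>C ?x - generator S ?x)" using resolvent_properties(2)[of y] by simp
  also have "\<dots> = \<beta> *\<^sub>C S t ?x - generator S (S t ?x)"
    using S_clinear[OF t] generator_semigroup(2)[OF resolvent_properties(1) t, of y]
    by (simp add: linear_diff[OF lin] bounded_clinear_def)
  finally show ?thesis
    using resolvent_properties(3)[OF generator_semigroup(1)[OF resolvent_properties(1) t, of y]] by simp
qed

lemma \<iota>_add: "\<iota> (x + y) = \<iota> x + \<iota> y"
  and \<iota>_scaleC: "\<iota> (c *\<^sub>C x) = c *\<^sub>C \<iota> x"
  and norm_\<iota>: "norm (\<iota> x) = norm (resolvent S \<beta> x)"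
  and dense: "closure (range \<iota>) = UNIV"
  using extrapolation by (auto simp: extrapolation_space_def)

lemma \<iota>_scaleR: "\<iota> (r *\<^sub>R x) = r *\<^sub>R \<iota> x"
  using \<iota>_scaleC[of "complex_of_real r" x] by (simp add: scaleC_of_real)

lemma bounded_linear_\<iota>: "bounded_linear \<iota>"
proof -
  have "bounded_linear (resolvent S \<beta>)"
    using resolvent_properties(4) by (rule bounded_clinear_bounded_linear)
  then obtain K where "\<And>x. norm (resolvent S \<beta> x) \<le> norm x * K"
    using bounded_linear.bounded by blast
  then show ?thesis
    by (intro bounded_linear_intro[where K=K]) (simp_all add: \<iota>_add \<iota>_scaleR norm_\<iota>)
qed

text \<open>Injectivity makes the preimage taken in \<open>input_map\<close> unique, whence its
  linearity. It holds since the norm of \<open>\<iota> x\<close> is that of the resolvent, which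
  vanishes only at 0.\<close>

lemma inj_\<iota>: "inj \<iota>"
proof (rule injI)
  fix x y assume "\<iota> x = \<iota> y"
  then have "\<iota> (x - y) = 0" by (simp add: linear_diff[OF bounded_linear.linear[OF bounded_linear_\<iota>]])
  then have "resolvent S \<beta> (x - y) = 0" using norm_\<iota>[of "x - y"] by simp
  moreover have "resolvent S \<beta> 0 = 0"
    using linear_0[OF bounded_linear.linear[OF bounded_clinear_bounded_linear[OF resolvent_properties(4)]]] .
  ultimately show "x = y" using resolvent_properties(2)[of "x - y"] resolvent_properties(2)[of 0] by simp
qed

definition E :: "real \<Rightarrow> 'e \<Rightarrow> 'e" where "E = extended_semigroup \<iota> S"

text \<open>Density of the range makes the extension unique, so the definite description in
  \<open>extended_semigroup\<close> picks the map built by continuity.\<close>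

lemma E_properties:
  assumes t: "0 \<le> t" and K: "\<And>x. norm (S t x) \<le> K * norm x"
  shows "bounded_clinear (E t)" "E t (\<iota> x) = \<iota> (S t x)" "norm (E t y) \<le> K * norm y"
proof -
  note lin = bounded_linear.linear[OF bounded_linear_S[OF t]]
  have "norm (\<iota> (S t x)) \<le> K * norm (\<iota> x)" for x
    using K[of "resolvent S \<beta> x"] by (simp add: norm_\<iota> resolvent_commute[OF t])
  then obtain g where g: "bounded_clinear g" "\<And>x. g (\<iota> x) = \<iota> (S t x)" "\<And>y. norm (g y) \<le> K * norm y"
    using bounded_clinear_extension[of \<iota> "\<lambda>x. \<iota> (S t x)" K] S_clinear[OF t]
    by (auto simp: \<iota>_add \<iota>_scaleC dense linear_add[OF lin] bounded_clinear_def)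
  have "E t = g"
    unfolding E_def extended_semigroup_def
  proof (rule the_equality)
    fix f assume "bounded_clinear f \<and> (\<forall>x. f (\<iota> x) = \<iota> (S t x))"
    then show "f = g"
      using g bounded_linear_eq_on_dense[OF _ _ dense] by (metis bounded_clinear_bounded_linear)
  qed (use g in auto)
  then show "bounded_clinear (E t)" "E t (\<iota> x) = \<iota> (S t x)" "norm (E t y) \<le> K * norm y"
    using g by auto
qed

lemma E_\<iota>: "0 \<le> t \<Longrightarrow> E t (\<iota> x) = \<iota> (S t x)"
  and bounded_linear_E: "0 \<le> t \<Longrightarrow> bounded_linear (E t)"
proof -
  assume t: "0 \<le> t"
  obtain K where "\<And>x. norm (S t x) \<le> K * norm x"
    using C0_semigroup_locally_bounded[OF semigroup, of t] t by (metis atLeastAtMost_iff order_refl)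
  from E_properties[OF t this] show "E t (\<iota> x) = \<iota> (S t x)" "bounded_linear (E t)"
    by (auto simp: bounded_clinear_def)
qed

lemma E_locally_bounded:
  obtains K where "0 \<le> K" "\<And>t y. t \<in> {0..T} \<Longrightarrow> norm (E t y) \<le> K * norm y"
proof -
  obtain K where K: "0 \<le> K" "\<And>t x. t \<in> {0..T} \<Longrightarrow> norm (S t x) \<le> K * norm x"
    using C0_semigroup_locally_bounded[OF semigroup, of T] by metis
  show ?thesis
  proof (rule that[OF K(1)])
    fix t y assume "t \<in> {0..T}"
    then show "norm (E t y) \<le> K * norm y" using E_properties(3)[of t K y] K(2) by auto
  qed
qed

lemma E_add:
  assumes "0 \<le> s" "0 \<le> t"
  shows "E (s + t) y = E s (E t y)"
proof -
  have "E (s + t) = (\<lambda>y. E s (E t y))"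
    using assms S_add
    by (intro bounded_linear_eq_on_dense[OF _ _ dense] bounded_linear_compose[OF bounded_linear_E bounded_linear_E]
        bounded_linear_E) (auto simp: E_\<iota>)
  then show ?thesis by (rule fun_cong)
qed

text \<open>Strong continuity is assumed at 0 from the right only. For \<open>s \<le> t\<close> one
  factors out \<open>S s\<close>, which reduces the increment to \<open>S (t - s) x - x\<close> up
  to the uniform bound; this covers continuity from the left as well.\<close>

lemma S_continuous_on: "continuous_on {0..T} (\<lambda>t. S t x)"
proof -
  obtain K where K: "0 \<le> K" "\<And>t x. t \<in> {0..T} \<Longrightarrow> norm (S t x) \<le> K * norm x"
    using C0_semigroup_locally_bounded[OF semigroup, of T] by metis
  have diff: "norm (S t x - S s x) \<le> K * norm (S \<bar>t - s\<bar> x - x)" if "s \<in> {0..T}" "t \<in> {0..T}" for s t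
    using that
  proof (induction s t rule: linorder_wlog)
    case (le s t)
    have "S t x - S s x = S s (S (t - s) x - x)"
      using S_add[of s "t - s" x] le linear_diff[OF bounded_linear.linear[OF bounded_linear_S]] by simp
    then show ?case using K(2)[of s "S (t - s) x - x"] le by simp
  next
    case (sym s t) then show ?case by (simp add: norm_minus_commute abs_minus_commute)
  qed
  show ?thesis
    unfolding continuous_on_iff
  proof (intro ballI allI impI)
    fix s e :: real assume s: "s \<in> {0..T}" and e: "0 < e"
    have "0 < e / (K + 1)" using e K(1) by simp
    then have "eventually (\<lambda>t. dist (S t x) x < e / (K + 1)) (at_right 0)"
      using S_tendsto by (rule tendstoD[rotated])
    then obtain d where d: "0 < d" "\<And>t. 0 < t \<Longrightarrow> t < d \<Longrightarrow> dist (S t x) x < e / (K + 1)"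
      by (auto simp: eventually_at_right_field)
    have "dist (S t x) (S s x) < e" if t: "t \<in> {0..T}" "dist t s < d" for t
    proof -
      have "norm (S \<bar>t - s\<bar> x - x) < e / (K + 1)"
        using d t \<open>0 < e / (K + 1)\<close> by (cases "t = s") (auto simp: dist_norm S_0)
      then have "K * norm (S \<bar>t - s\<bar> x - x) \<le> K * (e / (K + 1))" using K(1) by (intro mult_left_mono) auto
      also have "\<dots> < e" using K(1) e by (simp add: field_simps)
      finally show ?thesis using diff[OF s t(1)] by (simp add: dist_norm)
    qed
    then show "\<exists>d>0. \<forall>t\<in>{0..T}. dist t s < d \<longrightarrow> dist (S t x) (S s x) < e" using d by blast
  qed
qed

text \<open>Measurability of the integrand of the input map rests on this. The orbits of points
  \<open>\<iota> x\<close> are continuous, these points are dense, and the uniform bound on the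
  operators extends continuity to all points.\<close>

lemma E_jointly_continuous: "continuous_on ({0..T} \<times> UNIV) (case_prod E)"
proof -
  obtain K where K: "0 \<le> K" "\<And>t y. t \<in> {0..T} \<Longrightarrow> norm (E t y) \<le> K * norm y"
    using E_locally_bounded by metis
  have E_cont: "continuous_on {0..T} (\<lambda>t. E t (\<iota> x))" for x
  proof -
    have "continuous_on {0..T} (\<lambda>t. \<iota> (S t x))"
      by (rule continuous_on_compose2[OF linear_continuous_on[OF bounded_linear_\<iota>] S_continuous_on]) auto
    then show ?thesis by (rule continuous_on_eq) (auto simp: E_\<iota>)
  qed
  show ?thesis
    unfolding continuous_on_iff
  proof (intro ballI allI impI)
    fix p :: "real \<times> 'e" and e :: real assume p: "p \<in> {0..T} \<times> UNIV" and e: "0 < e"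
    obtain s z where sz: "p = (s, z)" "s \<in> {0..T}" using p by auto
    \<comment> \<open>Three of the four terms below are at most \<open>K * \<epsilon>\<close>, and
      this choice makes each of them less than \<open>e / 4\<close>.\<close>
    define \<epsilon> where "\<epsilon> = e / (4 * (K + 1))"
    have \<epsilon>: "0 < \<epsilon>" "K * \<epsilon> < e / 4" using e K(1) by (auto simp: \<epsilon>_def field_simps)
    obtain x where x: "dist (\<iota> x) z < \<epsilon>"
      using closure_approachable[of z "range \<iota>"] dense \<epsilon>(1) by auto
    obtain d where d: "0 < d" "\<And>t. t \<in> {0..T} \<Longrightarrow> dist t s < d \<Longrightarrow> dist (E t (\<iota> x)) (E s (\<iota> x)) < e / 4"
      using E_cont[of x] sz(2) e unfolding continuous_on_iff by (metis zero_less_divide_iff zero_less_numeral)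
    have "dist (E t y) (E s z) < e" if t: "t \<in> {0..T}" "dist t s < d" "dist y z < \<epsilon>" for t y
    proof -
      have E_diff: "norm (E r a - E r b) \<le> K * norm (a - b)" if "r \<in> {0..T}" for r a b
        using K(2)[OF that, of "a - b"] that linear_diff[OF bounded_linear.linear[OF bounded_linear_E]] by simp
      have "norm (E t y - E t z) \<le> K * \<epsilon>"
      proof -
        have "K * norm (y - z) \<le> K * \<epsilon>"
          using t(3) K(1) by (intro mult_left_mono) (auto simp: dist_norm)
        then show ?thesis using E_diff[OF t(1), of y z] by linarith
      qed
      moreover have "norm (E t z - E t (\<iota> x)) \<le> K * \<epsilon>"
      proof -
        have "K * norm (z - \<iota> x) \<le> K * \<epsilon>"
          using x K(1) by (intro mult_left_mono) (auto simp: dist_norm norm_minus_commute)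
        then show ?thesis using E_diff[OF t(1), of z "\<iota> x"] by linarith
      qed
      moreover have "norm (E s (\<iota> x) - E s z) \<le> K * \<epsilon>"
      proof -
        have "K * norm (\<iota> x - z) \<le> K * \<epsilon>"
          using x K(1) by (intro mult_left_mono) (auto simp: dist_norm)
        then show ?thesis using E_diff[OF sz(2), of "\<iota> x" z] by linarith
      qed
      moreover have "norm (E t (\<iota> x) - E s (\<iota> x)) < e / 4" using d(2) t by (simp add: dist_norm)
      moreover have "norm (E t y - E s z) \<le> norm (E t y - E t z) + norm (E t z - E t (\<iota> x)) +
          norm (E t (\<iota> x) - E s (\<iota> x)) + norm (E s (\<iota> x) - E s z)"
        using norm_triangle_ineq[of "E t y - E t z" "E t z - E t (\<iota> x)"]
          norm_triangle_ineq[of "E t y - E t (\<iota> x)" "E t (\<iota> x) - E s (\<iota> x)"]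
          norm_triangle_ineq[of "E t y - E s (\<iota> x)" "E s (\<iota> x) - E s z"] by simp
      ultimately show ?thesis using \<epsilon>(2) unfolding dist_norm by linarith
    qed
    moreover have "dist t s \<le> dist (t, y) (s, z)" "dist y z \<le> dist (t, y) (s, z)" for t y
      using dist_fst_le[of "(t, y)" "(s, z)"] dist_snd_le[of "(t, y)" "(s, z)"] by auto
    ultimately have "dist (E t y) (E s z) < e" if "t \<in> {0..T}" "dist (t, y) (s, z) < min d \<epsilon>" for t y
      using that by (meson min_less_iff_conj order.strict_trans1)
    then have "\<forall>q\<in>{0..T} \<times> UNIV. dist q p < min d \<epsilon> \<longrightarrow> dist (case_prod E q) (case_prod E p) < e"
      unfolding sz by auto
    then show "\<exists>d>0. \<forall>q\<in>{0..T} \<times> UNIV. dist q p < d \<longrightarrow> dist (case_prod E q) (case_prod E p) < e"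
      using d(1) \<epsilon>(1) by (intro exI[of _ "min d \<epsilon>"]) simp
  qed
qed

end

section \<open>Boundedness of the input maps\<close>

interpretation Leb: complete_finite_measure "Leb t" for t
  by (rule complete_finite_measure_lebesgue_on)

locale control_system = extrapolated_semigroup S \<beta> \<iota>
  for S :: "real \<Rightarrow> 'h::complex_hilbert \<Rightarrow> 'h" and \<beta> :: complex and \<iota> :: "'h \<Rightarrow> 'e::complex_banach" +
  fixes B :: "'u::complex_hilbert \<Rightarrow> 'e"
  assumes admissible: "admissible_control_operator \<iota> S B"
begin

abbreviation I :: "real \<Rightarrow> (real \<Rightarrow> 'u) \<Rightarrow> 'e" where "I \<equiv> input_integral \<iota> S B"

abbreviation F :: "real \<Rightarrow> (real \<Rightarrow> 'u) \<Rightarrow> 'h" where "F \<equiv> input_map \<iota> S B"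

lemma bounded_linear_B: "bounded_linear B"
  using admissible by (simp add: admissible_control_operator_def bounded_clinear_def)

lemma I_def: "I t u = Bochner_integral (Leb t) (\<lambda>\<sigma>. E (t - \<sigma>) (B (u \<sigma>)))"
  by (simp add: input_integral_def E_def)

text \<open>In the large space the input integral is harmless: \<open>E\<close> is uniformly bounded
  on the interval, \<open>B\<close> is bounded, and the L^1 norm is at most the L^2 norm times the
  square root of the total measure. The bound in \<open>'h\<close> is the hard one and comes
  later.\<close>

lemma integrand:
  assumes u: "u \<in> L2 (Leb t)"
  shows "strongly_measurable (Leb t) (\<lambda>\<sigma>. E (t - \<sigma>) (B (u \<sigma>)))"
    "integrable (Leb t) (\<lambda>\<sigma>. norm (E (t - \<sigma>) (B (u \<sigma>))))"
    "\<exists>C\<ge>0. \<forall>v\<in>L2 (Leb t). norm (I t v) \<le> C * L2_norm (Leb t) v"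
proof -
  have cont: "continuous_on ({0..t} \<times> UNIV) (\<lambda>(\<sigma>, y). E (t - \<sigma>) (B y))"
  proof -
    have "continuous_on ({0..t} \<times> UNIV) (\<lambda>p. case_prod E (t - fst p, B (snd p)))"
      by (rule continuous_on_compose2[OF E_jointly_continuous[of t]])
         (auto intro!: continuous_intros bounded_linear.continuous_on[OF bounded_linear_B])
    then show ?thesis by (simp add: case_prod_beta')
  qed
  have sm: "strongly_measurable (Leb t) (\<lambda>\<sigma>. E (t - \<sigma>) (B (v \<sigma>)))" if "v \<in> L2 (Leb t)" for v
    using Leb.L2_D(1)[OF that] cont by (rule strongly_measurable_Caratheodory)
  obtain K where K: "0 \<le> K" "\<And>s y. s \<in> {0..t} \<Longrightarrow> norm (E s y) \<le> K * norm y"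
    using E_locally_bounded by metis
  obtain b where b: "0 \<le> b" "\<And>y. norm (B y) \<le> norm y * b"
    using bounded_linear.nonneg_bounded[OF bounded_linear_B] by blast
  have le: "norm (E (t - \<sigma>) (B (v \<sigma>))) \<le> K * b * norm (v \<sigma>)" if "\<sigma> \<in> {0<..<t}" for \<sigma> v
  proof -
    have "norm (E (t - \<sigma>) (B (v \<sigma>))) \<le> K * norm (B (v \<sigma>))" using that by (intro K) auto
    also have "\<dots> \<le> K * (norm (v \<sigma>) * b)" using b(2) K(1) by (rule mult_left_mono)
    finally show ?thesis by (simp add: mult_ac)
  qed
  have int: "integrable (Leb t) (\<lambda>\<sigma>. norm (E (t - \<sigma>) (B (v \<sigma>))))" if "v \<in> L2 (Leb t)" for v
  proof (rule Bochner_Integration.integrable_bound)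
    show "integrable (Leb t) (\<lambda>\<sigma>. K * b * norm (v \<sigma>))" using Leb.L2_D(3)[OF that] by simp
    show "(\<lambda>\<sigma>. norm (E (t - \<sigma>) (B (v \<sigma>)))) \<in> borel_measurable (Leb t)"
      using sm[OF that] by (rule Leb.borel_measurable_norm_strongly)
    show "AE \<sigma> in Leb t. norm (norm (E (t - \<sigma>) (B (v \<sigma>)))) \<le> norm (K * b * norm (v \<sigma>))"
      using le K(1) b(1) by (intro AE_I2) (simp add: abs_mult)
  qed
  show "strongly_measurable (Leb t) (\<lambda>\<sigma>. E (t - \<sigma>) (B (u \<sigma>)))"
    "integrable (Leb t) (\<lambda>\<sigma>. norm (E (t - \<sigma>) (B (u \<sigma>))))"
    using sm int u by auto
  have "norm (I t v) \<le> K * b * sqrt (measure (Leb t) (space (Leb t))) * L2_norm (Leb t) v"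
    if v: "v \<in> L2 (Leb t)" for v
  proof -
    have "norm (I t v) \<le> (\<integral>\<sigma>. norm (E (t - \<sigma>) (B (v \<sigma>))) \<partial>Leb t)"
      unfolding I_def using sm[OF v] int[OF v] by (rule Leb.norm_Bochner_integral_le)
    also have "\<dots> \<le> (\<integral>\<sigma>. K * b * norm (v \<sigma>) \<partial>Leb t)"
      using int[OF v] Leb.L2_D(3)[OF v] le by (intro integral_mono) auto
    also have "\<dots> = K * b * (\<integral>\<sigma>. norm (v \<sigma>) \<partial>Leb t)" by simp
    also have "\<dots> \<le> K * b * (sqrt (measure (Leb t) (space (Leb t))) * L2_norm (Leb t) v)"
      using Leb.L1_le_L2[OF v] K(1) b(1) by (intro mult_left_mono) auto
    finally show ?thesis by (simp add: mult_ac)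
  qed
  then show "\<exists>C\<ge>0. \<forall>v\<in>L2 (Leb t). norm (I t v) \<le> C * L2_norm (Leb t) v"
    using K(1) b(1) by (intro exI[of _ "K * b * sqrt (measure (Leb t) (space (Leb t)))"]) auto
qed

text \<open>\<open>\<sigma>\<close> is kept inside the interval because nothing is known of
  \<open>E\<close> at negative times.\<close>

lemma E_diff_linear:
  assumes "\<sigma> \<in> {0<..<t}"
  shows "E (t - \<sigma>) (B (a + b)) = E (t - \<sigma>) (B a) + E (t - \<sigma>) (B b)"
    "E (t - \<sigma>) (B (c *\<^sub>R a)) = c *\<^sub>R E (t - \<sigma>) (B a)"
proof -
  have "0 \<le> t - \<sigma>" using assms by simp
  note lE = bounded_linear.linear[OF bounded_linear_E[OF this]]
  note lB = bounded_linear.linear[OF bounded_linear_B]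
  show "E (t - \<sigma>) (B (a + b)) = E (t - \<sigma>) (B a) + E (t - \<sigma>) (B b)"
    "E (t - \<sigma>) (B (c *\<^sub>R a)) = c *\<^sub>R E (t - \<sigma>) (B a)"
    by (simp_all add: linear_add[OF lE] linear_add[OF lB] linear_scale[OF lE] linear_scale[OF lB])
qed

lemma I_cong:
  assumes "u \<in> L2 (Leb t)" "\<And>\<sigma>. \<sigma> \<in> {0<..<t} \<Longrightarrow> u \<sigma> = v \<sigma>"
  shows "I t u = I t v"
proof -
  show ?thesis
    unfolding I_def using assms(2)
    by (intro Leb.Bochner_integral_cong_AE integrand assms(1) AE_I2) auto
qed

lemma I_add:
  assumes u: "u \<in> L2 (Leb t)" and v: "v \<in> L2 (Leb t)"
  shows "I t (\<lambda>\<sigma>. u \<sigma> + v \<sigma>) = I t u + I t v"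
proof -
  have "I t (\<lambda>\<sigma>. u \<sigma> + v \<sigma>) = Bochner_integral (Leb t) (\<lambda>\<sigma>. E (t - \<sigma>) (B (u \<sigma>)) + E (t - \<sigma>) (B (v \<sigma>)))"
    unfolding I_def
    by (intro Leb.Bochner_integral_cong_AE integrand Leb.L2_add u v AE_I2) (simp add: E_diff_linear)
  also have "\<dots> = I t u + I t v"
    unfolding I_def by (intro Leb.Bochner_integral_add integrand u v)
  finally show ?thesis .
qed

lemma I_scaleR:
  assumes u: "u \<in> L2 (Leb t)"
  shows "I t (\<lambda>\<sigma>. c *\<^sub>R u \<sigma>) = c *\<^sub>R I t u"
proof -
  have "I t (\<lambda>\<sigma>. c *\<^sub>R u \<sigma>) = Bochner_integral (Leb t) (\<lambda>\<sigma>. c *\<^sub>R E (t - \<sigma>) (B (u \<sigma>)))"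
    unfolding I_def
    by (intro Leb.Bochner_integral_cong_AE integrand L2_scaleR u AE_I2) (simp add: E_diff_linear)
  also have "\<dots> = c *\<^sub>R I t u"
    unfolding I_def by (rule Leb.Bochner_integral_bounded_linear[OF integrand(1,2)[OF u] bounded_linear_scaleR_right])
  finally show ?thesis .
qed

lemma L2_restrict:
  fixes u :: "real \<Rightarrow> 'b::real_normed_vector"
  assumes "s \<le> r" "u \<in> L2 (Leb r)"
  shows "u \<in> L2 (Leb s)" "L2_norm (Leb s) u \<le> L2_norm (Leb r) u"
proof -
  have "emeasure (Leb s) ((\<lambda>t. t) -` A \<inter> space (Leb s)) \<le> emeasure (Leb r) A" if A: "A \<in> sets (Leb r)" for A
  proof -
    have A': "A \<in> sets lebesgue" "A \<subseteq> {0<..<r}" using A by (auto simp: sets_restrict_space_iff)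
    then have "emeasure (Leb r) A = emeasure lebesgue A" by (intro emeasure_restrict_space) auto
    moreover have "emeasure lebesgue (A \<inter> {0<..<s}) \<le> emeasure lebesgue A"
      using A' by (intro emeasure_mono) auto
    ultimately show ?thesis using interval_inclusion(2)[OF assms(1) A] by simp
  qed
  from L2_pullback[OF interval_inclusion(1)[OF assms(1)] this assms(2)]
  show "u \<in> L2 (Leb s)" "L2_norm (Leb s) u \<le> L2_norm (Leb r) u" by auto
qed

lemma L2_left_shift:
  assumes s: "0 \<le> s" and t: "0 \<le> t" and u: "u \<in> L2 (Leb (s + t))"
  shows "(\<lambda>\<sigma>. u (s + \<sigma>)) \<in> L2 (Leb t)"
  using emeasure_interval_split[OF s t]
  by (intro L2_pullback(1)[OF interval_translation(1)[OF s] _ u]) simp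

text \<open>Translation onto \<open>{s<..<s + t}\<close> followed by extension by 0; neither step
  increases the norm.\<close>

lemma L2_right_shift:
  fixes v :: "real \<Rightarrow> 'u"
  assumes s: "0 \<le> s" and v: "v \<in> L2 (Leb t)"
  obtains u where "u \<in> L2 (Leb (s + t))" "\<And>\<sigma>. \<sigma> \<in> {0<..<s} \<Longrightarrow> u \<sigma> = 0"
    "\<And>\<sigma>. \<sigma> \<in> {0<..<t} \<Longrightarrow> u (s + \<sigma>) = v \<sigma>" "L2_norm (Leb (s + t)) u \<le> L2_norm (Leb t) v"
proof -
  let ?N = "lebesgue_on {s<..<s + t}"
  have h: "(\<lambda>r. - s + r) \<in> ?N \<rightarrow>\<^sub>M Leb t"
    by (intro measurable_restrict_space3 translation_measurable_lebesgue) auto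
  have le: "emeasure ?N ((\<lambda>r. - s + r) -` A \<inter> space ?N) \<le> emeasure (Leb t) A" if A: "A \<in> sets (Leb t)" for A
  proof -
    have A': "A \<in> sets lebesgue" "A \<subseteq> {0<..<t}" using A by (auto simp: sets_restrict_space_iff)
    have eq: "(\<lambda>r. - s + r) -` A \<inter> space ?N = (\<lambda>r. - s + r) -` A" using A'(2) by force
    have "emeasure ?N ((\<lambda>r. - s + r) -` A) = emeasure lebesgue ((\<lambda>r. - s + r) -` A)"
      using A'(2) by (intro emeasure_restrict_space) force+
    also have "\<dots> = emeasure lebesgue A" by (rule emeasure_lebesgue_translation)
    also have "\<dots> = emeasure (Leb t) A" using A' by (intro emeasure_restrict_space[symmetric]) auto
    finally show ?thesis unfolding eq by (rule eq_refl)
  qed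
  define w where "w r = v (- s + r)" for r
  have w: "w \<in> L2 ?N" "L2_norm ?N w \<le> L2_norm (Leb t) v"
    unfolding w_def[abs_def] using L2_pullback[OF h le v] by auto
  have sub: "{s<..<s + t} \<subseteq> {0<..<s + t}" using s by auto
  show ?thesis
  proof (rule that)
    show "(\<lambda>r. if r \<in> {s<..<s + t} then w r else 0) \<in> L2 (Leb (s + t))"
      by (rule L2_zero_extension(1)[OF sub _ _ w(1)]) auto
    have "L2_norm (Leb (s + t)) (\<lambda>r. if r \<in> {s<..<s + t} then w r else 0) = L2_norm ?N w"
      by (rule L2_zero_extension(2)[OF sub _ _ w(1)]) auto
    then show "L2_norm (Leb (s + t)) (\<lambda>r. if r \<in> {s<..<s + t} then w r else 0) \<le> L2_norm (Leb t) v"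
      using w(2) by simp
  qed (auto simp: w_def)
qed

text \<open>Input before time \<open>s\<close> is first transported to \<open>s\<close> and then
  carried on by \<open>E t\<close>, which commutes with the integral because it is bounded and
  linear; for later input the clock restarts at \<open>s\<close>.\<close>

lemma I_composition:
  assumes s: "0 \<le> s" and t: "0 \<le> t" and u: "u \<in> L2 (Leb (s + t))"
  shows "I (s + t) u = E t (I s u) + I t (\<lambda>\<sigma>. u (s + \<sigma>))"
proof -
  have us: "u \<in> L2 (Leb s)" using L2_restrict(1)[of s "s + t"] t u by simp
  have "I (s + t) u = Bochner_integral (Leb s) (\<lambda>\<sigma>. E (s + t - \<sigma>) (B (u \<sigma>))) +
      Bochner_integral (Leb t) (\<lambda>\<sigma>. E (s + t - (s + \<sigma>)) (B (u (s + \<sigma>))))"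
    unfolding I_def
    by (rule Bochner_integral_split[OF complete_finite_measure_lebesgue_on complete_finite_measure_lebesgue_on
          complete_finite_measure_lebesgue_on interval_inclusion(1) interval_translation(1)[OF s]
          emeasure_interval_split[OF s t] integrand(1,2)[OF u]]) (use t in auto)
  also have "Bochner_integral (Leb s) (\<lambda>\<sigma>. E (s + t - \<sigma>) (B (u \<sigma>))) =
      Bochner_integral (Leb s) (\<lambda>\<sigma>. E t (E (s - \<sigma>) (B (u \<sigma>))))"
  proof -
    have eq: "E t (E (s - \<sigma>) (B (u \<sigma>))) = E (s + t - \<sigma>) (B (u \<sigma>))" if "\<sigma> \<in> {0<..<s}" for \<sigma>
      using E_add[of t "s - \<sigma>"] that t by (simp add: algebra_simps)
    have "strongly_measurable (Leb s) (\<lambda>\<sigma>. E t (E (s - \<sigma>) (B (u \<sigma>))))"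
      by (rule strongly_measurable_bounded_linear[OF bounded_linear_E[OF t] integrand(1)[OF us]])
    moreover have "integrable (Leb s) (\<lambda>\<sigma>. norm (E t (E (s - \<sigma>) (B (u \<sigma>)))))"
    proof -
      obtain K where K: "0 \<le> K" "\<And>y. norm (E t y) \<le> norm y * K"
        using bounded_linear.nonneg_bounded[OF bounded_linear_E[OF t]] by blast
      show ?thesis
      proof (rule Bochner_Integration.integrable_bound)
        show "integrable (Leb s) (\<lambda>\<sigma>. norm (E (s - \<sigma>) (B (u \<sigma>))) * K)" using integrand(2)[OF us] by simp
        show "(\<lambda>\<sigma>. norm (E t (E (s - \<sigma>) (B (u \<sigma>))))) \<in> borel_measurable (Leb s)"
          by (rule Leb.borel_measurable_norm_strongly[OF
                strongly_measurable_bounded_linear[OF bounded_linear_E[OF t] integrand(1)[OF us]]])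
        show "AE \<sigma> in Leb s. norm (norm (E t (E (s - \<sigma>) (B (u \<sigma>))))) \<le> norm (norm (E (s - \<sigma>) (B (u \<sigma>))) * K)"
          using K by (simp add: abs_mult)
      qed
    qed
    ultimately show ?thesis
      using eq by (intro Leb.Bochner_integral_cong_AE[symmetric] AE_I2) auto
  qed
  also have "\<dots> = E t (I s u)"
    unfolding I_def by (rule Leb.Bochner_integral_bounded_linear[OF integrand(1,2)[OF us] bounded_linear_E[OF t]])
  finally show ?thesis by (simp add: I_def)
qed

lemma I_right_shift:
  assumes s: "0 \<le> s" and t: "0 \<le> t" and v: "v \<in> L2 (Leb t)"
  obtains u where "u \<in> L2 (Leb (s + t))" "I (s + t) u = I t v" "L2_norm (Leb (s + t)) u \<le> L2_norm (Leb t) v"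
proof -
  obtain u where u: "u \<in> L2 (Leb (s + t))" "\<And>\<sigma>. \<sigma> \<in> {0<..<s} \<Longrightarrow> u \<sigma> = 0"
    "\<And>\<sigma>. \<sigma> \<in> {0<..<t} \<Longrightarrow> u (s + \<sigma>) = v \<sigma>" "L2_norm (Leb (s + t)) u \<le> L2_norm (Leb t) v"
    using L2_right_shift[OF s v] by metis
  have us: "u \<in> L2 (Leb s)" using L2_restrict(1)[of s "s + t"] t u(1) by simp
  obtain C where "norm (I s u) \<le> C * L2_norm (Leb s) u" using integrand(3)[OF us] us by blast
  \<comment> \<open>The delayed control vanishes before \<open>s\<close>, so the L^2 bound on
    \<open>I s\<close> removes the first term of the composition formula.\<close>
  moreover have "(\<integral>\<sigma>. (norm (u \<sigma>))\<^sup>2 \<partial>Leb s) = (\<integral>\<sigma>. 0 \<partial>Leb s)"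
    using u(2) by (intro Bochner_Integration.integral_cong) auto
  then have "L2_norm (Leb s) u = 0" by (simp add: L2_norm_def)
  ultimately have "I s u = 0" by simp
  moreover have "I t (\<lambda>\<sigma>. u (s + \<sigma>)) = I t v"
    by (rule I_cong[OF L2_left_shift[OF s t u(1)] u(3)])
  ultimately have "I (s + t) u = I t v"
    using I_composition[OF s t u(1)] linear_0[OF bounded_linear.linear[OF bounded_linear_E[OF t]]] by simp
  then show ?thesis using that u by blast
qed

text \<open>Composition extends the hypothesis from \<open>\<tau>\<close> to its multiples, as
  \<open>E \<tau>\<close> maps the range into itself. A general \<open>t\<close> lies below some
  multiple, and delaying the control realises \<open>I t v\<close> as a value at that
  multiple.\<close>

lemma I_in_range:
  assumes t: "0 \<le> t" and v: "v \<in> L2 (Leb t)"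
  shows "I t v \<in> range \<iota>"
proof -
  obtain \<tau> where \<tau>: "0 < \<tau>" "\<And>u. u \<in> L2 (lebesgue_on {0<..}) \<Longrightarrow> I \<tau> u \<in> range \<iota>"
    using admissible by (auto simp: admissible_control_operator_def)
  have range_\<tau>: "I \<tau> u \<in> range \<iota>" if u: "u \<in> L2 (Leb \<tau>)" for u
  proof -
    \<comment> \<open>Admissibility speaks of controls on the half-line, but \<open>I \<tau>\<close>
      sees only their values before \<open>\<tau>\<close>.\<close>
    have "(\<lambda>\<sigma>. if \<sigma> \<in> {0<..<\<tau>} then u \<sigma> else 0) \<in> L2 (lebesgue_on {0<..})"
      by (rule L2_zero_extension(1)[OF _ _ _ u]) auto
    then have "I \<tau> (\<lambda>\<sigma>. if \<sigma> \<in> {0<..<\<tau>} then u \<sigma> else 0) \<in> range \<iota>" by (rule \<tau>(2))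
    moreover have "I \<tau> u = I \<tau> (\<lambda>\<sigma>. if \<sigma> \<in> {0<..<\<tau>} then u \<sigma> else 0)"
      by (rule I_cong[OF u]) simp
    ultimately show ?thesis by simp
  qed
  \<comment> \<open>The multiples are written \<open>n * \<tau> + \<tau>\<close>, so that
    \<open>n = 0\<close> is admissibility itself.\<close>
  have range_n: "I (real n * \<tau> + \<tau>) u \<in> range \<iota>" if "u \<in> L2 (Leb (real n * \<tau> + \<tau>))" for n u
    using that
  proof (induction n arbitrary: u)
    case 0 then show ?case using range_\<tau> by simp
  next
    case (Suc n)
    let ?s = "real n * \<tau> + \<tau>"
    have s: "0 \<le> ?s" using \<tau>(1) by simp
    have u: "u \<in> L2 (Leb (?s + \<tau>))" using Suc.prems by (simp add: distrib_right add_ac)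
    have "u \<in> L2 (Leb ?s)" using L2_restrict(1)[of ?s "?s + \<tau>"] \<tau>(1) u by simp
    then obtain x where x: "I ?s u = \<iota> x" using Suc.IH by blast
    obtain y where y: "I \<tau> (\<lambda>\<sigma>. u (?s + \<sigma>)) = \<iota> y"
      using range_\<tau>[OF L2_left_shift[OF s less_imp_le[OF \<tau>(1)] u]] by blast
    have "I (?s + \<tau>) u = \<iota> (S \<tau> x + y)"
      using I_composition[OF s less_imp_le[OF \<tau>(1)] u] x y \<tau>(1) by (simp add: E_\<iota> \<iota>_add)
    then show ?case by (simp add: distrib_right add_ac)
  qed
  obtain n :: nat where "t / \<tau> \<le> n" using real_arch_simple by blast
  then have n: "t \<le> real n * \<tau> + \<tau>" using \<tau>(1) by (simp add: pos_divide_le_eq)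
  obtain u where "u \<in> L2 (Leb (real n * \<tau> + \<tau> - t + t))" "I (real n * \<tau> + \<tau> - t + t) u = I t v"
    using I_right_shift[of "real n * \<tau> + \<tau> - t" t v] n t v by auto
  then show ?thesis using range_n[of u n] by simp
qed

lemma \<iota>_F: "0 \<le> t \<Longrightarrow> u \<in> L2 (Leb t) \<Longrightarrow> \<iota> (F t u) = I t u"
  unfolding input_map_def by (rule f_inv_into_f[OF I_in_range])

lemma F_add:
  assumes "0 \<le> t" "u \<in> L2 (Leb t)" "v \<in> L2 (Leb t)"
  shows "F t (\<lambda>\<sigma>. u \<sigma> + v \<sigma>) = F t u + F t v"
proof -
  have "\<iota> (F t (\<lambda>\<sigma>. u \<sigma> + v \<sigma>)) = \<iota> (F t u + F t v)"
    using assms by (simp add: \<iota>_F I_add \<iota>_add Leb.L2_add)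
  then show ?thesis by (rule injD[OF inj_\<iota>])
qed

lemma F_scaleR:
  assumes "0 \<le> t" "u \<in> L2 (Leb t)"
  shows "F t (\<lambda>\<sigma>. c *\<^sub>R u \<sigma>) = c *\<^sub>R F t u"
proof -
  have "\<iota> (F t (\<lambda>\<sigma>. c *\<^sub>R u \<sigma>)) = \<iota> (c *\<^sub>R F t u)"
    using assms by (simp add: \<iota>_F I_scaleR \<iota>_scaleR L2_scaleR)
  then show ?thesis by (rule injD[OF inj_\<iota>])
qed

text \<open>Automatic boundedness: the graph of \<open>F T\<close> is closed since \<open>I T\<close> is bounded into \<open>'e\<close>, so
  \<open>\<lambda>u. norm (F T u)\<close> is countably subadditive.\<close>

lemma F_bounded:
  assumes T: "0 \<le> T"
  obtains C where "0 \<le> C" "\<And>u. u \<in> L2 (Leb T) \<Longrightarrow> norm (F T u) \<le> C * L2_norm (Leb T) u"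
proof -
  have sum_eq: "(\<lambda>t. (\<Sum>i<n. u i t) - w t) = (\<Sum>i<n. u i) - w" for n and u :: "nat \<Rightarrow> real \<Rightarrow> 'u" and w
    by (simp add: fun_eq_iff fun_sum_apply)
  obtain C where C: "0 \<le> C" "\<And>v. v \<in> L2 (Leb T) \<Longrightarrow> norm (I T v) \<le> C * L2_norm (Leb T) v"
    using integrand(3)[OF Leb.L2_zero] by blast
  show ?thesis
  proof (rule countably_subadditive_seminorm_bounded[of "L2 (Leb T)" "L2_norm (Leb T)" "\<lambda>u. norm (F T u)"])
    fix u v :: "real \<Rightarrow> 'u" assume uv: "u \<in> L2 (Leb T)" "v \<in> L2 (Leb T)"
    show "L2_norm (Leb T) (u + v) \<le> L2_norm (Leb T) u + L2_norm (Leb T) v"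
      using Leb.L2_norm_triangle[OF uv] by (simp add: plus_fun_def)
    show "norm (F T (u + v)) \<le> norm (F T u) + norm (F T v)"
      using F_add[OF T uv] by (simp add: plus_fun_def norm_triangle_ineq)
  next
    fix u :: "nat \<Rightarrow> real \<Rightarrow> 'u" and w
    assume u: "\<And>n. u n \<in> L2 (Leb T)" and w: "w \<in> L2 (Leb T)"
      and lim: "(\<lambda>n. L2_norm (Leb T) ((\<Sum>i<n. u i) - w)) \<longlonglongrightarrow> 0" and sum: "summable (\<lambda>n. norm (F T (u n)))"
    have part: "I T (\<lambda>t. \<Sum>i<n. u i t) = \<iota> (\<Sum>i<n. F T (u i))" for n
    proof (induction n)
      case 0
      have "I T (\<lambda>t. 0 *\<^sub>R u 0 t) = 0" using I_scaleR[OF u, of 0 0] by simp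
      moreover have "\<iota> 0 = 0" using linear_0[OF bounded_linear.linear[OF bounded_linear_\<iota>]] .
      ultimately show ?case by simp
    next
      case (Suc n)
      have "I T (\<lambda>t. (\<Sum>i<n. u i t) + u n t) = I T (\<lambda>t. \<Sum>i<n. u i t) + I T (u n)"
        using u by (intro I_add Leb.L2_sum)
      then show ?case using Suc u T by (simp add: \<iota>_add \<iota>_F)
    qed
    have "(\<lambda>n. \<Sum>i<n. F T (u i)) \<longlonglongrightarrow> (\<Sum>n. F T (u n))"
      using summable_LIMSEQ[OF summable_norm_cancel[OF sum]] .
    then have lim1: "(\<lambda>n. \<iota> (\<Sum>i<n. F T (u i))) \<longlonglongrightarrow> \<iota> (\<Sum>n. F T (u n))"
      by (rule bounded_linear.tendsto[OF bounded_linear_\<iota>])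
    \<comment> \<open>Boundedness of \<open>I T\<close> into \<open>'e\<close> turns L^2 convergence
      of the partial sums into convergence of their images.\<close>
    have "(\<lambda>n. I T (\<lambda>t. \<Sum>i<n. u i t) - I T w) \<longlonglongrightarrow> 0"
    proof (rule Lim_null_comparison)
      show "(\<lambda>n. C * L2_norm (Leb T) ((\<Sum>i<n. u i) - w)) \<longlonglongrightarrow> 0"
        using tendsto_mult_right_zero[OF lim] .
      have "norm (I T (\<lambda>t. \<Sum>i<n. u i t) - I T w) \<le> C * L2_norm (Leb T) ((\<Sum>i<n. u i) - w)" for n
      proof -
        have sn: "(\<lambda>t. \<Sum>i<n. u i t) \<in> L2 (Leb T)" using u by (intro Leb.L2_sum)
        have d: "(\<lambda>t. (\<Sum>i<n. u i t) - w t) \<in> L2 (Leb T)" using sn w by (rule Leb.L2_diff)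
        have "I T (\<lambda>t. ((\<Sum>i<n. u i t) - w t) + w t) = I T (\<lambda>t. (\<Sum>i<n. u i t) - w t) + I T w"
          using d w by (rule I_add)
        then have "I T (\<lambda>t. \<Sum>i<n. u i t) - I T w = I T (\<lambda>t. (\<Sum>i<n. u i t) - w t)" by simp
        then show ?thesis using C(2)[OF d] by (simp add: sum_eq)
      qed
      then show "eventually (\<lambda>n. norm (I T (\<lambda>t. \<Sum>i<n. u i t) - I T w) \<le>
          C * L2_norm (Leb T) ((\<Sum>i<n. u i) - w)) sequentially" by simp
    qed
    then have "(\<lambda>n. \<iota> (\<Sum>i<n. F T (u i))) \<longlonglongrightarrow> I T w" using LIM_zero_cancel by (simp add: part)
    \<comment> \<open>The images have two limits in \<open>'e\<close>, one from the L^2 limit and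
      one from the norm-convergent series in \<open>'h\<close>; injectivity of
      \<open>\<iota>\<close> brings their equality back to \<open>'h\<close>.\<close>
    then have "I T w = \<iota> (\<Sum>n. F T (u n))" using lim1 LIMSEQ_unique by blast
    then have "F T w = (\<Sum>n. F T (u n))" using \<iota>_F[OF T w] injD[OF inj_\<iota>] by metis
    then show "norm (F T w) \<le> (\<Sum>n. norm (F T (u n)))" using summable_norm[OF sum] by simp
  next
    fix u :: "nat \<Rightarrow> real \<Rightarrow> 'u"
    assume "\<And>n. u n \<in> L2 (Leb T)" "summable (\<lambda>n. L2_norm (Leb T) (u n))"
    from Leb.L2_complete[OF this]
    show "\<exists>w\<in>L2 (Leb T). (\<lambda>n. L2_norm (Leb T) ((\<Sum>i<n. u i) - w)) \<longlonglongrightarrow> 0" by (simp add: sum_eq)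
  next
    fix c and u :: "real \<Rightarrow> 'u" assume u: "u \<in> L2 (Leb T)"
    show "L2_norm (Leb T) (c *\<^sub>R u) = \<bar>c\<bar> * L2_norm (Leb T) u"
      using L2_norm_scaleR[of "Leb T" c u] by (simp add: scaleR_fun_def)
    show "norm (F T (c *\<^sub>R u)) = \<bar>c\<bar> * norm (F T u)"
      using F_scaleR[OF T u, of c] by (simp add: scaleR_fun_def)
  qed (use that Leb.subspace_L2 in auto)
qed

lemma F_uniformly_bounded:
  assumes T: "0 \<le> T"
  obtains C where "0 \<le> C"
    "\<And>t u. t \<in> {0..T} \<Longrightarrow> u \<in> L2 (Leb T) \<Longrightarrow> norm (F t u) \<le> C * L2_norm (Leb T) u"
proof -
  obtain C where C: "0 \<le> C" "\<And>u. u \<in> L2 (Leb T) \<Longrightarrow> norm (F T u) \<le> C * L2_norm (Leb T) u"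
    using F_bounded[OF T] by metis
  have "norm (F t u) \<le> C * L2_norm (Leb T) u" if t: "t \<in> {0..T}" and u: "u \<in> L2 (Leb T)" for t u
  proof -
    have ut: "u \<in> L2 (Leb t)" "L2_norm (Leb t) u \<le> L2_norm (Leb T) u"
      using L2_restrict[OF _ u, of t] t by auto
    obtain v where v: "v \<in> L2 (Leb T)" "I T v = I t u" "L2_norm (Leb T) v \<le> L2_norm (Leb t) u"
      using I_right_shift[of "T - t" t u] t ut(1) by auto
    have "\<iota> (F T v) = \<iota> (F t u)" using v t T ut(1) by (simp add: \<iota>_F)
    then have "F t u = F T v" using injD[OF inj_\<iota>] by metis
    then have "norm (F t u) \<le> C * L2_norm (Leb T) v" using C(2)[OF v(1)] by simp
    also have "\<dots> \<le> C * L2_norm (Leb T) u" using v(3) ut(2) C(1) by (intro mult_left_mono) auto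
    finally show ?thesis .
  qed
  then show ?thesis using that C(1) by blast
qed

end

section \<open>Lipschitz continuity and coercivity of the cost\<close>

lemma bdd_above_norm_diff:
  fixes x y :: "real \<Rightarrow> 'a::real_normed_vector"
  assumes "continuous_on {0..T} x" "continuous_on {0..T} y"
  shows "bdd_above ((\<lambda>t. norm (x t - y t)) ` {0..T})"
proof -
  have "compact ((\<lambda>t. norm (x t - y t)) ` {0..T})"
    using assms by (intro compact_continuous_image continuous_intros) auto
  then show ?thesis by (intro bounded_imp_bdd_above compact_imp_bounded)
qed

lemma X_dist_Pair:
  "X_dist T (x, u) (y, v) =
     (SUP t\<in>{0..T}. norm (x t - y t)) + L2_norm (Leb T) (\<lambda>t. u t - v t)"
  by (simp add: X_dist_def)

lemma X_dist_nonneg: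
  assumes "z \<in> X_space T" "z' \<in> X_space T" "0 \<le> T"
  shows "0 \<le> X_dist T z z'"
proof -
  obtain x u y v where z: "z = (x, u)" "z' = (y, v)" by fastforce
  have "norm (x 0 - y 0) \<le> (SUP t\<in>{0..T}. norm (x t - y t))"
    using assms by (intro cSUP_upper bdd_above_norm_diff) (auto simp: z X_space_def)
  then have "0 \<le> (SUP t\<in>{0..T}. norm (x t - y t))" using norm_ge_zero order_trans by blast
  then show ?thesis by (simp add: z X_dist_Pair)
qed

lemma X_dist_triangle:
  assumes "z1 \<in> X_space T" "z2 \<in> X_space T" "z3 \<in> X_space T" "0 \<le> T"
  shows "X_dist T z1 z3 \<le> X_dist T z1 z2 + X_dist T z2 z3"
proof -
  obtain x1 u1 x2 u2 x3 u3 where z: "z1 = (x1, u1)" "z2 = (x2, u2)" "z3 = (x3, u3)"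
    by (metis surj_pair)
  have c: "continuous_on {0..T} x1" "continuous_on {0..T} x2" "continuous_on {0..T} x3"
    and u: "u1 \<in> L2 (Leb T)" "u2 \<in> L2 (Leb T)" "u3 \<in> L2 (Leb T)"
    using assms by (auto simp: z X_space_def)
  have "(SUP t\<in>{0..T}. norm (x1 t - x3 t)) \<le>
      (SUP t\<in>{0..T}. norm (x1 t - x2 t)) + (SUP t\<in>{0..T}. norm (x2 t - x3 t))"
  proof (rule cSUP_least)
    fix t assume t: "t \<in> {0..T}"
    have "norm (x1 t - x3 t) \<le> norm (x1 t - x2 t) + norm (x2 t - x3 t)"
      using norm_triangle_ineq[of "x1 t - x2 t" "x2 t - x3 t"] by simp
    then show "norm (x1 t - x3 t) \<le>
        (SUP t\<in>{0..T}. norm (x1 t - x2 t)) + (SUP t\<in>{0..T}. norm (x2 t - x3 t))"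
      using cSUP_upper[OF t bdd_above_norm_diff[OF c(1,2)]] cSUP_upper[OF t bdd_above_norm_diff[OF c(2,3)]]
      by linarith
  qed (use assms in auto)
  moreover have "L2_norm (Leb T) (\<lambda>t. u1 t - u3 t) \<le>
      L2_norm (Leb T) (\<lambda>t. u1 t - u2 t) + L2_norm (Leb T) (\<lambda>t. u2 t - u3 t)"
    using Leb.L2_norm_triangle[OF Leb.L2_diff[OF u(1,2)] Leb.L2_diff[OF u(2,3)]] by simp
  ultimately show ?thesis by (simp add: z X_dist_Pair)
qed

section \<open>Constraint functions and the Slater margin\<close>

lemma constraint_continuous:
  assumes "continuous_on (UNIV \<times> {0..T}) (\<lambda>(x, t). f x t)" and x: "continuous_on {0..T} x"
  shows "continuous_on {0..T} (\<lambda>t. f (x t) t)"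
proof -
  have "continuous_on {0..T} (\<lambda>t. (\<lambda>(x, t). f x t) (x t, t))"
    by (rule continuous_on_compose2[OF assms(1)]) (auto intro!: continuous_intros x)
  then show ?thesis by simp
qed

lemma bdd_above_constraints:
  fixes g :: "nat \<Rightarrow> 'h::real_normed_vector \<Rightarrow> real \<Rightarrow> real"
  assumes g: "\<forall>j\<in>{1..l}. continuous_on (UNIV \<times> {0..T}) (\<lambda>(x, t). g j x t)"
    and x: "continuous_on {0..T} x"
  shows "bdd_above ((\<lambda>t. Max (insert 0 ((\<lambda>j. g j (x t) t) ` {1..l}))) ` {0..T})"
proof -
  have "\<exists>b. \<forall>t\<in>{0..T}. g j (x t) t \<le> b" if j: "j \<in> {1..l}" for j
  proof -
    have "compact ((\<lambda>t. g j (x t) t) ` {0..T})"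
      by (intro compact_continuous_image constraint_continuous[OF bspec[OF g j] x]) simp
    then have "bdd_above ((\<lambda>t. g j (x t) t) ` {0..T})"
      by (intro bounded_imp_bdd_above compact_imp_bounded)
    then show ?thesis by (auto simp: bdd_above_def)
  qed
  then obtain b where b: "\<And>j t. j \<in> {1..l} \<Longrightarrow> t \<in> {0..T} \<Longrightarrow> g j (x t) t \<le> b j" by metis
  \<comment> \<open>A sum of absolute values dominates each of its terms and is also defined when
    there are no constraints.\<close>
  have "Max (insert 0 ((\<lambda>j. g j (x t) t) ` {1..l})) \<le> (\<Sum>j\<in>{1..l}. \<bar>b j\<bar>)" if t: "t \<in> {0..T}" for t
  proof (rule Max.boundedI)
    fix y assume "y \<in> insert 0 ((\<lambda>j. g j (x t) t) ` {1..l})"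
    then consider "y = 0" | j where "j \<in> {1..l}" "y = g j (x t) t" by auto
    then show "y \<le> (\<Sum>j\<in>{1..l}. \<bar>b j\<bar>)"
    proof cases
      case 2
      have "y \<le> \<bar>b j\<bar>" using b[OF 2(1) t] 2(2) by linarith
      also have "\<dots> \<le> (\<Sum>j\<in>{1..l}. \<bar>b j\<bar>)" using 2(1) by (intro member_le_sum) auto
      finally show ?thesis .
    qed (simp add: sum_nonneg)
  qed auto
  then show ?thesis by (rule bdd_aboveI2)
qed

lemma constraint_violation_bounds:
  fixes g :: "nat \<Rightarrow> 'h::real_normed_vector \<Rightarrow> real \<Rightarrow> real"
  assumes g: "\<forall>j\<in>{1..l}. continuous_on (UNIV \<times> {0..T}) (\<lambda>(x, t). g j x t)"
    and x: "continuous_on {0..T} x" and T: "0 \<le> T"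
  shows "0 \<le> constraint_violation T l g (x, u)"
    and "j \<in> {1..l} \<Longrightarrow> t \<in> {0..T} \<Longrightarrow> g j (x t) t \<le> constraint_violation T l g (x, u)"
proof -
  have up: "Max (insert 0 ((\<lambda>j. g j (x t) t) ` {1..l})) \<le> constraint_violation T l g (x, u)"
    if "t \<in> {0..T}" for t
    unfolding constraint_violation_def using cSUP_upper[OF that bdd_above_constraints[OF g x]] by simp
  have "0 \<le> Max (insert 0 ((\<lambda>j. g j (x 0) 0) ` {1..l}))" by (rule Max_ge) auto
  also have "\<dots> \<le> constraint_violation T l g (x, u)" using T by (intro up) simp
  finally show "0 \<le> constraint_violation T l g (x, u)" .
  assume j: "j \<in> {1..l}" and t: "t \<in> {0..T}"
  have "g j (x t) t \<le> Max (insert 0 ((\<lambda>j. g j (x t) t) ` {1..l}))" using j by (intro Max_ge) auto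
  also have "\<dots> \<le> constraint_violation T l g (x, u)" using t by (rule up)
  finally show "g j (x t) t \<le> constraint_violation T l g (x, u)" .
qed

lemma constraint_violation_le:
  assumes "0 \<le> T" "\<And>j t. j \<in> {1..l} \<Longrightarrow> t \<in> {0..T} \<Longrightarrow> g j (x t) t \<le> b"
  shows "constraint_violation T l g (x, u) \<le> max 0 b"
  unfolding constraint_violation_def prod.case
proof (rule cSUP_least)
  fix t assume "t \<in> {0..T}"
  then show "Max (insert 0 ((\<lambda>j. g j (x t) t) ` {1..l})) \<le> max 0 b"
    using assms(2) by (intro Max.boundedI) (auto simp: le_max_iff_disj)
qed (use assms in auto)

lemma Slater_margin:
  fixes g :: "nat \<Rightarrow> 'h::real_normed_vector \<Rightarrow> real \<Rightarrow> real"
  assumes g: "\<forall>j\<in>{1..l}. continuous_on (UNIV \<times> {0..T}) (\<lambda>(x, t). g j x t)"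
    and x: "continuous_on {0..T} x" and T: "0 \<le> T"
    and neg: "\<forall>t\<in>{0..T}. \<forall>j\<in>{1..l}. g j (x t) t < 0"
  obtains \<delta> where "0 < \<delta>" "\<And>t j. t \<in> {0..T} \<Longrightarrow> j \<in> {1..l} \<Longrightarrow> g j (x t) t \<le> - \<delta>"
proof -
  have "\<exists>d>0. \<forall>t\<in>{0..T}. g j (x t) t \<le> - d" if j: "j \<in> {1..l}" for j
  proof -
    obtain s where s: "s \<in> {0..T}" "\<forall>t\<in>{0..T}. g j (x t) t \<le> g j (x s) s"
      using continuous_attains_sup[OF _ _ constraint_continuous[OF bspec[OF g j] x]] T by auto
    then show ?thesis using neg j by (intro exI[of _ "- g j (x s) s"]) auto
  qed
  then obtain d where d: "\<And>j. j \<in> {1..l} \<Longrightarrow> 0 < d j"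
    "\<And>j t. j \<in> {1..l} \<Longrightarrow> t \<in> {0..T} \<Longrightarrow> g j (x t) t \<le> - d j" by metis
  \<comment> \<open>Compactness of the interval has given a margin for each constraint. Inserting 1
    keeps the minimum defined and positive when \<open>l = 0\<close>.\<close>
  define \<delta> where "\<delta> = Min (insert 1 (d ` {1..l}))"
  have "0 < \<delta>" using d(1) by (simp add: \<delta>_def)
  moreover have "\<delta> \<le> d j" if "j \<in> {1..l}" for j unfolding \<delta>_def using that by (intro Min_le) auto
  ultimately show ?thesis using that[of \<delta>] d(2) by force
qed

section \<open>The cost functional on bounded sets\<close>

lemma GDERIV_lipschitz:
  fixes f :: "'a::real_inner \<Rightarrow> real"
  assumes D: "\<And>w. GDERIV f w :> D w" and bound: "\<And>w. norm w \<le> r \<Longrightarrow> norm (D w) \<le> b"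
    and "norm v \<le> r" "norm w \<le> r"
  shows "\<bar>f v - f w\<bar> \<le> b * norm (v - w)"
proof -
  \<comment> \<open>The growth conditions bound the gradient on balls only; balls are convex, so the
    mean value inequality applies there.\<close>
  have "norm (f v - f w) \<le> b * norm (v - w)"
  proof (rule differentiable_bound[of "cball 0 r"])
    show "(f has_derivative (\<lambda>h. h \<bullet> D z)) (at z within cball 0 r)" for z
      using D[of z] by (simp add: gderiv_def has_derivative_at_withinI)
    show "onorm (\<lambda>h. h \<bullet> D z) \<le> b" if "z \<in> cball 0 r" for z
    proof (rule onorm_bound)
      have nD: "norm (D z) \<le> b" using bound that by simp
      then show "0 \<le> b" using norm_ge_zero order_trans by blast
      show "norm (h \<bullet> D z) \<le> b * norm h" for h
      proof -
        have "norm (h \<bullet> D z) \<le> norm h * norm (D z)" using Cauchy_Schwarz_ineq2[of h "D z"] by simp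
        also have "\<dots> \<le> norm h * b" using nD by (rule mult_left_mono) simp
        finally show ?thesis by (simp add: mult.commute)
      qed
    qed
  qed (use assms in auto)
  then show ?thesis by simp
qed

lemma cost_integrand_measurable:
  fixes \<theta> :: "'h::real_normed_vector \<Rightarrow> 'u::real_normed_vector \<Rightarrow> real \<Rightarrow> real"
  assumes \<theta>: "continuous_on (UNIV \<times> UNIV \<times> {0..T}) (\<lambda>(x, u, t). \<theta> x u t)"
    and x: "continuous_on {0..T} x" and u: "u \<in> L2 (Leb T)"
  shows "(\<lambda>t. \<theta> (x t) (u t) t) \<in> borel_measurable (Leb T)"
proof -
  have "continuous_on ({0..T} \<times> UNIV) (\<lambda>p. (\<lambda>(x, u, t). \<theta> x u t) (x (fst p), snd p, fst p))"
    by (rule continuous_on_compose2[OF \<theta>])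
       (auto intro!: continuous_intros continuous_on_compose2[OF x])
  then have "continuous_on ({0..T} \<times> UNIV) (\<lambda>(t, v). \<theta> (x t) v t)" by (simp add: case_prod_beta')
  from strongly_measurable_Caratheodory[OF Leb.L2_D(1)[OF u] this]
  show ?thesis by (rule Leb.strongly_measurable_imp_borel_measurable)
qed

lemma cost_integrable:
  fixes \<theta> :: "'h::real_normed_vector \<Rightarrow> 'u::real_normed_vector \<Rightarrow> real \<Rightarrow> real"
  assumes \<theta>: "continuous_on (UNIV \<times> UNIV \<times> {0..T}) (\<lambda>(x, u, t). \<theta> x u t)"
    and growth: "\<forall>R>0. \<exists>C>0. \<exists>\<omega>. integrable (Leb T) \<omega> \<and>
          (AE t in Leb T. \<omega> t \<ge> 0) \<and>
          (\<forall>x u. \<forall>t\<in>{0<..<T}. norm x \<le> R \<longrightarrow> \<bar>\<theta> x u t\<bar> \<le> C * (norm u)\<^sup>2 + \<omega> t)"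
    and x: "continuous_on {0..T} x" and u: "u \<in> L2 (Leb T)"
  shows "integrable (Leb T) (\<lambda>t. \<theta> (x t) (u t) t)"
proof -
  \<comment> \<open>A single trajectory is bounded, so one radius of the growth condition
    suffices.\<close>
  have "bounded (x ` {0..T})" by (intro compact_imp_bounded compact_continuous_image x) auto
  then obtain R where R: "0 < R" "\<And>t. t \<in> {0..T} \<Longrightarrow> norm (x t) \<le> R"
    by (auto simp: bounded_pos)
  obtain C \<omega> where C: "integrable (Leb T) \<omega>"
    "\<forall>x u. \<forall>t\<in>{0<..<T}. norm x \<le> R \<longrightarrow> \<bar>\<theta> x u t\<bar> \<le> C * (norm u)\<^sup>2 + \<omega> t"
    using growth[rule_format, OF R(1)] by auto
  show ?thesis
  proof (rule Bochner_Integration.integrable_bound)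
    show "integrable (Leb T) (\<lambda>t. C * (norm (u t))\<^sup>2 + \<omega> t)"
      using C(1) u by (simp add: L2_def)
    show "AE t in Leb T. norm (\<theta> (x t) (u t) t) \<le> norm (C * (norm (u t))\<^sup>2 + \<omega> t)"
    proof (rule AE_I2)
      fix t assume "t \<in> space (Leb T)"
      then have "\<bar>\<theta> (x t) (u t) t\<bar> \<le> C * (norm (u t))\<^sup>2 + \<omega> t" using R(2) C(2) by auto
      then show "norm (\<theta> (x t) (u t) t) \<le> norm (C * (norm (u t))\<^sup>2 + \<omega> t)" by simp
    qed
  qed (rule cost_integrand_measurable[OF \<theta> x u])
qed

text \<open>The state is changed at fixed control, then the control at fixed state. The first
  difference is at most the sup distance times an integrable function; the second is bounded by a
  product of L^2 functions, and Cauchy-Schwarz brings out the L^2 distance.\<close>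

lemma cost_lipschitz:
  fixes \<theta> :: "'h::complex_hilbert \<Rightarrow> 'u::complex_hilbert \<Rightarrow> real \<Rightarrow> real" and T :: real
  defines "M \<equiv> Leb T"
  assumes T: "0 \<le> T"
    and int: "\<And>x u. continuous_on {0..T} x \<Longrightarrow> u \<in> L2 M \<Longrightarrow> integrable M (\<lambda>t. \<theta> (x t) (u t) t)"
    and gx: "\<forall>x u. \<forall>t\<in>{0..T}. GDERIV (\<lambda>y. \<theta> y u t) x :> \<theta>\<^sub>x x u t"
    and gu: "\<forall>x u. \<forall>t\<in>{0..T}. GDERIV (\<lambda>v. \<theta> x v t) u :> \<theta>\<^sub>u x u t"
    and C: "0 \<le> C" "integrable M \<omega>" "\<eta> \<in> L2 M"
      "\<forall>x u. \<forall>t\<in>{0<..<T}. norm x \<le> R \<longrightarrow>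
         norm (\<theta>\<^sub>x x u t) \<le> C * (norm u)\<^sup>2 + \<omega> t \<and> norm (\<theta>\<^sub>u x u t) \<le> C * norm u + \<eta> t"
    and x: "continuous_on {0..T} x" "\<And>t. t \<in> {0..T} \<Longrightarrow> norm (x t) \<le> R"
    and y: "continuous_on {0..T} y" "\<And>t. t \<in> {0..T} \<Longrightarrow> norm (y t) \<le> R"
    and u: "u \<in> L2 M" "L2_norm M u \<le> K" and v: "v \<in> L2 M" "L2_norm M v \<le> K"
  shows "\<bar>cost T \<theta> (x, u) - cost T \<theta> (y, v)\<bar> \<le>
    (C * K\<^sup>2 + \<bar>integral\<^sup>L M \<omega>\<bar> + 2 * C * K + L2_norm M \<eta>) * X_dist T (x, u) (y, v)"
proof -
  interpret M: complete_finite_measure M unfolding M_def by (rule complete_finite_measure_lebesgue_on)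
  define a where "a = (SUP t\<in>{0..T}. norm (x t - y t))"
  define b where "b = L2_norm M (\<lambda>t. u t - v t)"
  have a: "norm (x t - y t) \<le> a" if "t \<in> {0..T}" for t
    unfolding a_def by (rule cSUP_upper[OF that bdd_above_norm_diff[OF x(1) y(1)]])
  have "norm (x 0 - y 0) \<le> a" using a T by simp
  then have a0: "0 \<le> a" using norm_ge_zero order_trans by blast
  have b0: "0 \<le> b" by (simp add: b_def)
  have K0: "0 \<le> K" using u(2) L2_norm_nonneg order_trans by blast
  have d: "(\<lambda>t. u t - v t) \<in> L2 M" using u(1) v(1) by (rule M.L2_diff)
  let ?h = "\<lambda>t. a * (C * (norm (u t))\<^sup>2 + \<omega> t) +
      (C * (norm (u t - v t) * norm (u t)) + C * (norm (u t - v t) * norm (v t)) + norm (u t - v t) * norm (\<eta> t))"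
  have le: "\<bar>\<theta> (x t) (u t) t - \<theta> (y t) (v t) t\<bar> \<le> ?h t" if t: "t \<in> {0<..<T}" for t
  proof -
    have t': "t \<in> {0..T}" using t by auto
    have "\<bar>\<theta> (x t) (u t) t - \<theta> (y t) (u t) t\<bar> \<le> (C * (norm (u t))\<^sup>2 + \<omega> t) * norm (x t - y t)"
      by (rule GDERIV_lipschitz[where f="\<lambda>z. \<theta> z (u t) t" and D="\<lambda>z. \<theta>\<^sub>x z (u t) t" and r=R])
         (use gx C(4) t t' x(2) y(2) in auto)
    \<comment> \<open>The bound dominates a norm, so it is nonnegative at every \<open>t\<close> of
      the interval, whereas \<open>\<omega>\<close> itself need not be.\<close>
    moreover have "0 \<le> C * (norm (u t))\<^sup>2 + \<omega> t"
    proof -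
      have "norm (\<theta>\<^sub>x (x t) (u t) t) \<le> C * (norm (u t))\<^sup>2 + \<omega> t" using C(4) t x(2)[OF t'] by blast
      then show ?thesis using norm_ge_zero order_trans by blast
    qed
    then have "(C * (norm (u t))\<^sup>2 + \<omega> t) * norm (x t - y t) \<le> (C * (norm (u t))\<^sup>2 + \<omega> t) * a"
      using a[OF t'] by (intro mult_left_mono)
    \<comment> \<open>The ball of radius \<open>norm (u t) + norm (v t)\<close> contains both
      controls, and the gradient in the control grows at most linearly on it. The norm of
      \<open>\<eta> t\<close> replaces \<open>\<eta> t\<close>, whose sign is not known.\<close>
    moreover have "\<bar>\<theta> (y t) (u t) t - \<theta> (y t) (v t) t\<bar> \<le>
        (C * (norm (u t) + norm (v t)) + norm (\<eta> t)) * norm (u t - v t)"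
    proof (rule GDERIV_lipschitz[where f="\<lambda>z. \<theta> (y t) z t" and D="\<lambda>z. \<theta>\<^sub>u (y t) z t" and
          r="norm (u t) + norm (v t)"])
      fix w :: 'u assume w: "norm w \<le> norm (u t) + norm (v t)"
      have "norm (\<theta>\<^sub>u (y t) w t) \<le> C * norm w + \<eta> t" using C(4) t y(2)[OF t'] by blast
      also have "\<dots> \<le> C * (norm (u t) + norm (v t)) + norm (\<eta> t)"
        using w C(1) by (intro add_mono mult_left_mono) auto
      finally show "norm (\<theta>\<^sub>u (y t) w t) \<le> C * (norm (u t) + norm (v t)) + norm (\<eta> t)" .
    qed (use gu t' in auto)
    ultimately show ?thesis by (simp add: algebra_simps)
  qed
  note integrals = C(2) M.L2_D(2)[OF u(1)] M.L2_Cauchy_Schwarz(1)[OF d u(1)]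
    M.L2_Cauchy_Schwarz(1)[OF d v(1)] M.L2_Cauchy_Schwarz(1)[OF d C(3)]
  have int_h: "integrable M ?h"
    using integrals by simp
  have "\<bar>cost T \<theta> (x, u) - cost T \<theta> (y, v)\<bar> = \<bar>\<integral>t. \<theta> (x t) (u t) t - \<theta> (y t) (v t) t \<partial>M\<bar>"
    using int[OF x(1) u(1)] int[OF y(1) v(1)] by (simp add: cost_def M_def)
  also have "\<dots> \<le> (\<integral>t. \<bar>\<theta> (x t) (u t) t - \<theta> (y t) (v t) t\<bar> \<partial>M)" by (rule integral_abs_bound)
  also have "\<dots> \<le> (\<integral>t. ?h t \<partial>M)"
    using int[OF x(1) u(1)] int[OF y(1) v(1)] int_h le by (intro integral_mono) (auto simp: M_def)
  also have "\<dots> = a * (C * (L2_norm M u)\<^sup>2 + integral\<^sup>L M \<omega>) +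
      (C * (\<integral>t. norm (u t - v t) * norm (u t) \<partial>M) + C * (\<integral>t. norm (u t - v t) * norm (v t) \<partial>M) +
       (\<integral>t. norm (u t - v t) * norm (\<eta> t) \<partial>M))"
    using integrals by (simp add: L2_norm_power2)
  also have "\<dots> \<le> a * (C * K\<^sup>2 + \<bar>integral\<^sup>L M \<omega>\<bar>) + (C * (b * K) + C * (b * K) + b * L2_norm M \<eta>)"
  proof (intro add_mono mult_left_mono a0 C(1))
    show "(L2_norm M u)\<^sup>2 \<le> K\<^sup>2" using u(2) by (intro power_mono) auto
    show "(\<integral>t. norm (u t - v t) * norm (u t) \<partial>M) \<le> b * K"
      using M.L2_Cauchy_Schwarz(2)[OF d u(1)] mult_left_mono[OF u(2) b0] by (simp add: b_def)
    show "(\<integral>t. norm (u t - v t) * norm (v t) \<partial>M) \<le> b * K"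
      using M.L2_Cauchy_Schwarz(2)[OF d v(1)] mult_left_mono[OF v(2) b0] by (simp add: b_def)
    show "(\<integral>t. norm (u t - v t) * norm (\<eta> t) \<partial>M) \<le> b * L2_norm M \<eta>"
      using M.L2_Cauchy_Schwarz(2)[OF d C(3)] by (simp add: b_def)
  qed auto
  also have "\<dots> = (C * K\<^sup>2 + \<bar>integral\<^sup>L M \<omega>\<bar>) * a + (2 * C * K + L2_norm M \<eta>) * b"
    by (simp add: algebra_simps)
  \<comment> \<open>The distance is the sum of \<open>a\<close> and \<open>b\<close>, so the sum of
    their coefficients is a common Lipschitz constant.\<close>
  also have "\<dots> \<le> (C * K\<^sup>2 + \<bar>integral\<^sup>L M \<omega>\<bar> + 2 * C * K + L2_norm M \<eta>) * a +
      (C * K\<^sup>2 + \<bar>integral\<^sup>L M \<omega>\<bar> + 2 * C * K + L2_norm M \<eta>) * b"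
    using C(1) K0 by (intro add_mono[OF mult_right_mono mult_right_mono] a0 b0) auto
  also have "\<dots> = (C * K\<^sup>2 + \<bar>integral\<^sup>L M \<omega>\<bar> + 2 * C * K + L2_norm M \<eta>) * X_dist T (x, u) (y, v)"
    by (simp add: X_dist_Pair a_def b_def M_def distrib_left)
  finally show ?thesis .
qed

text \<open>The exceptional null set of the coercivity condition depends on \<open>(x, u)\<close>. Along a trajectory
  countably many pairs suffice: rational times for the state, and the values of simple approximants
  for the control.\<close>

lemma coercive_along_trajectory:
  fixes \<theta> :: "'h::real_normed_vector \<Rightarrow> 'u::real_normed_vector \<Rightarrow> real \<Rightarrow> real"
  assumes \<theta>: "continuous_on (UNIV \<times> UNIV \<times> {0..T}) (\<lambda>(x, u, t). \<theta> x u t)"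
    and coercive: "\<forall>x u. AE t in Leb T. \<theta> x u t \<ge> C * (norm u)\<^sup>2 + \<omega> t"
    and x: "continuous_on {0..T} x" and u: "strongly_measurable (Leb T) u"
  shows "AE t in Leb T. \<theta> (x t) (u t) t \<ge> C * (norm (u t))\<^sup>2 + \<omega> t"
proof -
  let ?M = "Leb T"
  obtain s where s: "\<And>n::nat. simple_function ?M (s n)" "AE t in ?M. (\<lambda>n. s n t) \<longlonglongrightarrow> u t"
    using u by (auto simp: strongly_measurable_def)
  have "AE t in ?M. \<forall>n. \<forall>q\<in>\<rat>. \<forall>v\<in>s n ` space ?M. \<theta> (x q) v t \<ge> C * (norm v)\<^sup>2 + \<omega> t"
    unfolding AE_all_countable
  proof
    fix n
    define V where "V = s n ` space ?M"
    have "countable V"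
      using s(1)[of n] unfolding V_def by (intro countable_finite) (simp add: simple_function_def)
    then show "AE t in ?M. \<forall>q\<in>\<rat>. \<forall>v\<in>s n ` space ?M. \<theta> (x q) v t \<ge> C * (norm v)\<^sup>2 + \<omega> t"
      unfolding V_def[symmetric] using coercive by (simp add: AE_ball_countable countable_rat)
  qed
  with s(2) AE_space show ?thesis
  proof eventually_elim
    case (elim t)
    have t: "t \<in> {0<..<T}" using elim by simp
    \<comment> \<open>For a fixed rational \<open>q\<close>, continuity in the control removes the
      approximants.\<close>
    have rational: "C * (norm (u t))\<^sup>2 + \<omega> t \<le> \<theta> (x q) (u t) t" if "q \<in> \<rat>" for q
    proof (rule LIMSEQ_le)
      show "(\<lambda>n. C * (norm (s n t))\<^sup>2 + \<omega> t) \<longlonglongrightarrow> C * (norm (u t))\<^sup>2 + \<omega> t"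
        by (intro tendsto_intros elim)
      have "(\<lambda>n. (x q, s n t, t)) \<longlonglongrightarrow> (x q, u t, t)" by (intro tendsto_intros elim)
      from continuous_on_tendsto_compose[OF \<theta> this]
      show "(\<lambda>n. \<theta> (x q) (s n t) t) \<longlonglongrightarrow> \<theta> (x q) (u t) t" using t by simp
      show "\<exists>N. \<forall>n\<ge>N. C * (norm (s n t))\<^sup>2 + \<omega> t \<le> \<theta> (x q) (s n t) t" using elim that by blast
    qed
    show ?case
    proof (rule ccontr)
      assume "\<not> ?case"
      then have less: "\<theta> (x t) (u t) t < C * (norm (u t))\<^sup>2 + \<omega> t" by simp
      \<comment> \<open>Only the state varies here; the control value and the time argument of
        \<theta> stay at \<open>t\<close>. A strict violation at \<open>t\<close> would persist at
        rational times close to \<open>t\<close>.\<close>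
      have "continuous_on {0..T} (\<lambda>r. (\<lambda>(x, u, t). \<theta> x u t) (x r, u t, t))"
        by (rule continuous_on_compose2[OF \<theta>]) (use t in \<open>auto intro!: continuous_intros x\<close>)
      then have "continuous_on {0..T} (\<lambda>r. \<theta> (x r) (u t) t)" by simp
      then have "((\<lambda>r. \<theta> (x r) (u t) t) \<longlongrightarrow> \<theta> (x t) (u t) t) (at t within {0..T})"
        using t by (auto simp: continuous_on_def)
      then have "eventually (\<lambda>r. \<theta> (x r) (u t) t < C * (norm (u t))\<^sup>2 + \<omega> t) (at t within {0..T})"
        using less by (rule order_tendstoD)
      then obtain e where e: "0 < e"
        "\<And>r. r \<in> {0..T} \<Longrightarrow> r \<noteq> t \<Longrightarrow> dist r t < e \<Longrightarrow> \<theta> (x r) (u t) t < C * (norm (u t))\<^sup>2 + \<omega> t"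
        by (auto simp: eventually_at)
      obtain q where q: "q \<in> \<rat>" "t < q" "q < min (t + e) T"
        using Rats_dense_in_real[of t "min (t + e) T"] e(1) t by auto
      then have "\<theta> (x q) (u t) t < C * (norm (u t))\<^sup>2 + \<omega> t"
        using t by (intro e(2)) (auto simp: dist_real_def)
      then show False using rational[OF q(1)] by simp
    qed
  qed
qed

lemma coercive_L2_bound:
  fixes \<theta> :: "'h::real_normed_vector \<Rightarrow> 'u::real_normed_vector \<Rightarrow> real \<Rightarrow> real" and T :: real
  defines "M \<equiv> Leb T"
  assumes \<theta>: "continuous_on (UNIV \<times> UNIV \<times> {0..T}) (\<lambda>(x, u, t). \<theta> x u t)"
    and coercive: "0 < C" "integrable M \<omega>" "\<forall>x u. AE t in M. \<theta> x u t \<ge> C * (norm u)\<^sup>2 + \<omega> t"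
    and x: "continuous_on {0..T} x" and u: "u \<in> L2 M"
    and int: "integrable M (\<lambda>t. \<theta> (x t) (u t) t)" and c: "cost T \<theta> (x, u) < c"
  shows "L2_norm M u \<le> sqrt ((c - integral\<^sup>L M \<omega>) / C)"
proof -
  have u': "strongly_measurable M u" "integrable M (\<lambda>t. (norm (u t))\<^sup>2)" using u by (auto simp: L2_def)
  have "C * (L2_norm M u)\<^sup>2 + integral\<^sup>L M \<omega> = (\<integral>t. C * (norm (u t))\<^sup>2 + \<omega> t \<partial>M)"
    using u'(2) coercive(2) by (simp add: L2_norm_power2)
  also have "\<dots> \<le> (\<integral>t. \<theta> (x t) (u t) t \<partial>M)"
    using u'(2) coercive(2) int
      coercive_along_trajectory[OF \<theta> coercive(3)[unfolded M_def] x u'(1)[unfolded M_def], folded M_def]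
    by (intro integral_mono_AE) auto
  also have "\<dots> < c" using c by (simp add: cost_def M_def)
  finally have "(L2_norm M u)\<^sup>2 \<le> (c - integral\<^sup>L M \<omega>) / C" using coercive(1) by (simp add: field_simps)
  then show ?thesis by (rule real_le_rsqrt)
qed

section \<open>Exactness for the optimal control problem\<close>

theorem theorem14:
  fixes S :: "real \<Rightarrow> 'h::complex_hilbert \<Rightarrow> 'h"
    and \<beta> :: complex
    and \<iota> :: "'h \<Rightarrow> 'e::complex_banach"
    and B :: "'u::complex_hilbert \<Rightarrow> 'e"
    and T :: real and x\<^sub>0 x\<^sub>T :: 'h
    and U :: "(real \<Rightarrow> 'u) set"
    and \<theta> :: "'h \<Rightarrow> 'u \<Rightarrow> real \<Rightarrow> real"
    and \<theta>\<^sub>x :: "'h \<Rightarrow> 'u \<Rightarrow> real \<Rightarrow> 'h"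
    and \<theta>\<^sub>u :: "'h \<Rightarrow> 'u \<Rightarrow> real \<Rightarrow> 'u"
    and l :: nat and g :: "nat \<Rightarrow> 'h \<Rightarrow> real \<Rightarrow> real"
    and M :: "real measure"
    and A \<Omega> :: "((real \<Rightarrow> 'h) \<times> (real \<Rightarrow> 'u)) set"
  assumes M_def: "M = lebesgue_on {0<..<T}"
    and A_def: "A = admissible_pairs \<iota> S B T x\<^sub>0 x\<^sub>T U"
    and \<Omega>_def: "\<Omega> = feasible_set A T l g"
    and semigroup: "C0_semigroup S"
    and extrapolation: "\<beta> \<in> resolvent_set S" "extrapolation_space S \<beta> \<iota>"
    and admissible: "admissible_control_operator \<iota> S B"
    and T_pos: "T > 0"
    and U: "U \<subseteq> L2 M" "L2_closed M U" "L2_convex U"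
    and \<theta>_continuous: "continuous_on (UNIV \<times> UNIV \<times> {0..T}) (\<lambda>(x, u, t). \<theta> x u t)"
    and \<theta>_growth: "\<forall>R>0. \<exists>C>0. \<exists>\<omega>. integrable M \<omega> \<and> (AE t in M. \<omega> t \<ge> 0) \<and>
          (\<forall>x u. \<forall>t\<in>{0<..<T}. norm x \<le> R \<longrightarrow> \<bar>\<theta> x u t\<bar> \<le> C * (norm u)\<^sup>2 + \<omega> t)"
    and coercive: "(\<exists>K. \<forall>u\<in>U. L2_norm M u \<le> K) \<or>
          (\<exists>C>0. \<exists>\<omega>. integrable M \<omega> \<and>
            (\<forall>x u. AE t in M. \<theta> x u t \<ge> C * (norm u)\<^sup>2 + \<omega> t))"
    and \<theta>_gradient_x: "\<forall>x u. \<forall>t\<in>{0..T}. GDERIV (\<lambda>y. \<theta> y u t) x :> \<theta>\<^sub>x x u t"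
    and \<theta>_gradient_u: "\<forall>x u. \<forall>t\<in>{0..T}. GDERIV (\<lambda>v. \<theta> x v t) u :> \<theta>\<^sub>u x u t"
    and \<theta>\<^sub>x_continuous: "continuous_on (UNIV \<times> UNIV \<times> {0..T}) (\<lambda>(x, u, t). \<theta>\<^sub>x x u t)"
    and \<theta>\<^sub>u_continuous: "continuous_on (UNIV \<times> UNIV \<times> {0..T}) (\<lambda>(x, u, t). \<theta>\<^sub>u x u t)"
    and gradient_growth: "\<forall>R>0. \<exists>C>0. \<exists>\<omega> \<eta>.
          integrable M \<omega> \<and> (AE t in M. \<omega> t \<ge> 0) \<and> \<eta> \<in> L2 M \<and> (AE t in M. (\<eta> t :: real) \<ge> 0) \<and>
          (\<forall>x u. \<forall>t\<in>{0<..<T}. norm x \<le> R \<longrightarrow>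
             norm (\<theta>\<^sub>x x u t) \<le> C * (norm u)\<^sup>2 + \<omega> t \<and> norm (\<theta>\<^sub>u x u t) \<le> C * norm u + \<eta> t)"
    and optimal: "\<exists>z. globally_optimal (cost T \<theta>) \<Omega> z"
    and g_convex: "\<forall>j\<in>{1..l}. \<forall>t\<in>{0..T}. convex_on UNIV (\<lambda>x. g j x t)"
    and g_continuous: "\<forall>j\<in>{1..l}. continuous_on (UNIV \<times> {0..T}) (\<lambda>(x, t). g j x t)"
    and slater: "\<exists>(x, u)\<in>A. \<forall>t\<in>{0..T}. \<forall>j\<in>{1..l}. g j (x t) t < 0"
  shows "\<forall>c::real. \<exists>lam0\<ge>0. \<forall>lam\<ge>lam0.
           completely_exact (X_dist T) (cost T \<theta>) \<Omega> (penalty T \<theta> l g lam) A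
             {z \<in> A. penalty T \<theta> l g lam z < c}"
proof
  fix c :: real
  interpret control_system S \<beta> \<iota> B
    by standard (use semigroup extrapolation admissible in auto)
  have M: "M = Leb T" by (simp add: M_def)
  interpret M: complete_finite_measure M
    unfolding M_def by (rule complete_finite_measure_lebesgue_on)
  have T0: "0 \<le> T" using T_pos by simp
  let ?\<phi> = "constraint_violation T l g"
  have A_iff: "(x, u) \<in> A \<longleftrightarrow> continuous_on {0..T} x \<and> u \<in> L2 M \<and> u \<in> U \<and> x T = x\<^sub>T \<and>
      (\<forall>t\<in>{0..T}. x t = S t x\<^sub>0 + F t u)" for x u
    by (auto simp: A_def admissible_pairs_def X_space_def M_def)
  have AX: "z \<in> X_space T" if "z \<in> A" for z
    using that by (auto simp: A_def admissible_pairs_def)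
  obtain z0 where z0: "globally_optimal (cost T \<theta>) \<Omega> z0" using optimal by blast
  obtain xh uh where h: "(xh, uh) \<in> A" "\<forall>t\<in>{0..T}. \<forall>j\<in>{1..l}. g j (xh t) t < 0"
    using slater by blast
  have xh: "continuous_on {0..T} xh" and uh: "uh \<in> L2 M" using h(1) by (auto simp: A_iff)
  \<comment> \<open>The abstract result needs the optimal value strictly below the level, which
    \<open>c\<close> may fail to provide. Exactness is proved for the larger level and then
    restricted.\<close>
  define c' where "c' = max c (cost T \<theta> z0 + 1)"
  have int: "integrable M (\<lambda>t. \<theta> (x t) (u t) t)" if "continuous_on {0..T} x" "u \<in> L2 M" for x u
    using cost_integrable[OF \<theta>_continuous \<theta>_growth[unfolded M_def] that(1)] that(2) by (simp add: M_def)
  have "\<exists>K. \<forall>x u. (x, u) \<in> A \<longrightarrow> cost T \<theta> (x, u) < c' \<longrightarrow> L2_norm M u \<le> K"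
    using coercive
  proof
    assume "\<exists>K. \<forall>u\<in>U. L2_norm M u \<le> K"
    then show ?thesis using A_iff by blast
  next
    assume "\<exists>C>0. \<exists>\<omega>. integrable M \<omega> \<and> (\<forall>x u. AE t in M. \<theta> x u t \<ge> C * (norm u)\<^sup>2 + \<omega> t)"
    then obtain C \<omega> where C: "0 < C" "integrable M \<omega>" "\<forall>x u. AE t in M. \<theta> x u t \<ge> C * (norm u)\<^sup>2 + \<omega> t"
      by blast
    have "L2_norm M u \<le> sqrt ((c' - integral\<^sup>L M \<omega>) / C)" if "(x, u) \<in> A" "cost T \<theta> (x, u) < c'" for x u
      using coercive_L2_bound[OF \<theta>_continuous C(1) C(2)[unfolded M_def] C(3)[unfolded M_def], of x u c']
        that int by (simp add: A_iff M_def)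
    then show ?thesis by blast
  qed
  then obtain K0 where K0: "\<And>x u. (x, u) \<in> A \<Longrightarrow> cost T \<theta> (x, u) < c' \<Longrightarrow> L2_norm M u \<le> K0"
    by blast
  \<comment> \<open>Including the Slater control keeps whole segments towards the Slater point
    within the bound \<open>K\<close>.\<close>
  define K where "K = max K0 (L2_norm M uh)"
  have K: "0 \<le> K" "L2_norm M uh \<le> K" by (simp_all add: K_def le_max_iff_disj)
  have K': "L2_norm M u \<le> K" if "(x, u) \<in> A" "cost T \<theta> (x, u) < c'" for x u
    using K0[OF that] by (simp add: K_def)
  obtain CF where CF: "0 \<le> CF"
    "\<And>t u. t \<in> {0..T} \<Longrightarrow> u \<in> L2 M \<Longrightarrow> norm (F t u) \<le> CF * L2_norm M u"
    using F_uniformly_bounded[OF T0] unfolding M_def by metis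
  obtain KS where KS: "0 \<le> KS" "\<And>t x. t \<in> {0..T} \<Longrightarrow> norm (S t x) \<le> KS * norm x"
    using C0_semigroup_locally_bounded[OF semigroup, of T] by metis
  \<comment> \<open>The bound follows from \<open>x t = S t x\<^sub>0 + F t u\<close>; the summand 1
    makes \<open>R\<close> positive, as the growth conditions require.\<close>
  define R where "R = KS * norm x\<^sub>0 + CF * K + 1"
  have "0 < R" using KS(1) CF(1) K(1) by (simp add: R_def add_nonneg_pos)
  have xR: "norm (x t) \<le> R" if A: "(x, u) \<in> A" and u: "L2_norm M u \<le> K" and t: "t \<in> {0..T}" for x u t
  proof -
    have "x t = S t x\<^sub>0 + F t u" "u \<in> L2 M" using A t by (auto simp: A_iff)
    then have "norm (x t) \<le> KS * norm x\<^sub>0 + CF * L2_norm M u"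
      using norm_triangle_ineq[of "S t x\<^sub>0" "F t u"] KS(2)[OF t, of x\<^sub>0] CF(2)[OF t, of u] by simp
    also have "\<dots> \<le> R" using mult_left_mono[OF u CF(1)] by (simp add: R_def)
    finally show ?thesis .
  qed
  obtain C \<omega> \<eta> where C: "0 < C" "integrable M \<omega>" "\<eta> \<in> L2 M" "\<forall>x u. \<forall>t\<in>{0<..<T}. norm x \<le> R \<longrightarrow>
      norm (\<theta>\<^sub>x x u t) \<le> C * (norm u)\<^sup>2 + \<omega> t \<and> norm (\<theta>\<^sub>u x u t) \<le> C * norm u + \<eta> t"
    using gradient_growth[rule_format, OF \<open>0 < R\<close>] by auto
  define L where "L = C * K\<^sup>2 + \<bar>integral\<^sup>L M \<omega>\<bar> + 2 * C * K + L2_norm M \<eta>"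
  \<comment> \<open>In \<open>Q\<close> two states differ by at most \<open>2 * R\<close> and two
    controls by at most \<open>2 * K\<close>, so \<open>D\<close> bounds the distance to the Slater
    point.\<close>
  define D where "D = 2 * R + 2 * K + 1"
  \<comment> \<open>Bounding the control instead of the cost makes \<open>Q\<close> convex.\<close>
  define Q where "Q = {z \<in> A. L2_norm M (snd z) \<le> K}"
  have L: "0 \<le> L" using C(1) K(1) by (simp add: L_def)
  have D: "0 < D" using \<open>0 < R\<close> K(1) by (simp add: D_def)
  obtain \<delta> where \<delta>: "0 < \<delta>" "\<And>t j. t \<in> {0..T} \<Longrightarrow> j \<in> {1..l} \<Longrightarrow> g j (xh t) t \<le> - \<delta>"
    using Slater_margin[OF g_continuous xh T0 h(2)] by metis
  have \<phi>_nonneg: "0 \<le> ?\<phi> z" if "z \<in> A" for z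
    using that constraint_violation_bounds(1)[OF g_continuous _ T0] by (cases z) (auto simp: A_iff)
  have lip: "\<bar>cost T \<theta> y - cost T \<theta> z\<bar> \<le> L * X_dist T y z" if "y \<in> Q" "z \<in> Q" for y z
  proof -
    obtain x1 u1 x2 u2 where yz: "y = (x1, u1)" "z = (x2, u2)" by fastforce
    have A: "(x1, u1) \<in> A" "(x2, u2) \<in> A" and u: "L2_norm M u1 \<le> K" "L2_norm M u2 \<le> K"
      using that by (auto simp: Q_def yz)
    show ?thesis
      unfolding yz L_def M_def
      by (rule cost_lipschitz[OF T0 int[unfolded M_def] \<theta>_gradient_x \<theta>_gradient_u less_imp_le[OF C(1)]
            C(2,3)[unfolded M_def] C(4)])
         (use A u xR[OF A(1) u(1)] xR[OF A(2) u(2)] in \<open>auto simp: A_iff M_def\<close>)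
  qed
  have restore: "\<exists>w\<in>Q. X_dist T w z \<le> s * D \<and> 0 < X_dist T w z \<and> ?\<phi> w \<le> max 0 ((1 - s) * ?\<phi> z - s * \<delta>)"
    if z: "z \<in> Q" "0 < ?\<phi> z" and s: "0 < s" "s \<le> 1" for z s
  proof -
    obtain x u where xu: "z = (x, u)" by fastforce
    have A: "(x, u) \<in> A" and uK: "L2_norm M u \<le> K" using z(1) by (auto simp: Q_def xu)
    have x: "continuous_on {0..T} x" and u: "u \<in> L2 M" using A by (auto simp: A_iff)
    \<comment> \<open>Dynamics and end conditions are affine in the pair and \<open>U\<close> is
      convex, so the segment towards the Slater point stays admissible.\<close>
    define y where "y t = (1 - s) *\<^sub>R x t + s *\<^sub>R xh t" for t
    define v where "v t = (1 - s) *\<^sub>R u t + s *\<^sub>R uh t" for t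
    have y: "continuous_on {0..T} y" unfolding y_def by (intro continuous_intros x xh)
    have v: "v \<in> L2 M" unfolding v_def by (intro M.L2_add L2_scaleR u uh)
    have "v \<in> U" unfolding v_def using U(3) A h(1) s by (auto simp: L2_convex_def A_iff)
    moreover have "y T = x\<^sub>T" using A h(1) by (simp add: A_iff y_def flip: scaleR_add_left)
    moreover have "y t = S t x\<^sub>0 + F t v" if t: "t \<in> {0..T}" for t
    proof -
      have L2t: "u \<in> L2 (Leb t)" "uh \<in> L2 (Leb t)"
        using L2_restrict(1)[of t T] t u uh by (auto simp: M)
      have "F t v = (1 - s) *\<^sub>R F t u + s *\<^sub>R F t uh"
        unfolding v_def using t L2t by (simp add: F_add F_scaleR L2_scaleR)
      moreover have "x t = S t x\<^sub>0 + F t u" "xh t = S t x\<^sub>0 + F t uh" using A h(1) t by (auto simp: A_iff)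
      ultimately show ?thesis by (simp add: y_def algebra_simps)
    qed
    ultimately have yvA: "(y, v) \<in> A" using y v by (simp add: A_iff)
    have "L2_norm M v \<le> (1 - s) * L2_norm M u + s * L2_norm M uh"
      unfolding v_def using M.L2_norm_triangle[OF L2_scaleR[OF u, of "1 - s"] L2_scaleR[OF uh, of s]] s
      by (simp add: L2_norm_scaleR)
    also have "\<dots> \<le> (1 - s) * K + s * K" using uK K(2) s by (intro add_mono mult_left_mono) auto
    finally have "(y, v) \<in> Q" using yvA by (simp add: Q_def algebra_simps)
    have diff: "norm (y t - x t) = s * norm (xh t - x t)" for t
    proof -
      have "y t - x t = s *\<^sub>R (xh t - x t)" by (simp add: y_def algebra_simps)
      then show ?thesis using s by simp
    qed
    have "(SUP t\<in>{0..T}. norm (y t - x t)) \<le> s * (2 * R)"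
    proof (rule cSUP_least)
      fix t assume t: "t \<in> {0..T}"
      have "norm (xh t - x t) \<le> 2 * R"
        using norm_triangle_ineq4[of "xh t" "x t"] xR[OF A uK t] xR[OF h(1) K(2) t] by linarith
      then show "norm (y t - x t) \<le> s * (2 * R)" using s by (simp add: diff)
    qed (use T0 in auto)
    moreover have "L2_norm M (\<lambda>t. v t - u t) \<le> s * (2 * K)"
    proof -
      have "(\<lambda>t. v t - u t) = (\<lambda>t. s *\<^sub>R (uh t + (- 1) *\<^sub>R u t))" by (auto simp: v_def algebra_simps)
      then have "L2_norm M (\<lambda>t. v t - u t) = s * L2_norm M (\<lambda>t. uh t + (- 1) *\<^sub>R u t)"
        using s by (simp add: L2_norm_scaleR del: scaleR_minus1_left)
      also have "L2_norm M (\<lambda>t. uh t + (- 1) *\<^sub>R u t) \<le> L2_norm M uh + L2_norm M (\<lambda>t. (- 1) *\<^sub>R u t)"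
        using uh u by (intro M.L2_norm_triangle L2_scaleR)
      also have "\<dots> \<le> 2 * K" using uK K(2) L2_norm_scaleR[of M "- 1" u] by simp
      finally show ?thesis using s by (simp add: mult_left_mono)
    qed
    ultimately have "X_dist T (y, v) z \<le> s * (2 * R) + s * (2 * K)"
      unfolding xu X_dist_Pair M_def by linarith
    also have "\<dots> \<le> s * D" using s by (simp add: D_def algebra_simps)
    finally have dist_le: "X_dist T (y, v) z \<le> s * D" .
    \<comment> \<open>If the states agreed throughout, \<open>z\<close> would satisfy all
      constraints as the Slater point does, against \<open>0 < ?\<phi> z\<close>. So the states
      differ at some time, and the move has positive length.\<close>
    have dist_pos: "0 < X_dist T (y, v) z"
    proof -
      have "\<exists>t\<in>{0..T}. x t \<noteq> xh t"
      proof (rule ccontr)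
        assume "\<not> ?thesis"
        then have "?\<phi> (x, u) \<le> max 0 0"
          using h(2) T0 by (intro constraint_violation_le) (auto intro: less_imp_le)
        then show False using z(2) by (simp add: xu)
      qed
      then obtain t where t: "t \<in> {0..T}" "0 < norm (y t - x t)" using diff s by auto
      have "norm (y t - x t) \<le> (SUP t\<in>{0..T}. norm (y t - x t))"
        by (rule cSUP_upper[OF t(1) bdd_above_norm_diff[OF y x]])
      then show ?thesis
        using t(2) L2_norm_nonneg[of "lebesgue_on {0<..<T}" "\<lambda>t. v t - u t"] unfolding xu X_dist_Pair by linarith
    qed
    \<comment> \<open>Convexity in the state mixes the violation at \<open>z\<close> with the margin
      \<open>- \<delta>\<close> at the Slater point.\<close>
    have "?\<phi> (y, v) \<le> max 0 ((1 - s) * ?\<phi> z - s * \<delta>)"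
    proof (rule constraint_violation_le[OF T0])
      fix j t assume j: "j \<in> {1..l}" and t: "t \<in> {0..T}"
      have "convex_on UNIV (\<lambda>x. g j x t)" using g_convex j t by blast
      then have "g j (y t) t \<le> (1 - s) * g j (x t) t + s * g j (xh t) t"
        unfolding y_def using s by (intro convex_onD) auto
      also have "\<dots> \<le> (1 - s) * ?\<phi> z + s * (- \<delta>)"
        using constraint_violation_bounds(2)[OF g_continuous x T0 j t, of u] \<delta>(2)[OF t j] s
        unfolding xu by (intro add_mono mult_left_mono) auto
      finally show "g j (y t) t \<le> (1 - s) * ?\<phi> z - s * \<delta>" by simp
    qed
    then show ?thesis using \<open>(y, v) \<in> Q\<close> dist_le dist_pos by blast
  qed
  have exact: "completely_exact (X_dist T) (cost T \<theta>) \<Omega> (\<lambda>z. cost T \<theta> z + lam * ?\<phi> z) A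
      {z \<in> A. cost T \<theta> z + lam * ?\<phi> z < c'}" if "L * D / \<delta> + 1 \<le> lam" for lam
  proof (rule completely_exact_on_sublevel[where Q=Q, OF _ _ \<phi>_nonneg _ z0 _ \<delta>(1) L D _ _ lip restore that])
    show "\<Omega> = {z \<in> A. ?\<phi> z = 0}" by (simp add: \<Omega>_def feasible_set_def)
    show "cost T \<theta> z0 < c'" by (simp add: c'_def)
    show "z \<in> Q" if "z \<in> A" "cost T \<theta> z < c'" for z
      using that K' by (cases z) (auto simp: Q_def)
    show "0 \<le> X_dist T y z" if "y \<in> A" "z \<in> A" for y z
      using that by (intro X_dist_nonneg AX T0)
    show "X_dist T x z \<le> X_dist T x y + X_dist T y z" if "x \<in> A" "y \<in> A" "z \<in> A" for x y z
      using that by (intro X_dist_triangle AX T0)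
  qed (auto simp: Q_def)
  have penalty: "penalty T \<theta> l g lam = (\<lambda>z. cost T \<theta> z + lam * ?\<phi> z)" for lam
    by (simp add: fun_eq_iff penalty_def)
  show "\<exists>lam0\<ge>0. \<forall>lam\<ge>lam0. completely_exact (X_dist T) (cost T \<theta>) \<Omega> (penalty T \<theta> l g lam) A
      {z \<in> A. penalty T \<theta> l g lam z < c}"
  proof (intro exI[of _ "L * D / \<delta> + 1"] conjI allI impI)
    show "0 \<le> L * D / \<delta> + 1" using L D \<delta>(1) by simp
    fix lam assume lam: "L * D / \<delta> + 1 \<le> lam"
    \<comment> \<open>The global parts of complete exactness do not mention the set, and the
      pointwise parts are inherited by subsets.\<close>
    have "c \<le> c'" by (simp add: c'_def)
    then have "{z \<in> A. cost T \<theta> z + lam * ?\<phi> z < c} \<subseteq> {z \<in> A. cost T \<theta> z + lam * ?\<phi> z < c'}" by auto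
    then show "completely_exact (X_dist T) (cost T \<theta>) \<Omega> (penalty T \<theta> l g lam) A
        {z \<in> A. penalty T \<theta> l g lam z < c}"
      using exact[OF lam] unfolding penalty completely_exact_def by blast
  qed
qed

end
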